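(* Every two-bridge knot projection $P(a_1, a_2, \ldots, a_n)$ is (1, 3) homotopic to the trivial spherical curve.
   Context: A knot projection is the image of a generic immersion of a (single) circle into the $2$-sphere $S^2$ (the only self-intersections are finitely many transverse double points). Knot projections are considered up to ambient isotopy of $S^2$. The trivial spherical curve is the knot projection with no double points. Deformations (analogues, for curves without over/under information, of the Reidemeister moves). Type 1: locally create or delete a $1$-gon (a small kink containing one double point). Type 3: for an empty $3$-gon formed by three arcs, move one of the arcs across the double point of the other two. Two knot projections are (1, 3) homotopic if they are related by a finite sequence of deformations of types 1 and 3 and ambient isotopies. A vertical twist with $k$ double points ($k\ge 1$) is the image of two arcs in a disc with four boundary endpoints NW, NE, SW, SE, obtained by stacking $k$ simple crossings from top to bottom, the lower-left and lower-right ends of each crossing being joined by disjoint arcs to the upper-left and upper-right ends, respectively, of the next one. A horizontal twist with $k$ double points is obtained from this by a rotation by $90^\circ$ (so the $k$ crossings are placed in a row from left to right). Two-bridge knot projection (projection of the standard Conway form): let $n\ge 1$ and let $a_1,\dots,a_n$ be positive integers. Start with a horizontal twist $R_1$ with $a_1$ double points. For $i = 2,\dots,n$, construct $R_i$ from $R_{i-1}$ as follows. If $i$ is even, place a vertical twist with $a_i$ double points below $R_{i-1}$, joining its NW and NE ends to the SW and SE ends of $R_{i-1}$, respectively. If $i$ is odd, place a horizontal twist with $a_i$ double points to the right of $R_{i-1}$, joining its NW and SW ends to the NE and SE ends of $R_{i-1}$, respectively. Finally, close $R_n$ by two disjoint simple arcs outside the disc, joining NW to NE and SW to SE if $n$ is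 odd, and joining NW to SW and NE to SE if $n$ is even. If the resulting closed curve on $S^2$ is the image of a single circle, it is called the two-bridge knot projection $P(a_1,\dots,a_n)$. *)

theory Defs
  imports "HOL-Analysis.Analysis"
begin

section \<open>Knot projections\<close>

text \<open>The plane is \<open>real \<times> real\<close> and three-space is \<open>real \<times> real \<times> real\<close>; the norm on a
  product type is the Euclidean one.\<close>

type_synonym plane = "real \<times> real"
type_synonym space = "real \<times> real \<times> real"

abbreviation S2 :: "space set" where
  "S2 \<equiv> sphere 0 1"

text \<open>Maps of the circle are maps of the line of period 1, and \<open>{0..<1}\<close> lists the points of
  the circle once.\<close>

definition double_points :: "(real \<Rightarrow> space) \<Rightarrow> space set" where
  "double_points \<gamma> = {p. \<exists>s\<in>{0..<1}. \<exists>t\<in>{0..<1}. s \<noteq> t \<and> \<gamma> s = p \<and> \<gamma> t = p}"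

definition immersion_of_circle :: "(real \<Rightarrow> space) \<Rightarrow> bool" where
  "immersion_of_circle \<gamma> \<longleftrightarrow>
     (\<forall>t. \<gamma> (t + 1) = \<gamma> t) \<and> range \<gamma> \<subseteq> S2 \<and>
     \<gamma> C1_differentiable_on UNIV \<and> (\<forall>t. vector_derivative \<gamma> (at t) \<noteq> 0)"

definition generic_immersion :: "(real \<Rightarrow> space) \<Rightarrow> bool" where
  "generic_immersion \<gamma> \<longleftrightarrow>
     immersion_of_circle \<gamma> \<and>
     finite (double_points \<gamma>) \<and>
     (\<forall>r\<in>{0..<1}. \<forall>s\<in>{0..<1}. \<forall>t\<in>{0..<1}.
        \<gamma> r = \<gamma> s \<and> \<gamma> s = \<gamma> t \<longrightarrow> r = s \<or> s = t \<or> r = t) \<and>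
     (\<forall>s\<in>{0..<1}. \<forall>t\<in>{0..<1}. s \<noteq> t \<and> \<gamma> s = \<gamma> t \<longrightarrow>
        (\<nexists>c. vector_derivative \<gamma> (at s) = c *\<^sub>R vector_derivative \<gamma> (at t)))"

definition knot_projection :: "space set \<Rightarrow> bool" where
  "knot_projection K \<longleftrightarrow> (\<exists>\<gamma>. generic_immersion \<gamma> \<and> K = range \<gamma>)"

definition trivial_spherical_curve :: "space set \<Rightarrow> bool" where
  "trivial_spherical_curve K \<longleftrightarrow>
     (\<exists>\<gamma>. generic_immersion \<gamma> \<and> double_points \<gamma> = {} \<and> K = range \<gamma>)"

definition ambient_isotopic :: "space set \<Rightarrow> space set \<Rightarrow> bool" where
  "ambient_isotopic K L \<longleftrightarrow>
     K \<subseteq> S2 \<and> L \<subseteq> S2 \<and>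
     (\<exists>H :: real \<times> space \<Rightarrow> space.
        continuous_on ({0..1} \<times> S2) H \<and>
        (\<forall>t\<in>{0..1}. \<exists>g. homeomorphism S2 S2 (\<lambda>x. H (t, x)) g) \<and>
        (\<forall>x\<in>S2. H (0, x) = x) \<and>
        (\<lambda>x. H (1, x)) ` K = L)"


section \<open>Deformations of types 1 and 3\<close>

abbreviation unit_square :: "plane set" where
  "unit_square \<equiv> {0..1} \<times> {0..1}"

fun polygonal :: "plane list \<Rightarrow> plane set" where
  "polygonal (p # q # ps) = closed_segment p q \<union> polygonal (q # ps)"
| "polygonal _ = {}"

text \<open>The unit square is the model of a closed disc, and \<open>e\<close> is an embedding of it by compactness.
  As \<open>e\<close> may reverse the orientation, each model picture also stands for its mirror image.\<close>

definition local_replacement :: "plane set \<Rightarrow> plane set \<Rightarrow> space set \<Rightarrow> space set \<Rightarrow> bool" where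
  "local_replacement A B K L \<longleftrightarrow>
     K \<subseteq> S2 \<and> L \<subseteq> S2 \<and>
     (\<exists>e. continuous_on unit_square e \<and> inj_on e unit_square \<and> e ` unit_square \<subseteq> S2 \<and>
        K \<inter> e ` unit_square = e ` A \<and>
        L \<inter> e ` unit_square = e ` B \<and>
        K - e ` unit_square = L - e ` unit_square)"

text \<open>The two long edges of the kink cross at \<open>(1/2, 2/3)\<close>; with the edge at height \<open>3/4\<close> they bound
  the 1-gon.\<close>

definition type1_deformation :: "space set \<Rightarrow> space set \<Rightarrow> bool" where
  "type1_deformation =
     local_replacement
       (polygonal [(0, 1/2), (1, 1/2)])
       (polygonal [(0, 1/2), (3/4, 3/4), (1/4, 3/4), (1, 1/2)])"

definition crossing :: "plane set" where
  "crossing = polygonal [(0, 0), (1, 1)] \<union> polygonal [(0, 1), (1, 0)]"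

text \<open>The third arc passes from above to below the double point \<open>(1/2, 1/2)\<close> of the diagonals.\<close>

definition type3_deformation :: "space set \<Rightarrow> space set \<Rightarrow> bool" where
  "type3_deformation =
     local_replacement
       (crossing \<union> polygonal [(0, 1/2), (1/2, 3/4), (1, 1/2)])
       (crossing \<union> polygonal [(0, 1/2), (1/2, 1/4), (1, 1/2)])"

text \<open>The intermediate sets in a sequence of deformations need no separate condition: ambient
  isotopies and the two local replacements take the image of one circle with transverse double points
  to another such image, up to a homeomorphism of the sphere.\<close>

definition one_three_homotopic :: "space set \<Rightarrow> space set \<Rightarrow> bool" where
  "one_three_homotopic K L \<longleftrightarrow>
     knot_projection K \<and> knot_projection L \<and>
     equivclp (\<lambda>K L. ambient_isotopic K L \<or> type1_deformation K L \<or> type3_deformation K L) K L"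


section \<open>Two-bridge knot projections\<close>

text \<open>A tangle is drawn in the unit square. It meets the boundary exactly in the four corners, which
  are its ends. Composites put scaled copies of the two tangles in small squares of side \<open>1/4\<close> and
  join the corners by segments.\<close>

definition shrink :: "plane \<Rightarrow> plane set \<Rightarrow> plane set" where
  "shrink p S = (\<lambda>z. p + (1/4) *\<^sub>R z) ` S"

definition stack :: "plane set \<Rightarrow> plane set \<Rightarrow> plane set" where
  "stack S T =
     shrink (3/8, 5/8) S \<union> shrink (3/8, 1/8) T \<union>
     polygonal [(0, 1), (3/8, 7/8)] \<union> polygonal [(1, 1), (5/8, 7/8)] \<union>
     polygonal [(3/8, 5/8), (3/8, 3/8)] \<union> polygonal [(5/8, 5/8), (5/8, 3/8)] \<union>
     polygonal [(3/8, 1/8), (0, 0)] \<union> polygonal [(5/8, 1/8), (1, 0)]"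

definition juxtapose :: "plane set \<Rightarrow> plane set \<Rightarrow> plane set" where
  "juxtapose S T =
     shrink (1/8, 3/8) S \<union> shrink (5/8, 3/8) T \<union>
     polygonal [(0, 1), (1/8, 5/8)] \<union> polygonal [(0, 0), (1/8, 3/8)] \<union>
     polygonal [(3/8, 5/8), (5/8, 5/8)] \<union> polygonal [(3/8, 3/8), (5/8, 3/8)] \<union>
     polygonal [(7/8, 5/8), (1, 1)] \<union> polygonal [(7/8, 3/8), (1, 0)]"

text \<open>The value at \<open>0\<close> of the next three functions is a dummy.\<close>

fun vertical_twist :: "nat \<Rightarrow> plane set" where
  "vertical_twist 0 = {}"
| "vertical_twist (Suc 0) = crossing"
| "vertical_twist (Suc (Suc k)) = stack (vertical_twist (Suc k)) crossing"

fun horizontal_twist :: "nat \<Rightarrow> plane set" where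
  "horizontal_twist 0 = {}"
| "horizontal_twist (Suc 0) = crossing"
| "horizontal_twist (Suc (Suc k)) = juxtapose (horizontal_twist (Suc k)) crossing"

fun conway_tangle :: "(nat \<Rightarrow> nat) \<Rightarrow> nat \<Rightarrow> plane set" where
  "conway_tangle a 0 = {}"
| "conway_tangle a (Suc 0) = horizontal_twist (a 1)"
| "conway_tangle a (Suc (Suc i)) =
     (if even (Suc (Suc i))
      then stack (conway_tangle a (Suc i)) (vertical_twist (a (Suc (Suc i))))
      else juxtapose (conway_tangle a (Suc i)) (horizontal_twist (a (Suc (Suc i)))))"

definition conway_closure :: "(nat \<Rightarrow> nat) \<Rightarrow> nat \<Rightarrow> plane set" where
  "conway_closure a n =
     conway_tangle a n \<union>
     (if odd n
      then polygonal [(0, 1), (1/2, 2), (1, 1)] \<union> polygonal [(0, 0), (1/2, -1), (1, 0)]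
      else polygonal [(0, 1), (-1, 1/2), (0, 0)] \<union> polygonal [(1, 1), (2, 1/2), (1, 0)])"

definition inverse_stereographic :: "plane \<Rightarrow> space" where
  "inverse_stereographic = (\<lambda>(x, y).
     (2 * x / (x\<^sup>2 + y\<^sup>2 + 1), 2 * y / (x\<^sup>2 + y\<^sup>2 + 1), (x\<^sup>2 + y\<^sup>2 - 1) / (x\<^sup>2 + y\<^sup>2 + 1)))"

text \<open>The polygonal model has corners, so it is not itself the image of an immersion. Projections are
  taken up to ambient isotopy, and \<open>knot_projection K\<close> says that the curve comes from a single
  circle.\<close>

definition two_bridge_knot_projection :: "(nat \<Rightarrow> nat) \<Rightarrow> nat \<Rightarrow> space set \<Rightarrow> bool" where
  "two_bridge_knot_projection a n K \<longleftrightarrow>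
     knot_projection K \<and> ambient_isotopic (inverse_stereographic ` conway_closure a n) K"

end

theory Submission
  imports Defs
begin
text \<open>Let \<open>a\<close> and \<open>b\<close> add a crossing to a tangle on the right and below. One deformation of type 3
  gives the braid relation \<open>aba = bab\<close>. Starting from the zero and the infinity tangle, on which
  \<open>b\<close> and \<open>a\<close> respectively create only a kink, it follows that a row of an even number of crossings
  absorbs crossings added below, that a column of an even number absorbs crossings added on the right,
  and that a row and a column of the same odd length agree. So every Conway tangle becomes a row or a
  column, and which one, up to parity, is decided by how the four ends are joined. Kinks untwist the
  closure, except when it consists of two strands that are closed up separately. This case does not
  occur for a knot projection: if a curve is the union of two closed sets that cross transversally at
  every common point, it never changes from one to the other, so one of them contains the other.

  The plane isotopies behind these relations are explicit sequences of moves of pictures with integer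
  coordinates: a vertex is pushed along a segment, or a box that contains an arbitrary tangle is moved
  with straight legs attached to its corners. The sequences come from a computer search; a soundness
  theorem reduces their correctness to integer arithmetic.\<close>


section \<open>Planar deformations\<close>

text \<open>An ambient isotopy of the sphere is a family of homeomorphisms, but the Alexander trick
  contracts any plane homeomorphism of bounded support to the identity. So one homeomorphism per
  move is enough, and no planar isotopy is written down as a function of time. Every planar relation
  carries the region that supports it: a relation confined to the open square can be used again
  inside a larger tangle, where the rest of the picture must not move. The parity statements rest on
  the half turn \<open>aba\<close>, which by the braid relation conjugates \<open>a\<close> into
  \<open>b\<close>. Applied to a column of \<open>m\<close> crossings it gives a row of
  \<open>m + 2\<close> and vice versa, so these statements are inductions in steps of two. The
  excluded case has an obstacle of its own. A knot projection is smooth and transversal, the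
  polygonal model has straight crossings, and the homeomorphism between them need not preserve
  either notion. That a smooth branch corresponds to two opposite rays of a straight crossing has
  therefore to be derived from the sides on which the branches lie.\<close>

definition supported_homeo :: "plane set \<Rightarrow> (plane \<Rightarrow> plane) \<Rightarrow> bool" where
  "supported_homeo R h \<longleftrightarrow> (\<exists>g. homeomorphism UNIV UNIV h g) \<and> (\<forall>z. z \<notin> R \<longrightarrow> h z = z)"

text \<open>Invariance of domain makes the range open. Outside a large ball the map is the identity,
  and the image of the closed ball is compact, so the range is also closed and hence the whole
  plane. Surjectivity thus comes for free.\<close>

lemma supported_homeoI:
  assumes cont: "continuous_on UNIV h" and inj: "inj h" and R: "bounded R"
    and fix_out: "\<And>z. z \<notin> R \<Longrightarrow> h z = z"
  shows "supported_homeo R h"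
proof -
  obtain g where g: "homeomorphism UNIV (range h) h g"
    using invariance_of_domain_homeomorphism[of UNIV h] cont inj by auto
  have op: "open (range h)"
    using invariance_of_domain[of UNIV h] cont inj by auto
  obtain r where r: "R \<subseteq> ball 0 r"
    using R bounded_subset_ballD by blast
  have out: "h ` (- ball 0 r) = - ball 0 r"
    using r fix_out by (force simp: image_iff)
  have "cball 0 r \<union> - ball 0 r = (UNIV :: plane set)"
    using ball_subset_cball by blast
  then have "range h = h ` cball 0 r \<union> h ` (- ball 0 r)"
    by (metis image_Un)
  then have "range h = h ` cball 0 r \<union> (- ball 0 r)" by (simp only: out)
  moreover have "closed (h ` cball 0 r)"
    using cont by (intro compact_imp_closed compact_continuous_image) (auto intro: continuous_on_subset)
  ultimately have "closed (range h)" by (metis closed_Compl closed_Un open_ball)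
  then have "range h = UNIV" using op clopen by blast
  then show ?thesis using g fix_out unfolding supported_homeo_def by auto
qed

definition replaces :: "(plane \<Rightarrow> plane) \<Rightarrow> plane set \<Rightarrow> plane set \<Rightarrow> plane set \<Rightarrow> plane set \<Rightarrow> bool" where
  "replaces e A B P Q \<longleftrightarrow> P \<inter> e ` unit_square = e ` A \<and> Q \<inter> e ` unit_square = e ` B \<and>
     P - e ` unit_square = Q - e ` unit_square"

definition local_models :: "(plane set \<times> plane set) set" where
  "local_models =
    {(polygonal [(0, 1/2), (1, 1/2)], polygonal [(0, 1/2), (3/4, 3/4), (1/4, 3/4), (1, 1/2)]),
     (crossing \<union> polygonal [(0, 1/2), (1/2, 3/4), (1, 1/2)],
      crossing \<union> polygonal [(0, 1/2), (1/2, 1/4), (1, 1/2)])}"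

definition frame :: "plane \<Rightarrow> plane \<Rightarrow> plane \<Rightarrow> plane \<Rightarrow> plane" where
  "frame p u v z = p + fst z *\<^sub>R u + snd z *\<^sub>R v"

text \<open>The discs of the local replacements are affine parallelograms, so that injectivity of
  the chart is a determinant condition. Both clauses are confined to \<open>R\<close>: outside it
  the picture does not change, which allows the deformation to be repeated inside a larger
  picture.\<close>

definition elementary :: "plane set \<Rightarrow> plane set \<Rightarrow> plane set \<Rightarrow> bool" where
  "elementary R P Q \<longleftrightarrow>
     (\<exists>h. supported_homeo R h \<and> Q = h ` P) \<or>
     (\<exists>p u v A B. (A, B) \<in> local_models \<and> inj (frame p u v) \<and> frame p u v ` unit_square \<subseteq> R \<and>
        replaces (frame p u v) A B P Q)"

definition planar_eq :: "plane set \<Rightarrow> plane set \<Rightarrow> plane set \<Rightarrow> bool" where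
  "planar_eq R = equivclp (elementary R)"

lemma planar_eq_refl [simp]: "planar_eq R P P"
  by (simp add: planar_eq_def)

lemma planar_eq_sym: "planar_eq R P Q \<Longrightarrow> planar_eq R Q P"
  by (simp add: planar_eq_def equivclp_sym)

lemma planar_eq_trans [trans]: "planar_eq R P Q \<Longrightarrow> planar_eq R Q S \<Longrightarrow> planar_eq R P S"
  unfolding planar_eq_def by (rule equivclp_trans)

lemma planar_eq_elementary: "elementary R P Q \<Longrightarrow> planar_eq R P Q"
  by (auto simp: planar_eq_def)

lemma planar_eq_homeo: "supported_homeo R h \<Longrightarrow> planar_eq R P (h ` P)"
  by (rule planar_eq_elementary, unfold elementary_def, rule disjI1, rule exI[of _ h], rule conjI) (rule refl | assumption)+

lemma planar_eq_replaces:
  assumes "(A, B) \<in> local_models" "inj (frame p u v)" "frame p u v ` unit_square \<subseteq> R"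
    "replaces (frame p u v) A B P Q"
  shows "planar_eq R P Q"
  by (rule planar_eq_elementary, unfold elementary_def, rule disjI2)
    (rule exI[of _ p], rule exI[of _ u], rule exI[of _ v], rule exI[of _ A], rule exI[of _ B],
      intro conjI, (rule assms)+)

section \<open>Transport of deformations by affine maps\<close>

lemma equivclp_transport:
  assumes "equivclp r x y" and "\<And>x y. r x y \<Longrightarrow> equivclp s (f x) (f y)"
  shows "equivclp s (f x) (f y)"
  using assms(1)
proof (induction rule: equivclp_induct)
  case base
  show ?case by simp
next
  case (step y z)
  have "equivclp s (f y) (f z)"
    using step.hyps(2) assms(2) equivclp_sym by metis
  then show ?case using step.IH equivclp_trans by metis
qed

lemma frame_affine:
  assumes "linear L"
  shows "c + L (frame p u v z) = frame (c + L p) (L u) (L v) z"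
  by (simp add: frame_def linear_add[OF assms] linear_scale[OF assms] algebra_simps)

text \<open>The affine map \<open>c + L z\<close> conjugates a homeomorphism supported in
  \<open>R\<close> to one supported in the image of \<open>R\<close>, and it carries parallelograms
  to parallelograms. The remainder \<open>W\<close> misses this image, so it is fixed in the first
  case and lies outside the disc in the second.\<close>

lemma elementary_context:
  fixes L :: "plane \<Rightarrow> plane"
  assumes L: "linear L" "inj L" and el: "elementary R P Q"
    and R': "(\<lambda>z. c + L z) ` R \<subseteq> R'" and W: "W \<inter> (\<lambda>z. c + L z) ` R = {}"
  shows "elementary R' ((\<lambda>z. c + L z) ` P \<union> W) ((\<lambda>z. c + L z) ` Q \<union> W)"
proof -
  define T where "T = (\<lambda>z. c + L z)"
  obtain M where M: "linear M" "\<And>x. M (L x) = x" "\<And>x. L (M x) = x"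
    using linear_injective_isomorphism[OF L] by auto
  define T' where "T' = (\<lambda>z. M (z - c))"
  have TT': "T (T' z) = z" "T' (T z) = z" for z by (simp_all add: T_def T'_def M)
  have cT: "continuous_on S T" for S
    unfolding T_def by (intro continuous_intros linear_continuous_on linear_conv_bounded_linear[THEN iffD1] L)
  have cT': "continuous_on S T'" for S
    unfolding T'_def
    by (rule continuous_on_compose2[of UNIV M], intro linear_continuous_on linear_conv_bounded_linear[THEN iffD1] M)
       (auto intro!: continuous_intros)
  have injT: "inj T" using TT'(2) by (metis injI)
  consider (homeo) h where "supported_homeo R h" "Q = h ` P"
    | (loc) p u v A B where "(A, B) \<in> local_models" "inj (frame p u v)" "frame p u v ` unit_square \<subseteq> R"
        "replaces (frame p u v) A B P Q"
    using el unfolding elementary_def by blast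
  then have "elementary R' (T ` P \<union> W) (T ` Q \<union> W)"
  proof cases
    case homeo
    obtain g where g: "homeomorphism UNIV UNIV h g" and fx: "\<And>z. z \<notin> R \<Longrightarrow> h z = z"
      using homeo(1) unfolding supported_homeo_def by auto
    define h' where "h' = T \<circ> h \<circ> T'"
    have hg: "h (g z) = z" "g (h z) = z" for z using g unfolding homeomorphism_def by blast+
    have conj: "continuous_on UNIV (T \<circ> k \<circ> T')" if k: "continuous_on UNIV k" for k
    proof -
      have "continuous_on UNIV (k \<circ> T')"
        by (rule continuous_on_compose[OF cT' continuous_on_subset[OF k subset_UNIV]])
      from continuous_on_compose[OF this cT] show ?thesis by (simp only: comp_assoc)
    qed
    have "homeomorphism UNIV UNIV h' (T \<circ> g \<circ> T')"
    proof (rule homeomorphismI)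
      show "continuous_on UNIV h'" "continuous_on UNIV (T \<circ> g \<circ> T')"
        using conj[OF homeomorphism_cont1[OF g]] conj[OF homeomorphism_cont2[OF g]]
        by (simp_all only: h'_def)
    qed (auto simp: h'_def TT' hg)
    moreover have fx': "h' z = z" if "z \<notin> T ` R" for z
    proof -
      have "T' z \<notin> R" using that TT'(1) by (metis imageI)
      then show ?thesis by (simp add: h'_def fx TT')
    qed
    moreover have "z \<notin> T ` R" if "z \<notin> R'" for z using that R' unfolding T_def[symmetric] by blast
    ultimately have "supported_homeo R' h'"
      unfolding supported_homeo_def by metis
    moreover have "T ` Q \<union> W = h' ` (T ` P \<union> W)"
    proof -
      have "h' ` (T ` P) = T ` Q" by (simp add: h'_def homeo(2) TT' image_image)
      moreover have "h' ` W = W"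
      proof -
        have "h' z = z" if "z \<in> W" for z using that W fx' unfolding T_def[symmetric] by blast
        then show ?thesis by simp
      qed
      ultimately show ?thesis by (simp add: image_Un)
    qed
    ultimately show ?thesis unfolding elementary_def by (intro disjI1 exI[of _ h'] conjI)
  next
    case loc
    define e where "e = frame p u v"
    define e' where "e' = frame (T p) (L u) (L v)"
    have e': "e' = T \<circ> e"
      unfolding e'_def e_def T_def by (auto simp: frame_affine[OF L(1)])
    have im: "e' ` S = T ` (e ` S)" for S by (simp add: e' image_comp)
    have sub: "e ` unit_square \<subseteq> R" using loc(3) by (simp add: e_def)
    have Wd: "W \<inter> T ` (e ` unit_square) = {}" using W sub unfolding T_def[symmetric] by blast
    have rep: "P \<inter> e ` unit_square = e ` A" "Q \<inter> e ` unit_square = e ` B"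
      "P - e ` unit_square = Q - e ` unit_square"
      using loc(4) by (auto simp: replaces_def e_def)
    have "replaces e' A B (T ` P \<union> W) (T ` Q \<union> W)"
    proof -
      have "T ` P \<inter> T ` (e ` unit_square) = T ` (e ` A)" "T ` Q \<inter> T ` (e ` unit_square) = T ` (e ` B)"
        by (simp_all only: image_Int[OF injT, symmetric] rep)
      moreover have "T ` P - T ` (e ` unit_square) = T ` Q - T ` (e ` unit_square)"
        by (simp only: image_set_diff[OF injT, symmetric] rep)
      ultimately show ?thesis unfolding replaces_def im by (simp add: Int_Un_distrib2 Un_Diff Wd)
    qed
    moreover have "inj e'"
      using inj_compose[OF injT loc(2)] by (simp add: e' e_def)
    moreover have "e' ` unit_square \<subseteq> R'"
      using sub R' unfolding im T_def[symmetric] by blast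
    ultimately show ?thesis using loc(1) unfolding elementary_def e'_def
      by (intro disjI2 exI[of _ "T p"] exI[of _ "L u"] exI[of _ "L v"] exI[of _ A] exI[of _ B] conjI)
  qed
  then show ?thesis by (simp add: T_def)
qed

lemma planar_eq_context:
  fixes L :: "plane \<Rightarrow> plane"
  assumes "linear L" "inj L" "planar_eq R P Q"
    and "(\<lambda>z. c + L z) ` R \<subseteq> R'" and "W \<inter> (\<lambda>z. c + L z) ` R = {}"
  shows "planar_eq R' ((\<lambda>z. c + L z) ` P \<union> W) ((\<lambda>z. c + L z) ` Q \<union> W)"
  using equivclp_transport[of "elementary R" P Q "elementary R'" "\<lambda>P. (\<lambda>z. c + L z) ` P \<union> W"]
    elementary_context assms unfolding planar_eq_def by blast

definition open_box :: "real \<Rightarrow> real \<Rightarrow> plane set" where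
  "open_box lo hi = {lo<..<hi} \<times> {lo<..<hi}"

lemma bounded_open_box [simp]: "bounded (open_box lo hi)"
proof -
  have "open_box lo hi \<subseteq> {lo..hi} \<times> {lo..hi}" by (auto simp: open_box_def)
  then show ?thesis using bounded_subset compact_imp_bounded compact_Times compact_Icc by metis
qed

subsection \<open>Moving a vertex\<close>

text \<open>A vertex is moved by \<open>z \<mapsto> z + \<phi> z (w - v)\<close> with a tent function \<open>\<phi>\<close>. This map is injective
  because \<open>\<phi>\<close> decreases with slope less than 1 in the direction \<open>w - v\<close>, a condition
  that survives minima and maxima.\<close>

definition slow_decay :: "plane \<Rightarrow> (plane \<Rightarrow> real) \<Rightarrow> bool" where
  "slow_decay d g \<longleftrightarrow> (\<forall>z t. t > 0 \<longrightarrow> g (z + t *\<^sub>R d) > g z - t)"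

text \<open>The values on the empty list matter: the minimum is cut off at 1, the height of a tent
  at its vertex, and the maximum at 0, so that everything outside the tents stays fixed.\<close>

fun min_list_fun :: "(plane \<Rightarrow> real) list \<Rightarrow> plane \<Rightarrow> real" where
  "min_list_fun [] z = 1"
| "min_list_fun (f # fs) z = min (f z) (min_list_fun fs z)"

fun max_list_fun :: "(plane \<Rightarrow> real) list \<Rightarrow> plane \<Rightarrow> real" where
  "max_list_fun [] z = 0"
| "max_list_fun (f # fs) z = max (f z) (max_list_fun fs z)"

lemma slow_decay_min_max:
  assumes "slow_decay d f" "slow_decay d g"
  shows "slow_decay d (\<lambda>z. min (f z) (g z))" "slow_decay d (\<lambda>z. max (f z) (g z))"
  unfolding slow_decay_def
proof (safe del: split_paired_All)
  fix z and t :: real assume "0 < t"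
  then have "f z - t < f (z + t *\<^sub>R d)" "g z - t < g (z + t *\<^sub>R d)"
    using assms unfolding slow_decay_def by blast+
  then show "min (f z) (g z) - t < min (f (z + t *\<^sub>R d)) (g (z + t *\<^sub>R d))"
    "max (f z) (g z) - t < max (f (z + t *\<^sub>R d)) (g (z + t *\<^sub>R d))" by linarith+
qed

lemma slow_decay_const [simp]: "slow_decay d (\<lambda>z. c)"
  by (simp add: slow_decay_def)

lemma slow_decay_min_list_fun:
  "(\<And>f. f \<in> set fs \<Longrightarrow> slow_decay d f) \<Longrightarrow> slow_decay d (min_list_fun fs)"
  by (induction fs) (auto intro: slow_decay_min_max simp: min_list_fun.simps[abs_def])

lemma slow_decay_max_list_fun:
  "(\<And>f. f \<in> set fs \<Longrightarrow> slow_decay d f) \<Longrightarrow> slow_decay d (max_list_fun fs)"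
  by (induction fs) (auto intro: slow_decay_min_max simp: max_list_fun.simps[abs_def])

lemma continuous_min_list_fun:
  "(\<And>f. f \<in> set fs \<Longrightarrow> continuous_on UNIV f) \<Longrightarrow> continuous_on UNIV (min_list_fun fs)"
  by (induction fs) (auto intro!: continuous_intros)

lemma continuous_max_list_fun:
  "(\<And>f. f \<in> set fs \<Longrightarrow> continuous_on UNIV f) \<Longrightarrow> continuous_on UNIV (max_list_fun fs)"
  by (induction fs) (auto intro!: continuous_intros)

lemma min_list_fun_le: "f \<in> set fs \<Longrightarrow> min_list_fun fs z \<le> f z"
  by (induction fs) (auto simp: min_le_iff_disj)

lemma min_list_fun_ge: "c \<le> 1 \<Longrightarrow> (\<And>f. f \<in> set fs \<Longrightarrow> c \<le> f z) \<Longrightarrow> c \<le> min_list_fun fs z"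
  by (induction fs) auto

lemma max_list_fun_ge: "f \<in> set fs \<Longrightarrow> f z \<le> max_list_fun fs z"
  by (induction fs) (auto simp: le_max_iff_disj)

lemma max_list_fun_nonneg: "0 \<le> max_list_fun fs z"
  by (induction fs) (auto simp: le_max_iff_disj)

lemma max_list_fun_le: "0 \<le> c \<Longrightarrow> (\<And>f. f \<in> set fs \<Longrightarrow> f z \<le> c) \<Longrightarrow> max_list_fun fs z \<le> c"
  by (induction fs) auto

lemma supported_homeo_push:
  assumes R: "bounded R" and cont: "continuous_on UNIV \<phi>" and slow: "slow_decay d \<phi>"
    and zero: "\<And>z. z \<notin> R \<Longrightarrow> \<phi> z = 0"
  shows "supported_homeo R (\<lambda>z. z + \<phi> z *\<^sub>R d)"
proof (rule supported_homeoI[OF _ _ R])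
  show "continuous_on UNIV (\<lambda>z. z + \<phi> z *\<^sub>R d)"
    using cont by (intro continuous_intros)
  have aux: "\<phi> z = \<phi> w" if eq: "z + \<phi> z *\<^sub>R d = w + \<phi> w *\<^sub>R d" and le: "\<phi> z \<le> \<phi> w" for z w
  proof (rule ccontr)
    assume "\<phi> z \<noteq> \<phi> w"
    then have pos: "\<phi> w - \<phi> z > 0" using le by simp
    have "z = w + (\<phi> w - \<phi> z) *\<^sub>R d"
      using eq by (simp add: algebra_simps)
    moreover have "\<phi> (w + (\<phi> w - \<phi> z) *\<^sub>R d) > \<phi> w - (\<phi> w - \<phi> z)"
      using slow pos unfolding slow_decay_def by blast
    ultimately show False by simp
  qed
  show "inj (\<lambda>z. z + \<phi> z *\<^sub>R d)"
  proof (rule injI)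
    fix z w assume eq: "z + \<phi> z *\<^sub>R d = w + \<phi> w *\<^sub>R d"
    then have "\<phi> z = \<phi> w" using aux[OF eq] aux[OF eq[symmetric]] by (cases "\<phi> z \<le> \<phi> w") auto
    then show "z = w" using eq by simp
  qed
qed (simp add: zero)

subsection \<open>Moving a box\<close>

text \<open>\<open>grow p l\<close> maps the concentric square of half the side affinely onto the square
  \<open>p + l *\<^sub>R unit_square\<close> and the segments between corresponding boundary points linearly.\<close>

definition ring_gauge :: "plane \<Rightarrow> real" where
  "ring_gauge z = max (1/2) (min 1 (max \<bar>2 * fst z - 1\<bar> \<bar>2 * snd z - 1\<bar>))"

text \<open>On the inner square, where the gauge is 1/2, this is the affine map onto the unit
  square; on the ring it is the radial projection to the boundary; outside it is the identity.
  Clamping the gauge yields all three from one continuous formula.\<close>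

definition ring_point :: "plane \<Rightarrow> plane" where
  "ring_point z = (1/2, 1/2) + (1 / ring_gauge z) *\<^sub>R (z - (1/2, 1/2))"

text \<open>A convex combination of \<open>p + l *\<^sub>R ring_point z\<close> and
  \<open>ring_point z\<close> with the weights \<open>2 - 2 * ring_gauge z\<close> and
  \<open>2 * ring_gauge z - 1\<close>. The former weight is 1 on the inner square and 0
  outside.\<close>

definition grow :: "plane \<Rightarrow> real \<Rightarrow> plane \<Rightarrow> plane" where
  "grow p l z = (2 - 2 * ring_gauge z) *\<^sub>R p +
     ((2 - 2 * ring_gauge z) * l + 2 * ring_gauge z - 1) *\<^sub>R ring_point z"

lemma ring_gauge_bounds: "1/2 \<le> ring_gauge z" "ring_gauge z \<le> 1"
  by (auto simp: ring_gauge_def)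

lemma continuous_grow: "continuous_on UNIV (grow p l)"
proof -
  have g: "continuous_on UNIV ring_gauge"
    unfolding ring_gauge_def by (intro continuous_intros)
  have nz: "ring_gauge z \<noteq> 0" for z using ring_gauge_bounds[of z] by linarith
  show ?thesis
    unfolding grow_def ring_point_def by (intro continuous_intros g) (auto simp: nz)
qed

lemma grow_outside: "z \<notin> open_box 0 1 \<Longrightarrow> grow p l z = z"
proof -
  assume "z \<notin> open_box 0 1"
  then have "1 \<le> max \<bar>2 * fst z - 1\<bar> \<bar>2 * snd z - 1\<bar>"
    by (cases z) (auto simp: open_box_def le_max_iff_disj abs_if split: if_splits)
  then have "ring_gauge z = 1" by (auto simp: ring_gauge_def)
  then show ?thesis by (simp add: grow_def ring_point_def)
qed

lemma grow_box:
  assumes "w \<in> unit_square"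
  shows "grow p l ((1/4, 1/4) + (1/2) *\<^sub>R w) = p + l *\<^sub>R w"
proof -
  obtain x y where w: "w = (x, y)" by force
  define z where "z = (1/4, 1/4) + (1/2) *\<^sub>R w"
  have g: "ring_gauge z = 1/2"
    using assms by (auto simp: ring_gauge_def w z_def abs_if field_simps min_def max_def)
  have "ring_point z = w"
    unfolding ring_point_def g by (simp add: w z_def)
  then show ?thesis unfolding z_def[symmetric] by (simp add: grow_def g)
qed

lemma grow_leg:
  assumes c: "fst c \<in> {0, 1}" "snd c \<in> {0, 1}" and s: "0 \<le> s" "s \<le> 1"
  shows "grow p l ((1 - s) *\<^sub>R c + s *\<^sub>R ((1/4, 1/4) + (1/2) *\<^sub>R c)) = (1 - s) *\<^sub>R c + s *\<^sub>R (p + l *\<^sub>R c)"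
proof -
  obtain x y where xy: "c = (x, y)" by force
  define z where "z = (1 - s) *\<^sub>R c + s *\<^sub>R ((1/4, 1/4) + (1/2) *\<^sub>R c)"
  have g: "ring_gauge z = 1 - s/2"
    using c s by (auto simp: ring_gauge_def xy z_def abs_if field_simps min_def max_def)
  have "z - (1/2, 1/2) = (1 - s/2) *\<^sub>R (c - (1/2, 1/2))"
    by (simp add: xy z_def field_simps)
  then have "ring_point z = c"
    using s by (simp add: ring_point_def g)
  then show ?thesis unfolding z_def[symmetric]
    by (simp add: grow_def g algebra_simps)
qed

text \<open>The contraction \<open>w \<mapsto> p + l w\<close> has a fixed point \<open>f\<close>
  inside the square, and \<open>grow\<close> scales \<open>ring_point z\<close> about
  \<open>f\<close> by a factor \<open>k\<close> between \<open>l\<close> and 1. Measured by the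
  gauge of the square about \<open>f\<close>, images of the inner square have values at most
  \<open>l\<close>, the image of a point of the ring has the value \<open>k\<close>, strictly
  between \<open>l\<close> and 1, and outside points have values at least 1. Thus the image
  determines \<open>k\<close>, hence \<open>ring_gauge z\<close>, hence \<open>z\<close>.\<close>

lemma inj_grow:
  assumes l: "0 < l" and p: "0 < fst p" "fst p + l < 1" "0 < snd p" "snd p + l < 1"
  shows "inj (grow p l)"
proof -
  have l1: "l < 1" using p by linarith
  define f where "f = (1 / (1 - l)) *\<^sub>R p"
  have fp: "p = (1 - l) *\<^sub>R f" using l1 by (simp add: f_def)
  have f: "0 < fst f" "fst f < 1" "0 < snd f" "snd f < 1"
    using p l1 by (auto simp: f_def field_simps)
  \<comment> \<open>The Minkowski functional of the unit square with respect to \<open>f\<close>;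
    the four denominators are the distances from \<open>f\<close> to the sides.\<close>
  define G where "G = (\<lambda>z::plane. max (max ((fst z - fst f) / (1 - fst f)) ((fst f - fst z) / fst f))
      (max ((snd z - snd f) / (1 - snd f)) ((snd f - snd z) / snd f)))"
  define k where "k = (\<lambda>z. (2 - 2 * ring_gauge z) * l + 2 * ring_gauge z - 1)"
  have kp: "k z > 0" for z
  proof -
    have "(2 - 2 * ring_gauge z) * l \<ge> 0" using ring_gauge_bounds[of z] l by simp
    moreover have "2 * ring_gauge z - 1 \<ge> 0" using ring_gauge_bounds[of z] by simp
    moreover have "(2 - 2 * ring_gauge z) * l > 0 \<or> 2 * ring_gauge z - 1 > 0"
      using l by (cases "ring_gauge z > 1/2") (auto simp: mult_less_cancel_right)
    ultimately show ?thesis unfolding k_def by linarith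
  qed
  have grow_eq: "grow p l z = f + k z *\<^sub>R (ring_point z - f)" for z
    by (simp add: grow_def k_def fp algebra_simps scaleR_2)
  have max_mult: "max (c * a) (c * b) = c * max a b" if "c \<ge> 0" for a b c :: real
    using that by (simp add: max_mult_distrib_left)
  have Gscale: "G (f + c *\<^sub>R (w - f)) = c * G w" if "c > 0" for c w
  proof -
    have "(fst (f + c *\<^sub>R (w - f)) - fst f) / (1 - fst f) = c * ((fst w - fst f) / (1 - fst f))"
      "(fst f - fst (f + c *\<^sub>R (w - f))) / fst f = c * ((fst f - fst w) / fst f)"
      "(snd (f + c *\<^sub>R (w - f)) - snd f) / (1 - snd f) = c * ((snd w - snd f) / (1 - snd f))"
      "(snd f - snd (f + c *\<^sub>R (w - f))) / snd f = c * ((snd f - snd w) / snd f)"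
      by (auto simp: algebra_simps)
    then show ?thesis using that by (simp only: G_def max_mult less_imp_le)
  qed
  have Gk: "G (grow p l z) = k z * G (ring_point z)" for z
    unfolding grow_eq by (rule Gscale[OF kp])
  define n where "n = (\<lambda>z::plane. max \<bar>2 * fst z - 1\<bar> \<bar>2 * snd z - 1\<bar>)"
  have Gle: "G w \<le> 1" if "n w \<le> 1" for w
    using that f unfolding G_def n_def by (auto simp: abs_le_iff field_simps)
  have Gge: "1 \<le> G w" if "1 \<le> n w" for w
    using that f unfolding G_def n_def
    by (auto simp: le_max_iff_disj field_simps abs_if split: if_splits)
  have ring: "ring_gauge z = max (1/2) (min 1 (n z))" for z by (simp add: ring_gauge_def n_def)
  have nring: "n (ring_point z) = n z / ring_gauge z" for z
  proof -
    have "ring_gauge z > 0" using ring_gauge_bounds[of z] by linarith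
    moreover have "2 * fst (ring_point z) - 1 = (2 * fst z - 1) / ring_gauge z"
      "2 * snd (ring_point z) - 1 = (2 * snd z - 1) / ring_gauge z"
      by (auto simp: ring_point_def diff_divide_distrib algebra_simps)
    ultimately show ?thesis by (simp add: n_def abs_divide max_divide_distrib_right)
  qed
  have inner: "G (grow p l z) \<le> l" if "n z \<le> 1/2" for z
  proof -
    have g: "ring_gauge z = 1/2" using that by (simp add: ring)
    have "k z = l" "n (ring_point z) \<le> 1" using that unfolding k_def nring g by auto
    then show ?thesis using Gle[of "ring_point z"] l by (simp add: Gk)
  qed
  have mid: "G (grow p l z) = k z" "ring_gauge z = n z" "l < k z" "k z < 1" if "1/2 < n z" "n z < 1" for z
  proof -
    show g: "ring_gauge z = n z" using that by (simp add: ring)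
    then have "n (ring_point z) = 1" using that by (simp add: nring)
    then have "G (ring_point z) = 1" using Gle[of "ring_point z"] Gge[of "ring_point z"] by simp
    then show "G (grow p l z) = k z" by (simp add: Gk)
    have "(2 * n z - 1) * (1 - l) > 0" "(2 - 2 * n z) * (1 - l) > 0" using that l1 by auto
    then show "l < k z" "k z < 1" by (auto simp: k_def g algebra_simps)
  qed
  have outer: "grow p l z = z" "1 \<le> G (grow p l z)" if "1 \<le> n z" for z
  proof -
    have "ring_gauge z = 1" using that by (simp add: ring)
    then show "grow p l z = z" by (simp add: grow_def ring_point_def)
    then show "1 \<le> G (grow p l z)" using Gge[OF that] by simp
  qed
  have kcase: "k z = k w" if "grow p l z = grow p l w" "n z < 1" "n w < 1" "1/2 < n z \<or> 1/2 < n w" for z w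
    using that mid[of z] mid[of w] inner[of z] inner[of w] by (metis leD linorder_not_le)
  have same: "z = w" if eq: "grow p l z = grow p l w" and g: "ring_gauge z = ring_gauge w" for z w
  proof -
    have "k z = k w" by (simp add: k_def g)
    then have "ring_point z = ring_point w" using eq kp[of w] by (simp add: grow_eq)
    then show ?thesis using g ring_gauge_bounds[of w] by (auto simp: ring_point_def)
  qed
  show ?thesis
  proof (rule injI)
    fix z w assume eq: "grow p l z = grow p l w"
    consider "1 \<le> n z" | "1 \<le> n w" | "n z \<le> 1/2" "n w \<le> 1/2" | "n z < 1" "n w < 1" "1/2 < n z \<or> 1/2 < n w"
      by linarith
    then show "z = w"
    proof cases
      case 1
      then have "1 \<le> n w" using outer(2)[of z] inner[of w] mid[of w] eq l1 by (smt (verit))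
      then show ?thesis using outer(1) 1 eq by metis
    next
      case 2
      then have "1 \<le> n z" using outer(2)[of w] inner[of z] mid[of z] eq l1 by (smt (verit))
      then show ?thesis using outer(1) 2 eq by metis
    next
      case 3
      then show ?thesis using same[OF eq] by (simp add: ring)
    next
      case 4
      have kk: "k z = k w" using kcase[OF eq 4] .
      have "(ring_gauge z - ring_gauge w) * (1 - l) = 0" using kk by (simp add: k_def algebra_simps)
      then show ?thesis using same[OF eq] l1 by simp
    qed
  qed
qed

lemma supported_homeo_grow:
  assumes "0 < l" "0 < fst p" "fst p + l < 1" "0 < snd p" "snd p + l < 1"
  shows "supported_homeo (open_box 0 1) (grow p l)"
  by (rule supported_homeoI[OF continuous_grow inj_grow[OF assms]]) (simp_all add: grow_outside)

definition corners :: "plane set" where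
  "corners = {(0, 0), (1, 0), (0, 1), (1, 1)}"

definition legged_box :: "plane \<Rightarrow> real \<Rightarrow> plane set \<Rightarrow> plane set" where
  "legged_box p l S = (\<lambda>w. p + l *\<^sub>R w) ` S \<union> (\<Union>c\<in>corners. closed_segment c (p + l *\<^sub>R c))"

text \<open>Both pictures are images under \<open>grow\<close> of the centred box of half the side,
  whose legs are radial segments that \<open>grow\<close> maps linearly. The content
  \<open>S\<close> is arbitrary, so whole tangles can be moved.\<close>

lemma legged_box_eq:
  assumes S: "S \<subseteq> unit_square"
    and "0 < l" "0 < fst p" "fst p + l < 1" "0 < snd p" "snd p + l < 1"
    and "0 < l'" "0 < fst p'" "fst p' + l' < 1" "0 < snd p'" "snd p' + l' < 1"
  shows "planar_eq (open_box 0 1) (legged_box p l S) (legged_box p' l' S)"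
proof -
  have *: "grow p l ` legged_box (1/4, 1/4) (1/2) S = legged_box p l S" for p l
  proof -
    have "grow p l ` closed_segment c ((1/4, 1/4) + (1/2) *\<^sub>R c) = closed_segment c (p + l *\<^sub>R c)"
      if "c \<in> corners" for c
    proof -
      have "fst c \<in> {0, 1}" "snd c \<in> {0, 1}" using that by (auto simp: corners_def)
      then show ?thesis
        unfolding closed_segment_image_interval image_image
        by (intro image_cong refl grow_leg) auto
    qed
    moreover have "grow p l ` (\<lambda>w. (1/4, 1/4) + (1/2) *\<^sub>R w) ` S = (\<lambda>w. p + l *\<^sub>R w) ` S"
      unfolding image_image using S by (intro image_cong refl grow_box) auto
    ultimately show ?thesis by (simp add: legged_box_def image_Un image_UN)
  qed
  have **: "planar_eq (open_box 0 1) (legged_box (1/4, 1/4) (1/2) S) (legged_box p l S)"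
    if "0 < l" "0 < fst p" "fst p + l < 1" "0 < snd p" "snd p + l < 1" for p l
    using planar_eq_homeo[OF supported_homeo_grow[OF that], of "legged_box (1/4, 1/4) (1/2) S"]
    unfolding * .
  show ?thesis
    by (rule planar_eq_trans[OF planar_eq_sym[OF **] **]) (use assms in auto)
qed

section \<open>Pictures with integer coordinates\<close>

type_synonym ipoint = "int \<times> int"
type_synonym segment = "ipoint \<times> ipoint"
type_synonym functional = "int \<times> int \<times> int"
type_synonym picture = "segment list \<times> (nat \<times> ipoint \<times> int) list"

definition real_point :: "ipoint \<Rightarrow> plane" where
  "real_point z = (of_int (fst z), of_int (snd z))"

definition segment_set :: "segment \<Rightarrow> plane set" where
  "segment_set s = closed_segment (real_point (fst s)) (real_point (snd s))"

definition place :: "ipoint \<Rightarrow> int \<Rightarrow> plane \<Rightarrow> plane" where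
  "place z l w = real_point z + of_int l *\<^sub>R w"

definition box_set :: "(nat \<Rightarrow> plane set) \<Rightarrow> nat \<times> ipoint \<times> int \<Rightarrow> plane set" where
  "box_set E b = place (fst (snd b)) (snd (snd b)) ` E (fst b)"

definition picture_set :: "(nat \<Rightarrow> plane set) \<Rightarrow> picture \<Rightarrow> plane set" where
  "picture_set E P = (\<Union>s\<in>set (fst P). segment_set s) \<union> (\<Union>b\<in>set (snd P). box_set E b)"

lemma segment_set_swap: "segment_set (q, p) = segment_set (p, q)"
  by (simp add: segment_set_def closed_segment_commute)

subsection \<open>Editing segment lists\<close>

definition has_seg :: "ipoint \<Rightarrow> ipoint \<Rightarrow> segment list \<Rightarrow> bool" where
  "has_seg p q S \<longleftrightarrow> (p, q) \<in> set S \<or> (q, p) \<in> set S"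

definition del_seg :: "ipoint \<Rightarrow> ipoint \<Rightarrow> segment list \<Rightarrow> segment list" where
  "del_seg p q S = filter (\<lambda>s. s \<noteq> (p, q) \<and> s \<noteq> (q, p)) S"

fun has_segs :: "segment list \<Rightarrow> segment list \<Rightarrow> bool" where
  "has_segs [] S \<longleftrightarrow> True"
| "has_segs (s # T) S \<longleftrightarrow> has_seg (fst s) (snd s) S \<and> has_segs T S"

fun del_segs :: "segment list \<Rightarrow> segment list \<Rightarrow> segment list" where
  "del_segs [] S = S"
| "del_segs (s # T) S = del_segs T (del_seg (fst s) (snd s) S)"

definition segs_set :: "segment list \<Rightarrow> plane set" where
  "segs_set S = (\<Union>s\<in>set S. segment_set s)"

lemma segs_set_simps [simp]:
  "segs_set [] = {}" "segs_set (s # S) = segment_set s \<union> segs_set S"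
  "segs_set (S @ T) = segs_set S \<union> segs_set T"
  by (auto simp: segs_set_def)

lemma segs_set_del_seg': "segment_set (p, q) \<union> segs_set (del_seg p q S) = segment_set (p, q) \<union> segs_set S"
proof -
  have "segment_set s \<subseteq> segment_set (p, q) \<union> segs_set (del_seg p q S)" if "s \<in> set S" for s
  proof (cases "s = (p, q) \<or> s = (q, p)")
    case True
    then show ?thesis using segment_set_swap[of q p] by auto
  next
    case False
    then have "s \<in> set (del_seg p q S)" using that by (simp add: del_seg_def)
    then show ?thesis unfolding segs_set_def by blast
  qed
  moreover have "set (del_seg p q S) \<subseteq> set S" by (auto simp: del_seg_def)
  ultimately show ?thesis unfolding segs_set_def by blast
qed

lemma segs_set_has: "has_seg p q S \<Longrightarrow> segment_set (p, q) \<subseteq> segs_set S"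
  unfolding has_seg_def segs_set_def using segment_set_swap[of q p] by blast

lemma segs_set_del_seg: "has_seg p q S \<Longrightarrow> segs_set S = segment_set (p, q) \<union> segs_set (del_seg p q S)"
  using segs_set_del_seg'[of p q S] segs_set_has[of p q S] by blast

text \<open>\<open>has_segs\<close> tests every segment against the full list, whereas
  \<open>del_segs\<close> works through a shrinking one. Keeping \<open>segs_set T\<close> on both
  sides frees the induction from the question whether a segment is still present.\<close>

lemma segs_set_del_segs': "segs_set T \<union> segs_set (del_segs T S) = segs_set T \<union> segs_set S"
proof (induction T arbitrary: S)
  case (Cons s T)
  have "segs_set (s # T) \<union> segs_set (del_segs (s # T) S) =
      segment_set s \<union> (segs_set T \<union> segs_set (del_seg (fst s) (snd s) S))"
    using Cons.IH[of "del_seg (fst s) (snd s) S"] by auto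
  also have "\<dots> = segs_set T \<union> (segment_set s \<union> segs_set S)"
    using segs_set_del_seg'[of "fst s" "snd s" S] by auto
  finally show ?case by auto
qed simp

lemma segs_set_has_segs: "has_segs T S \<Longrightarrow> segs_set T \<subseteq> segs_set S"
  by (induction T) (use segs_set_has in fastforce)+

lemma segs_set_del_segs: "has_segs T S \<Longrightarrow> segs_set S = segs_set T \<union> segs_set (del_segs T S)"
  using segs_set_del_segs'[of T S] segs_set_has_segs by blast

subsection \<open>Moves\<close>

text \<open>\<open>Kink\<close> and \<open>Flip\<close> are deformations of types 1 and 3; the other moves are isotopies or only
  change the subdivision into segments. The lists in \<open>Vertex\<close> are a certificate: the tent functions
  of the isotopy.\<close>

datatype move =
    Split ipoint ipoint ipoint
  | Merge ipoint ipoint ipoint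
  | Vertex ipoint ipoint "functional list list"
  | Box nat ipoint int ipoint int
  | Kink ipoint ipoint ipoint
  | Flip ipoint ipoint ipoint

definition value_at :: "functional \<Rightarrow> ipoint \<Rightarrow> int" where
  "value_at f z = fst f * fst z + fst (snd f) * snd z + snd (snd f)"

definition between :: "ipoint \<Rightarrow> ipoint \<Rightarrow> ipoint \<Rightarrow> bool" where
  "between p m q \<longleftrightarrow>
     (fst q - fst p) * (snd m - snd p) = (snd q - snd p) * (fst m - fst p) \<and>
     0 < (fst q - fst p) * (fst m - fst p) + (snd q - snd p) * (snd m - snd p) \<and>
     (fst q - fst p) * (fst m - fst p) + (snd q - snd p) * (snd m - snd p)
       < (fst q - fst p)\<^sup>2 + (snd q - snd p)\<^sup>2"

definition in_open :: "int \<Rightarrow> int \<Rightarrow> ipoint \<Rightarrow> bool" where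
  "in_open lo hi z \<longleftrightarrow> lo < fst z \<and> fst z < hi \<and> lo < snd z \<and> snd z < hi"

definition in_closed :: "int \<Rightarrow> int \<Rightarrow> ipoint \<Rightarrow> bool" where
  "in_closed lo hi z \<longleftrightarrow> lo \<le> fst z \<and> fst z \<le> hi \<and> lo \<le> snd z \<and> snd z \<le> hi"

definition box_corners :: "ipoint \<Rightarrow> int \<Rightarrow> ipoint list" where
  "box_corners z l = [z, (fst z + l, snd z), (fst z, snd z + l), (fst z + l, snd z + l)]"

text \<open>Every functional of a tent is positive at the old and at the new position of the vertex;
  a set on which one of them is nonpositive stays fixed.\<close>

definition avoids :: "functional list \<Rightarrow> ipoint list \<Rightarrow> bool" where
  "avoids t ps \<longleftrightarrow> (\<exists>f\<in>set t. \<forall>p\<in>set ps. value_at f p \<le> 0)"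

text \<open>The two conditions on tents bound the displacement along the leg from both sides: each
  tent has a functional that is nonpositive at \<open>q\<close>, and some tent has only functionals
  that are nonnegative there. The displacement then decreases exactly linearly from \<open>v\<close>
  to \<open>q\<close>, and the leg stays straight.\<close>

definition leg_ok :: "int \<Rightarrow> int \<Rightarrow> ipoint \<Rightarrow> functional list list \<Rightarrow> ipoint \<Rightarrow> bool" where
  "leg_ok lo hi v ts q \<longleftrightarrow> q \<noteq> v \<and> in_closed lo hi q \<and> (\<forall>t\<in>set ts. avoids t [q]) \<and>
     (\<exists>t\<in>set ts. \<forall>f\<in>set t. 0 \<le> value_at f q)"

definition vertex_ok :: "int \<Rightarrow> int \<Rightarrow> ipoint \<Rightarrow> ipoint \<Rightarrow> functional list list \<Rightarrow> picture \<Rightarrow> bool" where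
  "vertex_ok lo hi v w ts P \<longleftrightarrow> in_open lo hi v \<and> in_open lo hi w \<and>
     (\<forall>t\<in>set ts. \<forall>f\<in>set t. 0 < value_at f v \<and> 0 < value_at f w) \<and>
     (\<forall>s\<in>set (fst P). if fst s = v then leg_ok lo hi v ts (snd s)
        else if snd s = v then leg_ok lo hi v ts (fst s)
        else \<forall>t\<in>set ts. avoids t [fst s, snd s]) \<and>
     (\<forall>b\<in>set (snd P). \<forall>t\<in>set ts. avoids t (box_corners (fst (snd b)) (snd (snd b))))"

definition outside_square :: "ipoint \<Rightarrow> int \<Rightarrow> ipoint list \<Rightarrow> bool" where
  "outside_square z l ps \<longleftrightarrow>
     (\<forall>p\<in>set ps. fst p \<le> fst z) \<or> (\<forall>p\<in>set ps. fst z + l \<le> fst p) \<or>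
     (\<forall>p\<in>set ps. snd p \<le> snd z) \<or> (\<forall>p\<in>set ps. snd z + l \<le> snd p)"

definition strictly_inside :: "ipoint \<Rightarrow> int \<Rightarrow> ipoint \<Rightarrow> int \<Rightarrow> bool" where
  "strictly_inside c L z l \<longleftrightarrow> 0 < l \<and> fst c < fst z \<and> fst z + l < fst c + L \<and>
     snd c < snd z \<and> snd z + l < snd c + L"

definition legs :: "ipoint \<Rightarrow> int \<Rightarrow> ipoint \<Rightarrow> int \<Rightarrow> segment list" where
  "legs c L z l = zip (box_corners c L) (box_corners z l)"

text \<open>The model pictures have coordinates that are multiples of 1/4. With \<open>u\<close> and
  \<open>v\<close> equal to a quarter of the sides of the parallelogram, all their vertices become
  integral.\<close>

definition grid :: "ipoint \<Rightarrow> ipoint \<Rightarrow> ipoint \<Rightarrow> int \<Rightarrow> int \<Rightarrow> ipoint" where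
  "grid p u v a b = (fst p + a * fst u + b * fst v, snd p + a * snd u + b * snd v)"

text \<open>By Cramer's rule: the two frame coordinates of \<open>z\<close>, scaled by the absolute
  determinant, and their complements to \<open>4 * \<bar>d\<bar>\<close>. If \<open>d\<close> is not
  0, all four are nonnegative exactly on the parallelogram, and no division occurs.\<close>

definition side_values :: "ipoint \<Rightarrow> ipoint \<Rightarrow> ipoint \<Rightarrow> ipoint \<Rightarrow> int list" where
  "side_values p u v z =
    (let d = fst u * snd v - snd u * fst v;
         x = (fst z - fst p) * snd v - (snd z - snd p) * fst v;
         y = fst u * (snd z - snd p) - snd u * (fst z - fst p)
     in [x * sgn d, y * sgn d, 4 * \<bar>d\<bar> - x * sgn d, 4 * \<bar>d\<bar> - y * sgn d])"

text \<open>One side of the parallelogram has to separate it from the segment. Contact is allowed in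
  an endpoint listed in \<open>ts\<close>, since the strands that continue the model picture begin
  there.\<close>

definition segment_clear :: "ipoint \<Rightarrow> ipoint \<Rightarrow> ipoint \<Rightarrow> ipoint list \<Rightarrow> segment \<Rightarrow> bool" where
  "segment_clear p u v ts s \<longleftrightarrow>
     (\<exists>ab\<in>set (zip (side_values p u v (fst s)) (side_values p u v (snd s))).
        fst ab < 0 \<and> snd ab < 0 \<or> fst ab < 0 \<and> snd ab = 0 \<and> snd s \<in> set ts \<or>
        fst ab = 0 \<and> snd ab < 0 \<and> fst s \<in> set ts)"

definition box_clear :: "ipoint \<Rightarrow> ipoint \<Rightarrow> ipoint \<Rightarrow> nat \<times> ipoint \<times> int \<Rightarrow> bool" where
  "box_clear p u v b \<longleftrightarrow>
     (\<exists>i\<in>set [0..<4]. \<forall>c\<in>set (box_corners (fst (snd b)) (snd (snd b))). side_values p u v c ! i < 0)"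

definition replaceable :: "int \<Rightarrow> int \<Rightarrow> ipoint \<Rightarrow> ipoint \<Rightarrow> ipoint \<Rightarrow> segment list \<Rightarrow> ipoint list \<Rightarrow> picture \<Rightarrow> bool" where
  "replaceable lo hi p u v T ts P \<longleftrightarrow>
     fst u * snd v - snd u * fst v \<noteq> 0 \<and>
     in_open lo hi p \<and> in_open lo hi (grid p u v 4 0) \<and> in_open lo hi (grid p u v 0 4) \<and>
     in_open lo hi (grid p u v 4 4) \<and>
     has_segs T (fst P) \<and> (\<forall>s\<in>set (del_segs T (fst P)). segment_clear p u v ts s) \<and>
     (\<forall>b\<in>set (snd P). box_clear p u v b)"

definition grid_path :: "ipoint \<Rightarrow> ipoint \<Rightarrow> ipoint \<Rightarrow> (int \<times> int) list \<Rightarrow> segment list" where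
  "grid_path p u v ps = zip (map (\<lambda>z. grid p u v (fst z) (snd z)) ps) (map (\<lambda>z. grid p u v (fst z) (snd z)) (tl ps))"

definition grid_crossing :: "ipoint \<Rightarrow> ipoint \<Rightarrow> ipoint \<Rightarrow> segment list" where
  "grid_crossing p u v = grid_path p u v [(0, 0), (4, 4)] @ grid_path p u v [(0, 4), (4, 0)]"

fun apply_move :: "int \<Rightarrow> int \<Rightarrow> move \<Rightarrow> picture \<Rightarrow> picture option" where
  "apply_move lo hi (Split p q m) P =
     (if has_seg p q (fst P) \<and> between p m q
      then Some ((p, m) # (m, q) # del_seg p q (fst P), snd P) else None)"
| "apply_move lo hi (Merge p m q) P =
     (if has_segs [(p, m), (m, q)] (fst P) \<and> between p m q
      then Some ((p, q) # del_segs [(p, m), (m, q)] (fst P), snd P) else None)"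
| "apply_move lo hi (Vertex v w ts) P =
     (if vertex_ok lo hi v w ts P
      then Some (map (\<lambda>s. if fst s = v then (w, snd s) else if snd s = v then (fst s, w) else s) (fst P), snd P)
      else None)"
| "apply_move lo hi (Box i c L z l) P =
     (case map_of (snd P) i of None \<Rightarrow> None
      | Some (z0, l0) \<Rightarrow>
         (let T = legs c L z0 l0; S = del_segs T (fst P);
              B = filter (\<lambda>b. fst b \<noteq> i) (snd P)
          in if 0 < L \<and> in_closed lo hi c \<and> in_closed lo hi (fst c + L, snd c + L) \<and>
               strictly_inside c L z0 l0 \<and> strictly_inside c L z l \<and>
               filter (\<lambda>b. fst b = i) (snd P) = [(i, z0, l0)] \<and> has_segs T (fst P) \<and>
               (\<forall>s\<in>set S. outside_square c L [fst s, snd s]) \<and>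
               (\<forall>b\<in>set B. outside_square c L (box_corners (fst (snd b)) (snd (snd b))))
             then Some (legs c L z l @ S, (i, z, l) # B) else None))"
| "apply_move lo hi (Kink p u v) P =
     (let T = grid_path p u v [(0, 2), (3, 3), (1, 3), (4, 2)]
      in if replaceable lo hi p u v T [grid p u v 0 2, grid p u v 4 2] P
         then Some (grid_path p u v [(0, 2), (4, 2)] @ del_segs T (fst P), snd P) else None)"
| "apply_move lo hi (Flip p u v) P =
     (let T = grid_crossing p u v @ grid_path p u v [(0, 2), (2, 3), (4, 2)]
      in if replaceable lo hi p u v T
           [grid p u v 0 0, grid p u v 4 4, grid p u v 0 4, grid p u v 4 0, grid p u v 0 2, grid p u v 4 2] P
         then Some ((grid_crossing p u v @ grid_path p u v [(0, 2), (2, 1), (4, 2)]) @ del_segs T (fst P), snd P)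
         else None)"

fun apply_moves :: "int \<Rightarrow> int \<Rightarrow> move list \<Rightarrow> picture \<Rightarrow> picture option" where
  "apply_moves lo hi [] P = Some P"
| "apply_moves lo hi (m # ms) P =
     (case apply_move lo hi m P of None \<Rightarrow> None | Some Q \<Rightarrow> apply_moves lo hi ms Q)"

definition same_picture :: "picture \<Rightarrow> picture \<Rightarrow> bool" where
  "same_picture P Q \<longleftrightarrow> has_segs (fst P) (fst Q) \<and> has_segs (fst Q) (fst P) \<and> set (snd P) = set (snd Q)"

text \<open>Both pictures are moved to a common third one. As the deformation relation is symmetric,
  this makes every move available in both directions, although \<open>Kink\<close> only removes
  kinks.\<close>

definition joined :: "int \<Rightarrow> int \<Rightarrow> move list \<Rightarrow> picture \<Rightarrow> move list \<Rightarrow> picture \<Rightarrow> bool" where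
  "joined lo hi ms P ns Q \<longleftrightarrow>
     (case apply_moves lo hi ms P of None \<Rightarrow> False
      | Some P' \<Rightarrow> (case apply_moves lo hi ns Q of None \<Rightarrow> False | Some Q' \<Rightarrow> same_picture P' Q'))"

subsection \<open>Soundness\<close>

abbreviation region :: "int \<Rightarrow> int \<Rightarrow> plane set" where
  "region lo hi \<equiv> open_box (of_int lo) (of_int hi)"

lemma picture_set_eq: "picture_set E P = segs_set (fst P) \<union> (\<Union>b\<in>set (snd P). box_set E b)"
  by (simp add: picture_set_def segs_set_def)

lemma between_segment:
  assumes "between p m q"
  shows "segment_set (p, q) = segment_set (p, m) \<union> segment_set (m, q)"
proof -
  define x y a b where "x = real_of_int (fst q - fst p)" and "y = real_of_int (snd q - snd p)"
    and "a = real_of_int (fst m - fst p)" and "b = real_of_int (snd m - snd p)"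
  have e: "x * b = y * a" and t: "0 < x * a + y * b" "x * a + y * b < x\<^sup>2 + y\<^sup>2"
    using assms unfolding between_def x_def y_def a_def b_def
    by (simp_all only: of_int_mult[symmetric] of_int_add[symmetric] of_int_power[symmetric]
        of_int_less_iff of_int_eq_iff of_int_0_less_iff)
  \<comment> \<open>The parameter of the orthogonal projection of \<open>m\<close> to the line;
    collinearity makes the projection equal to \<open>m\<close>.\<close>
  define s where "s = (x * a + y * b) / (x\<^sup>2 + y\<^sup>2)"
  have pos: "x\<^sup>2 + y\<^sup>2 > 0" using t by linarith
  have s: "0 \<le> s" "s \<le> 1" using t pos by (auto simp: s_def field_simps)
  have "a * (x\<^sup>2 + y\<^sup>2) = x * (x * a + y * b)" "b * (x\<^sup>2 + y\<^sup>2) = y * (x * a + y * b)"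
    using e by (auto simp: power2_eq_square algebra_simps)
  then have "a = x * (x * a + y * b) / (x\<^sup>2 + y\<^sup>2)" "b = y * (x * a + y * b) / (x\<^sup>2 + y\<^sup>2)"
    using eq_divide_imp[OF less_imp_neq[OF pos, symmetric]] by blast+
  then have "a = x * s" "b = y * s" unfolding s_def times_divide_eq_right .
  then have "a = s * x" "b = s * y" by (simp_all add: mult.commute)
  then have "real_point m = (1 - s) *\<^sub>R real_point p + s *\<^sub>R real_point q"
    by (auto simp: real_point_def x_def y_def a_def b_def algebra_simps)
  then have "real_point m \<in> closed_segment (real_point p) (real_point q)"
    using s unfolding closed_segment_def by blast
  from Un_closed_segment[OF this] show ?thesis by (simp add: segment_set_def)
qed

definition functional_value :: "functional \<Rightarrow> plane \<Rightarrow> real" where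
  "functional_value f z = of_int (fst f) * fst z + of_int (fst (snd f)) * snd z + of_int (snd (snd f))"

lemma functional_value_real_point [simp]: "functional_value f (real_point z) = of_int (value_at f z)"
  by (simp add: functional_value_def value_at_def real_point_def)

lemma functional_value_convex_combination:
  "functional_value f ((1 - s) *\<^sub>R a + s *\<^sub>R b) = (1 - s) * functional_value f a + s * functional_value f b"
  by (simp add: functional_value_def algebra_simps)

lemma convex_functional_value_le: "convex {z. functional_value f z \<le> 0}"
  unfolding convex_alt
proof (clarsimp simp only: mem_Collect_eq functional_value_convex_combination)
  fix x y and u :: real
  assume "functional_value f x \<le> 0" "functional_value f y \<le> 0" "0 \<le> u" "u \<le> 1"
  then show "(1 - u) * functional_value f x + u * functional_value f y \<le> 0"
    by (intro add_nonpos_nonpos mult_nonneg_nonpos) auto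
qed

lemma continuous_functional_value: "continuous_on UNIV (functional_value f)"
  unfolding functional_value_def by (intro continuous_intros)

lemma frame_subset_convex:
  assumes "convex S" "p \<in> S" "p + u \<in> S" "p + v \<in> S" "p + u + v \<in> S"
  shows "frame p u v ` unit_square \<subseteq> S"
proof (rule image_subsetI)
  fix z :: plane assume "z \<in> unit_square"
  then obtain x y where z: "z = (x, y)" and "0 \<le> x" "x \<le> 1" "0 \<le> y" "y \<le> 1" by auto
  then have "(1 - y) *\<^sub>R ((1 - x) *\<^sub>R p + x *\<^sub>R (p + u)) + y *\<^sub>R ((1 - x) *\<^sub>R (p + v) + x *\<^sub>R (p + u + v)) \<in> S"
    using assms by (intro convexD_alt) auto
  then show "frame p u v z \<in> S" by (simp add: frame_def z algebra_simps)
qed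

lemma place_frame: "place z l = frame (real_point z) (of_int l, 0) (0, of_int l)"
  by (auto simp: place_def frame_def fun_eq_iff)

lemma place_subset_convex:
  assumes "convex S" "\<forall>c\<in>set (box_corners z l). real_point c \<in> S"
  shows "place z l ` unit_square \<subseteq> S"
  unfolding place_frame using assms
  by (intro frame_subset_convex) (auto simp: box_corners_def real_point_def)

lemma box_set_subset_convex:
  assumes "E (fst b) \<subseteq> unit_square" "convex S" "\<forall>c\<in>set (box_corners (fst (snd b)) (snd (snd b))). real_point c \<in> S"
  shows "box_set E b \<subseteq> S"
  using place_subset_convex[OF assms(2,3)] assms(1) unfolding box_set_def by blast

lemma segment_set_subset_convex:
  assumes "convex S" "real_point (fst s) \<in> S" "real_point (snd s) \<in> S"
  shows "segment_set s \<subseteq> S"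
  unfolding segment_set_def using assms closed_segment_subset by blast

lemma image_segment_pointwise:
  assumes "\<And>s. 0 \<le> s \<Longrightarrow> s \<le> 1 \<Longrightarrow> h ((1 - s) *\<^sub>R a + s *\<^sub>R b) = (1 - s) *\<^sub>R c + s *\<^sub>R d"
  shows "h ` closed_segment a b = closed_segment c d"
  unfolding closed_segment_image_interval image_image using assms by (intro image_cong refl) auto

definition frame_bounds :: "int \<Rightarrow> int \<Rightarrow> functional list" where
  "frame_bounds lo hi = [(1, 0, - lo), (-1, 0, hi), (0, 1, - lo), (0, -1, hi)]"

text \<open>Each functional of the certificate is divided by its value at the old position
  \<open>V\<close>. A tent then has height 1 at \<open>V\<close>, and along a segment from
  \<open>V\<close> the normalized functionals are affine, so the displacement can be computed
  exactly on the legs. The bounding lines of the region are added to every tent to confine the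
  support.\<close>

lemma vertex_move_sound:
  assumes E: "\<And>i. E i \<subseteq> unit_square" and ok: "vertex_ok lo hi v w ts P"
  shows "planar_eq (region lo hi) (picture_set E P)
    (picture_set E (map (\<lambda>s. if fst s = v then (w, snd s) else if snd s = v then (fst s, w) else s) (fst P), snd P))"
proof -
  define V W where "V = real_point v" and "W = real_point w"
  define nf where "nf = (\<lambda>f z. functional_value f z / functional_value f V)"
  define full where "full = (\<lambda>t. t @ frame_bounds lo hi)"
  define tent where "tent = (\<lambda>t. min_list_fun (map nf (full t)))"
  define \<phi> where "\<phi> = max_list_fun (map tent ts)"
  have inV: "in_open lo hi v" "in_open lo hi w" using ok by (auto simp: vertex_ok_def)
  have pos: "0 < functional_value f V \<and> 0 < functional_value f W" if "f \<in> set (full t)" "t \<in> set ts" for f t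
  proof (cases "f \<in> set t")
    case True
    then show ?thesis using ok that unfolding V_def W_def by (simp add: vertex_ok_def)
  next
    case False
    then have "f \<in> set (frame_bounds lo hi)" using that by (simp add: full_def)
    then show ?thesis using inV
      unfolding V_def W_def by (auto simp: frame_bounds_def value_at_def in_open_def)
  qed
  \<comment> \<open>The normalized functional goes from 1 at \<open>V\<close> to a positive value at
    \<open>W\<close>, so its slope along \<open>W - V\<close> exceeds -1.\<close>
  have slow1: "slow_decay (W - V) (nf f)" if "f \<in> set (full t)" "t \<in> set ts" for f t
    unfolding slow_decay_def
  proof (intro allI impI)
    fix z and s :: real assume s: "0 < s"
    have "functional_value f (z + s *\<^sub>R (W - V)) = functional_value f z + s * (functional_value f W - functional_value f V)"
      by (simp add: functional_value_def algebra_simps)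
    then have "nf f (z + s *\<^sub>R (W - V)) = nf f z + s * (functional_value f W / functional_value f V - 1)"
      using pos[OF that] by (simp add: nf_def field_simps)
    moreover have "s * (functional_value f W / functional_value f V) > 0" using pos[OF that] s by simp
    ultimately show "nf f z - s < nf f (z + s *\<^sub>R (W - V))" by (simp add: algebra_simps)
  qed
  have cont1: "continuous_on UNIV (nf f)" if "f \<in> set (full t)" "t \<in> set ts" for f t
    unfolding nf_def using pos[OF that] by (intro continuous_intros continuous_functional_value) simp
  have slow: "slow_decay (W - V) \<phi>"
    unfolding \<phi>_def tent_def using slow1 by (intro slow_decay_max_list_fun) (auto intro!: slow_decay_min_list_fun)
  have cont: "continuous_on UNIV \<phi>"
    unfolding \<phi>_def tent_def using cont1 by (intro continuous_max_list_fun) (auto intro!: continuous_min_list_fun)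
  have nonneg: "0 \<le> \<phi> z" for z unfolding \<phi>_def by (rule max_list_fun_nonneg)
  have zero: "\<phi> z = 0" if np: "\<And>t. t \<in> set ts \<Longrightarrow> \<exists>f\<in>set (full t). functional_value f z \<le> 0" for z
  proof -
    have "\<phi> z \<le> 0" unfolding \<phi>_def
    proof (rule max_list_fun_le)
      fix g assume "g \<in> set (map tent ts)"
      then obtain t where t: "t \<in> set ts" "g = tent t" by auto
      obtain f where f: "f \<in> set (full t)" "functional_value f z \<le> 0" using np[OF t(1)] by auto
      have "tent t z \<le> nf f z" unfolding tent_def using f by (intro min_list_fun_le) auto
      also have "\<dots> \<le> 0" using f pos[OF f(1) t(1)] by (simp add: nf_def divide_le_0_iff)
      finally show "g z \<le> 0" using t by simp
    qed simp
    then show ?thesis using nonneg[of z] by simp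
  qed
  have out: "\<phi> z = 0" if "z \<notin> region lo hi" for z
  proof (rule zero)
    fix t
    have "\<exists>f\<in>set (frame_bounds lo hi). functional_value f z \<le> 0"
      using that by (cases z) (auto simp: open_box_def frame_bounds_def functional_value_def)
    then show "\<exists>f\<in>set (full t). functional_value f z \<le> 0" by (auto simp: full_def)
  qed
  define h where "h = (\<lambda>z. z + \<phi> z *\<^sub>R (W - V))"
  have homeo: "supported_homeo (region lo hi) h"
    unfolding h_def by (rule supported_homeo_push[OF _ cont slow out]) auto
  have fixed: "h z = z" if "\<And>t. t \<in> set ts \<Longrightarrow> \<exists>f\<in>set t. functional_value f z \<le> 0" for z
    using zero[of z] that by (fastforce simp: h_def full_def)
  have box: "h ` box_set E b = box_set E b" if "b \<in> set (snd P)" for b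
  proof -
    have "h z = z" if z: "z \<in> box_set E b" for z
    proof (rule fixed)
      fix t assume "t \<in> set ts"
      then obtain f where "f \<in> set t" "\<forall>p\<in>set (box_corners (fst (snd b)) (snd (snd b))). value_at f p \<le> 0"
        using ok \<open>b \<in> set (snd P)\<close> unfolding vertex_ok_def avoids_def by blast
      then show "\<exists>f\<in>set t. functional_value f z \<le> 0"
        using z box_set_subset_convex[of E b "{z. functional_value f z \<le> 0}"] E convex_functional_value_le[of f]
        by auto
    qed
    then show ?thesis by simp
  qed
  have leg: "h ` segment_set (v, q) = segment_set (w, q)" if ok': "leg_ok lo hi v ts q" for q
    unfolding segment_set_def fst_conv snd_conv V_def[symmetric] W_def[symmetric]
  proof (rule image_segment_pointwise)
    fix s :: real assume s: "0 \<le> s" "s \<le> 1"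
    define Q where "Q = real_point q"
    define z where "z = (1 - s) *\<^sub>R V + s *\<^sub>R Q"
    have nfz: "nf f z = (1 - s) + s * nf f Q" if "f \<in> set (full t)" "t \<in> set ts" for f t
      unfolding nf_def z_def functional_value_convex_combination
      using pos[OF that] by (simp add: add_divide_distrib)
    have "\<phi> z \<le> 1 - s"
      unfolding \<phi>_def
    proof (rule max_list_fun_le)
      fix g assume "g \<in> set (map tent ts)"
      then obtain t where t: "t \<in> set ts" "g = tent t" by auto
      obtain f where f: "f \<in> set t" "value_at f q \<le> 0"
        using ok' t(1) unfolding leg_ok_def avoids_def by auto
      have f': "f \<in> set (full t)" using f by (simp add: full_def)
      have "tent t z \<le> nf f z" unfolding tent_def using f' by (intro min_list_fun_le) auto
      also have "\<dots> = (1 - s) + s * nf f Q" by (rule nfz[OF f' t(1)])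
      also have "\<dots> \<le> 1 - s" using f pos[OF f' t(1)] s
        by (simp add: nf_def Q_def divide_le_0_iff mult_nonneg_nonpos)
      finally show "g z \<le> 1 - s" using t by simp
    qed (use s in simp)
    moreover have "1 - s \<le> \<phi> z"
    proof -
      obtain t where t: "t \<in> set ts" "\<forall>f\<in>set t. 0 \<le> value_at f q" and q: "in_closed lo hi q"
        using ok' unfolding leg_ok_def by auto
      have ge: "0 \<le> value_at f q" if "f \<in> set (full t)" for f
        using that t(2) q by (auto simp: full_def frame_bounds_def in_closed_def value_at_def)
      have "1 - s \<le> tent t z"
        unfolding tent_def
      proof (rule min_list_fun_ge)
        fix g assume "g \<in> set (map nf (full t))"
        then obtain f where f: "f \<in> set (full t)" "g = nf f" by auto
        have "0 \<le> nf f Q" using ge[OF f(1)] pos[OF f(1) t(1)] by (simp add: nf_def Q_def)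
        then show "1 - s \<le> g z" using nfz[OF f(1) t(1)] f(2) s by simp
      qed (use s in simp)
      also have "tent t z \<le> \<phi> z" unfolding \<phi>_def using t(1) by (intro max_list_fun_ge) auto
      finally show ?thesis .
    qed
    ultimately have "\<phi> z = 1 - s" by simp
    then have "h z = z + (1 - s) *\<^sub>R (W - V)" by (simp add: h_def)
    then have "h z = (1 - s) *\<^sub>R W + s *\<^sub>R Q" by (simp add: z_def algebra_simps)
    then show "h ((1 - s) *\<^sub>R V + s *\<^sub>R real_point q) = (1 - s) *\<^sub>R W + s *\<^sub>R real_point q"
      by (simp add: z_def Q_def)
  qed
  have seg: "h ` segment_set s = segment_set (if fst s = v then (w, snd s) else if snd s = v then (fst s, w) else s)"
    if s: "s \<in> set (fst P)" for s
  proof -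
    obtain p q where pq: "s = (p, q)" using prod.exhaust[of s] by blast
    have ok1: "if p = v then leg_ok lo hi v ts q else if q = v then leg_ok lo hi v ts p
        else \<forall>t\<in>set ts. avoids t [p, q]"
      using ok s pq unfolding vertex_ok_def by fastforce
    consider "p = v" "leg_ok lo hi v ts q" | "p \<noteq> v" "q = v" "leg_ok lo hi v ts p"
      | "p \<noteq> v" "q \<noteq> v" "\<forall>t\<in>set ts. avoids t [p, q]"
      using ok1 by (auto split: if_splits)
    then show ?thesis
    proof cases
      case 1
      then show ?thesis using leg pq by simp
    next
      case 2
      then show ?thesis using leg[of p] pq by (simp add: segment_set_swap[of _ p])
    next
      case 3
      have "h z = z" if z: "z \<in> segment_set (p, q)" for z
      proof (rule fixed)
        fix t assume "t \<in> set ts"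
        then obtain f where "f \<in> set t" "value_at f p \<le> 0" "value_at f q \<le> 0"
          using 3 unfolding avoids_def by auto
        then show "\<exists>f\<in>set t. functional_value f z \<le> 0"
          using z segment_set_subset_convex[OF convex_functional_value_le[of f], of "(p, q)"] by auto
      qed
      then show ?thesis using 3 pq by simp
    qed
  qed
  define new where "new = (\<lambda>s. if fst s = v then (w, snd s) else if snd s = v then (fst s, w) else s)"
  have "h ` segment_set s = segment_set (new s)" if "s \<in> set (fst P)" for s
    using seg[OF that] by (simp only: new_def)
  then have "picture_set E (map new (fst P), snd P) = h ` picture_set E P"
    unfolding picture_set_def image_Un image_UN using box by simp
  then have "picture_set E (map (\<lambda>s. if fst s = v then (w, snd s) else if snd s = v then (fst s, w) else s) (fst P), snd P)
      = h ` picture_set E P" by (simp only: new_def)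
  then show ?thesis using planar_eq_homeo[OF homeo, of "picture_set E P"] by simp
qed

text \<open>In coordinates relative to the surrounding square this is \<open>legged_box_eq\<close>.
  Each of the other segments and boxes lies in a closed half-plane beyond one of the four side
  lines, so by convexity it misses the open square.\<close>

lemma box_move_sound:
  assumes E: "E i \<subseteq> unit_square" "\<And>b. b \<in> set B \<Longrightarrow> E (fst b) \<subseteq> unit_square"
    and L: "0 < L" "in_closed lo hi c" "in_closed lo hi (fst c + L, snd c + L)"
    and ins: "strictly_inside c L z0 l0" "strictly_inside c L z l"
    and S: "\<forall>s\<in>set S. outside_square c L [fst s, snd s]"
    and B: "\<forall>b\<in>set B. outside_square c L (box_corners (fst (snd b)) (snd (snd b)))"
  shows "planar_eq (region lo hi)
     (picture_set E (legs c L z0 l0 @ S, (i, z0, l0) # B)) (picture_set E (legs c L z l @ S, (i, z, l) # B))"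
proof -
  define T where "T = (\<lambda>w. real_point c + real_of_int L *\<^sub>R w)"
  define W where "W = segs_set S \<union> (\<Union>b\<in>set B. box_set E b)"
  define rel where "rel = (\<lambda>z. (1 / real_of_int L) *\<^sub>R (real_point z - real_point c))"
  have Lr: "0 < real_of_int L" using L by simp
  have Trel: "T (rel z + (of_int l / of_int L) *\<^sub>R w) = place z l w" for z l w
    using Lr by (simp add: T_def rel_def place_def scaleR_add_right)
  have pic: "picture_set E (legs c L z l @ S, (i, z, l) # B) = T ` legged_box (rel z) (of_int l / of_int L) (E i) \<union> W"
    for z l
  proof -
    have "T ` closed_segment a (rel z + (of_int l / of_int L) *\<^sub>R a) = closed_segment (T a) (place z l a)" for a
      unfolding Trel[symmetric]
      by (rule image_segment_pointwise) (simp add: T_def algebra_simps)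
    then have "T ` (\<Union>a\<in>corners. closed_segment a (rel z + (of_int l / of_int L) *\<^sub>R a)) = segs_set (legs c L z l)"
      unfolding image_UN by (simp add: corners_def legs_def box_corners_def segment_set_def T_def place_def real_point_def Un_assoc)
    moreover have "T ` (\<lambda>w. rel z + (of_int l / of_int L) *\<^sub>R w) ` E i = box_set E (i, z, l)"
      by (simp add: image_image Trel box_set_def)
    ultimately show ?thesis
      unfolding picture_set_eq legged_box_def image_Un W_def by auto
  qed
  have ratio: "0 < real_of_int l / of_int L" "0 < fst (rel z)" "fst (rel z) + of_int l / of_int L < 1"
    "0 < snd (rel z)" "snd (rel z) + of_int l / of_int L < 1" if "strictly_inside c L z l" for z l
  proof -
    have "0 < l" "fst c < fst z" "fst z + l < fst c + L" "snd c < snd z" "snd z + l < snd c + L"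
      using that by (auto simp: strictly_inside_def)
    then have "0 < real_of_int l" "real_of_int (fst c) < fst z" "real_of_int (fst z) + l < fst c + L"
      "real_of_int (snd c) < snd z" "real_of_int (snd z) + l < snd c + L"
      by (simp_all only: of_int_add[symmetric] of_int_less_iff of_int_0_less_iff)
    then show "0 < real_of_int l / of_int L" "0 < fst (rel z)" "fst (rel z) + of_int l / of_int L < 1"
      "0 < snd (rel z)" "snd (rel z) + of_int l / of_int L < 1"
      using Lr by (simp_all add: rel_def real_point_def field_simps)
  qed
  have Tbox: "real_of_int (fst c) < fst z" "fst z < real_of_int (fst c + L)"
    "real_of_int (snd c) < snd z" "snd z < real_of_int (snd c + L)"
    if "z \<in> T ` open_box 0 1" for z :: plane
  proof -
    have "0 < L * x" "L * x < L" if "0 < x" "x < 1" for x :: real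
      using that Lr by (auto simp: mult_less_cancel_left1)
    then show "real_of_int (fst c) < fst z" "fst z < real_of_int (fst c + L)"
      "real_of_int (snd c) < snd z" "snd z < real_of_int (snd c + L)"
      using that by (auto simp: T_def open_box_def real_point_def)
  qed
  have inner: "T ` open_box 0 1 \<subseteq> region lo hi"
  proof
    fix z assume z: "z \<in> T ` open_box 0 1"
    have "real_of_int lo \<le> fst c" "real_of_int (fst c + L) \<le> hi" "real_of_int lo \<le> snd c" "real_of_int (snd c + L) \<le> hi"
      using L by (simp_all only: in_closed_def of_int_le_iff fst_conv snd_conv)
    then show "z \<in> region lo hi"
      using Tbox[OF z] by (cases z) (auto simp: open_box_def)
  qed
  have halves: "convex {z::plane. fst z \<le> a}" "convex {z::plane. a \<le> fst z}"
    "convex {z::plane. snd z \<le> a}" "convex {z::plane. a \<le> snd z}" for a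
  proof -
    have "{z::plane. fst z \<le> a} = {..a} \<times> UNIV" "{z::plane. a \<le> fst z} = {a..} \<times> UNIV"
      "{z::plane. snd z \<le> a} = UNIV \<times> {..a}" "{z::plane. a \<le> snd z} = UNIV \<times> {a..}" by auto
    then show "convex {z::plane. fst z \<le> a}" "convex {z::plane. a \<le> fst z}"
      "convex {z::plane. snd z \<le> a}" "convex {z::plane. a \<le> snd z}"
      by (auto intro!: convex_Times)
  qed
  have avoid: "X \<inter> T ` open_box 0 1 = {}"
    if o: "outside_square c L ps" and X: "\<And>C. convex C \<Longrightarrow> (\<forall>p\<in>set ps. real_point p \<in> C) \<Longrightarrow> X \<subseteq> C" for X ps
  proof -
    consider "\<forall>p\<in>set ps. real_point p \<in> {z. fst z \<le> real_of_int (fst c)}" | "\<forall>p\<in>set ps. real_point p \<in> {z. real_of_int (fst c + L) \<le> fst z}"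
      | "\<forall>p\<in>set ps. real_point p \<in> {z. snd z \<le> real_of_int (snd c)}" | "\<forall>p\<in>set ps. real_point p \<in> {z. real_of_int (snd c + L) \<le> snd z}"
      using o unfolding outside_square_def real_point_def mem_Collect_eq fst_conv snd_conv of_int_le_iff by blast
    then have False if z: "z \<in> X" "z \<in> T ` open_box 0 1" for z
    proof cases
      case 1 then show False using subsetD[OF X[OF halves(1) 1] z(1)] Tbox[OF z(2)] by simp
    next
      case 2 then show False using subsetD[OF X[OF halves(2) 2] z(1)] Tbox[OF z(2)] by simp
    next
      case 3 then show False using subsetD[OF X[OF halves(3) 3] z(1)] Tbox[OF z(2)] by simp
    next
      case 4 then show False using subsetD[OF X[OF halves(4) 4] z(1)] Tbox[OF z(2)] by simp
    qed
    then show ?thesis by blast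
  qed
  have "segment_set s \<inter> T ` open_box 0 1 = {}" if "s \<in> set S" for s
    using segment_set_subset_convex[of _ s] S that by (intro avoid[of "[fst s, snd s]"]) auto
  moreover have "box_set E b \<inter> T ` open_box 0 1 = {}" if "b \<in> set B" for b
    using box_set_subset_convex[of E b, OF E(2)[OF that]] B that
    by (intro avoid[of "box_corners (fst (snd b)) (snd (snd b))"]) blast+
  ultimately have Wd: "W \<inter> T ` open_box 0 1 = {}"
    unfolding W_def segs_set_def by blast
  have lin: "linear (\<lambda>w::plane. real_of_int L *\<^sub>R w)" "inj (\<lambda>w::plane. real_of_int L *\<^sub>R w)"
    using Lr by (auto simp: linear_iff algebra_simps inj_on_def)
  show ?thesis
    unfolding pic
    using planar_eq_context[OF lin legged_box_eq[OF E(1) ratio[OF ins(1)] ratio[OF ins(2)]], of "real_point c"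
        "region lo hi" W, folded T_def] inner Wd by blast
qed

lemma real_point_grid:
  "real_point (grid p u v a b) =
     frame (real_point p) (4 *\<^sub>R real_point u) (4 *\<^sub>R real_point v) (of_int a / 4, of_int b / 4)"
  by (simp add: real_point_def grid_def frame_def)

lemma frame_segment: "frame p u v ` closed_segment a b = closed_segment (frame p u v a) (frame p u v b)"
  by (rule image_segment_pointwise) (simp add: frame_def algebra_simps)

definition side_functions :: "plane \<Rightarrow> plane \<Rightarrow> plane \<Rightarrow> plane \<Rightarrow> real list" where
  "side_functions p u v z =
    (let d = fst u * snd v - snd u * fst v;
         x = (fst z - fst p) * snd v - (snd z - snd p) * fst v;
         y = fst u * (snd z - snd p) - snd u * (fst z - fst p)
     in [x * sgn d, y * sgn d, 4 * \<bar>d\<bar> - x * sgn d, 4 * \<bar>d\<bar> - y * sgn d])"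

lemma of_int_sgn_real: "real_of_int (sgn x) = sgn (real_of_int x)"
  by (simp add: sgn_if)

lemma side_functions_real_point:
  "side_functions (real_point p) (real_point u) (real_point v) (real_point z) = map of_int (side_values p u v z)"
proof -
  have "fst (real_point w) = of_int (fst w)" "snd (real_point w) = of_int (snd w)" for w
    by (simp_all add: real_point_def)
  then show ?thesis
    by (simp add: side_functions_def side_values_def Let_def of_int_sgn_real)
qed

lemma side_functions_combination:
  assumes "i < 4"
  shows "side_functions p u v ((1 - s) *\<^sub>R a + s *\<^sub>R b) ! i =
    (1 - s) * side_functions p u v a ! i + s * side_functions p u v b ! i"
proof -
  have "i = 0 \<or> i = 1 \<or> i = 2 \<or> i = 3" using assms by auto
  then show ?thesis
    by (elim disjE) (simp_all add: side_functions_def Let_def algebra_simps)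
qed

lemma side_functions_frame:
  assumes "z \<in> frame p (4 *\<^sub>R u) (4 *\<^sub>R v) ` unit_square" and "i < 4"
  shows "0 \<le> side_functions p u v z ! i"
proof -
  obtain x y where z: "z = frame p (4 *\<^sub>R u) (4 *\<^sub>R v) (x, y)" and xy: "0 \<le> x" "x \<le> 1" "0 \<le> y" "y \<le> 1"
    using assms(1) by auto
  define d where "d = fst u * snd v - snd u * fst v"
  have "d * sgn d = \<bar>d\<bar>" by (rule abs_sgn[symmetric])
  have e: "(fst z - fst p) * snd v - (snd z - snd p) * fst v = 4 * x * d"
    "fst u * (snd z - snd p) - snd u * (fst z - fst p) = 4 * y * d"
    by (simp_all add: z frame_def d_def algebra_simps)
  have "side_functions p u v z = [4 * x * \<bar>d\<bar>, 4 * y * \<bar>d\<bar>, 4 * (1 - x) * \<bar>d\<bar>, 4 * (1 - y) * \<bar>d\<bar>]"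
    unfolding side_functions_def Let_def e d_def[symmetric]
    using \<open>d * sgn d = \<bar>d\<bar>\<close> by (simp add: mult.assoc algebra_simps)
  moreover have "i = 0 \<or> i = 1 \<or> i = 2 \<or> i = 3" using assms by auto
  ultimately show ?thesis using xy by auto
qed

text \<open>Along the segment one side functional is a convex combination of two nonpositive end
  values, not both zero. It is therefore negative in the interior of the segment, while it is
  nonnegative on the parallelogram. Only a listed endpoint can remain.\<close>

lemma segment_clear_sound:
  assumes "segment_clear p u v ts s"
  shows "segment_set s \<inter> frame (real_point p) (4 *\<^sub>R real_point u) (4 *\<^sub>R real_point v) ` unit_square
    \<subseteq> real_point ` set ts"
proof
  fix z assume z: "z \<in> segment_set s \<inter> frame (real_point p) (4 *\<^sub>R real_point u) (4 *\<^sub>R real_point v) ` unit_square"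
  obtain i where i: "i < length (side_values p u v (fst s))" and
    c: "side_values p u v (fst s) ! i < 0 \<and> side_values p u v (snd s) ! i < 0 \<or>
      side_values p u v (fst s) ! i < 0 \<and> side_values p u v (snd s) ! i = 0 \<and> snd s \<in> set ts \<or>
      side_values p u v (fst s) ! i = 0 \<and> side_values p u v (snd s) ! i < 0 \<and> fst s \<in> set ts"
    using assms unfolding segment_clear_def by (auto simp: in_set_zip)
  have i4: "i < 4" "length (side_values p u v w) = 4" for w
    using i by (auto simp: side_values_def Let_def)
  obtain t where t: "0 \<le> t" "t \<le> 1" and zt: "z = (1 - t) *\<^sub>R real_point (fst s) + t *\<^sub>R real_point (snd s)"
    using z unfolding segment_set_def closed_segment_def by auto
  define a b where "a = real_of_int (side_values p u v (fst s) ! i)" and "b = real_of_int (side_values p u v (snd s) ! i)"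
  have ge: "0 \<le> (1 - t) * a + t * b"
    using side_functions_frame[of z "real_point p" "real_point u" "real_point v" i] z i4
    unfolding zt side_functions_combination[OF i4(1)] side_functions_real_point by (simp add: a_def b_def)
  have c': "a < 0 \<and> b < 0 \<or> a < 0 \<and> b = 0 \<and> snd s \<in> set ts \<or> a = 0 \<and> b < 0 \<and> fst s \<in> set ts"
    using c by (auto simp: a_def b_def)
  consider "t = 0" | "t = 1" | "0 < t" "t < 1" using t by linarith
  then show "z \<in> real_point ` set ts"
  proof cases
    case 3
    then have "(1 - t) * a \<le> 0" "t * b \<le> 0" "(1 - t) * a < 0 \<or> t * b < 0"
      using c' by (auto simp: mult_le_0_iff mult_less_0_iff)
    then show ?thesis using ge by linarith
  qed (use c' ge zt in auto)
qed

lemma box_clear_sound: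
  assumes "box_clear p u v b" "E (fst b) \<subseteq> unit_square"
  shows "box_set E b \<inter> frame (real_point p) (4 *\<^sub>R real_point u) (4 *\<^sub>R real_point v) ` unit_square = {}"
proof -
  obtain i where i: "i < 4" "\<forall>c\<in>set (box_corners (fst (snd b)) (snd (snd b))). side_values p u v c ! i < 0"
    using assms(1) unfolding box_clear_def by auto
  define f where "f = (\<lambda>z. side_functions (real_point p) (real_point u) (real_point v) z ! i)"
  have comb: "f ((1 - t) *\<^sub>R x + t *\<^sub>R y) = (1 - t) * f x + t * f y" for t x y
    unfolding f_def by (rule side_functions_combination[OF i(1)])
  have "convex {z. f z < 0}"
    unfolding convex_alt mem_Collect_eq comb
  proof (intro ballI allI impI, elim conjE CollectE)
    fix x y and t :: real assume "f x < 0" "f y < 0" "0 \<le> t" "t \<le> 1"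
    then show "(1 - t) * f x + t * f y < 0"
      by (smt (verit) mult_nonneg_nonpos mult_pos_neg)
  qed
  moreover have "f (real_point c) < 0" if "c \<in> set (box_corners (fst (snd b)) (snd (snd b)))" for c
  proof -
    have "length (side_values p u v c) = 4" by (simp add: side_values_def Let_def)
    then show ?thesis using i that by (simp add: f_def side_functions_real_point)
  qed
  ultimately have "box_set E b \<subseteq> {z. f z < 0}"
    using box_set_subset_convex[of E b] assms(2) by blast
  then show ?thesis
    using side_functions_frame[of _ "real_point p" "real_point u" "real_point v" i] i(1) unfolding f_def by fastforce
qed

lemma inj_frame:
  assumes "fst u * snd v - snd u * fst v \<noteq> 0"
  shows "inj (frame p u v)"
proof (rule injI)
  fix z w assume "frame p u v z = frame p u v w"
  then have e: "(fst z - fst w) * fst u + (snd z - snd w) * fst v = 0"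
    "(fst z - fst w) * snd u + (snd z - snd w) * snd v = 0"
    by (auto simp: frame_def prod_eq_iff algebra_simps)
  have "(fst z - fst w) * (fst u * snd v - snd u * fst v) = 0" "(snd z - snd w) * (fst u * snd v - snd u * fst v) = 0"
    using e by algebra+
  then show "z = w" using assms by (simp add: prod_eq_iff)
qed

lemma replaceable_sound:
  fixes p u v
  defines "e \<equiv> frame (real_point p) (4 *\<^sub>R real_point u) (4 *\<^sub>R real_point v)"
  assumes E: "\<And>i. E i \<subseteq> unit_square" and rep: "replaceable lo hi p u v T ts P"
    and AB: "(A, B) \<in> local_models \<or> (B, A) \<in> local_models" "A \<subseteq> unit_square" "B \<subseteq> unit_square"
    and T: "segs_set T = e ` A" "segs_set T' = e ` B"
    and ts: "real_point ` set ts \<subseteq> e ` A \<inter> e ` B"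
  shows "planar_eq (region lo hi) (picture_set E P) (picture_set E (T' @ del_segs T (fst P), snd P))"
proof -
  define W where "W = segs_set (del_segs T (fst P)) \<union> (\<Union>b\<in>set (snd P). box_set E b)"
  have P: "picture_set E P = e ` A \<union> W" "picture_set E (T' @ del_segs T (fst P), snd P) = e ` B \<union> W"
    using rep segs_set_del_segs[of T "fst P"] T by (auto simp: replaceable_def picture_set_eq W_def)
  have "segment_set s \<inter> e ` unit_square \<subseteq> real_point ` set ts" if "s \<in> set (del_segs T (fst P))" for s
    using rep that segment_clear_sound unfolding e_def replaceable_def by blast
  moreover have "box_set E b \<inter> e ` unit_square = {}" if "b \<in> set (snd P)" for b
    using rep that box_clear_sound[of p u v b E] E unfolding e_def replaceable_def by blast
  ultimately have W: "W \<inter> e ` unit_square \<subseteq> e ` A \<inter> e ` B"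
    using ts unfolding W_def segs_set_def by blast
  have "real_of_int (fst u * snd v - snd u * fst v) \<noteq> 0"
    using rep unfolding replaceable_def of_int_eq_0_iff by blast
  then have inj: "inj e"
    unfolding e_def by (intro inj_frame) (simp add: real_point_def)
  have cv: "convex (region lo hi)" unfolding open_box_def by (intro convex_Times) auto
  have mem: "real_point z \<in> region lo hi" if "in_open lo hi z" for z
    using that by (auto simp: in_open_def open_box_def real_point_def)
  have corner: "real_point p \<in> region lo hi" "real_point p + 4 *\<^sub>R real_point u \<in> region lo hi"
    "real_point p + 4 *\<^sub>R real_point v \<in> region lo hi" "real_point p + 4 *\<^sub>R real_point u + 4 *\<^sub>R real_point v \<in> region lo hi"
    using rep mem[of p] mem[of "grid p u v 4 0"] mem[of "grid p u v 0 4"] mem[of "grid p u v 4 4"]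
    unfolding replaceable_def real_point_grid by (simp_all add: frame_def add.assoc)
  then have sub: "e ` unit_square \<subseteq> region lo hi"
    unfolding e_def by (intro frame_subset_convex cv)
  have eA: "e ` A \<subseteq> e ` unit_square" "e ` B \<subseteq> e ` unit_square" using AB by auto
  have "replaces e A B (e ` A \<union> W) (e ` B \<union> W)" "replaces e B A (e ` B \<union> W) (e ` A \<union> W)"
    using W eA unfolding replaces_def by blast+
  then show ?thesis
    using AB(1) planar_eq_replaces[OF _ inj[unfolded e_def] sub[unfolded e_def], folded e_def] planar_eq_sym
    unfolding P by metis
qed

lemma segs_set_grid_path:
  "segs_set (grid_path p u v ps) = frame (real_point p) (4 *\<^sub>R real_point u) (4 *\<^sub>R real_point v) `
     polygonal (map (\<lambda>z. (of_int (fst z) / 4, of_int (snd z) / 4)) ps)"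
proof (induction ps)
  case (Cons a ps)
  then show ?case
    by (cases ps) (auto simp: grid_path_def segment_set_def real_point_grid frame_segment image_Un)
qed (simp add: grid_path_def)

lemma segs_set_grid_crossing:
  "segs_set (grid_crossing p u v) = frame (real_point p) (4 *\<^sub>R real_point u) (4 *\<^sub>R real_point v) ` crossing"
  unfolding grid_crossing_def segs_set_simps segs_set_grid_path crossing_def image_Un by simp

lemma polygonal_subset_convex: "convex S \<Longrightarrow> set ps \<subseteq> S \<Longrightarrow> polygonal ps \<subseteq> S"
  by (induction ps rule: polygonal.induct) (auto dest: closed_segment_subset)

lemma convex_unit_square: "convex unit_square"
  by (intro convex_Times) auto

lemma local_model_subset:
  "polygonal [(0, 1/2), (1, 1/2)] \<subseteq> unit_square"
  "polygonal [(0, 1/2), (3/4, 3/4), (1/4, 3/4), (1, 1/2)] \<subseteq> unit_square"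
  "crossing \<union> polygonal [(0, 1/2), (1/2, 3/4), (1, 1/2)] \<subseteq> unit_square"
  "crossing \<union> polygonal [(0, 1/2), (1/2, 1/4), (1, 1/2)] \<subseteq> unit_square"
  unfolding crossing_def Un_subset_iff
  by (intro conjI polygonal_subset_convex convex_unit_square; auto)+

lemma apply_move_sound:
  assumes E: "\<And>i. E i \<subseteq> unit_square" and m: "apply_move lo hi m P = Some Q"
  shows "planar_eq (region lo hi) (picture_set E P) (picture_set E Q)"
proof (cases m)
  case (Split p q z)
  then have ok: "has_seg p q (fst P)" "between p z q" and Q: "Q = ((p, z) # (z, q) # del_seg p q (fst P), snd P)"
    using m by (auto split: if_splits)
  have "picture_set E P = picture_set E Q"
    unfolding Q picture_set_eq using segs_set_del_seg[OF ok(1)] between_segment[OF ok(2)] by auto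
  then show ?thesis by simp
next
  case (Merge p z q)
  then have ok: "has_segs [(p, z), (z, q)] (fst P)" "between p z q"
    and Q: "Q = ((p, q) # del_segs [(p, z), (z, q)] (fst P), snd P)"
    using m by (auto split: if_splits)
  have "picture_set E P = picture_set E Q"
    unfolding Q picture_set_eq fst_conv snd_conv segs_set_del_segs[OF ok(1)] between_segment[OF ok(2)] segs_set_simps
    by auto
  then show ?thesis by simp
next
  case (Vertex v w ts)
  then show ?thesis using m vertex_move_sound[OF E, of lo hi v w ts P] by (auto split: if_splits)
next
  case (Box i c L z l)
  obtain z0 l0 where look: "map_of (snd P) i = Some (z0, l0)"
    using m Box by (cases "map_of (snd P) i") auto
  define T where "T = legs c L z0 l0"
  define S where "S = del_segs T (fst P)"
  define B where "B = filter (\<lambda>b. fst b \<noteq> i) (snd P)"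
  have ok: "0 < L" "in_closed lo hi c" "in_closed lo hi (fst c + L, snd c + L)"
    "strictly_inside c L z0 l0" "strictly_inside c L z l"
    and f: "filter (\<lambda>b. fst b = i) (snd P) = [(i, z0, l0)]" and has: "has_segs T (fst P)"
    and oS: "\<forall>s\<in>set S. outside_square c L [fst s, snd s]"
    and oB: "\<forall>b\<in>set B. outside_square c L (box_corners (fst (snd b)) (snd (snd b)))"
    and Q: "Q = (legs c L z l @ S, (i, z, l) # B)"
    using m Box look unfolding T_def S_def B_def by (auto simp: Let_def split: if_splits)
  have "set (snd P) = set (filter (\<lambda>b. fst b = i) (snd P)) \<union> set B" unfolding B_def by auto
  then have "picture_set E P = picture_set E (T @ S, (i, z0, l0) # B)"
    unfolding picture_set_eq f S_def using segs_set_del_segs[OF has] by simp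
  then show ?thesis
    unfolding Q using box_move_sound[OF E E ok oS oB] by (simp add: T_def)
next
  case (Kink p u v)
  define T where "T = grid_path p u v [(0, 2), (3, 3), (1, 3), (4, 2)]"
  have rep: "replaceable lo hi p u v T [grid p u v 0 2, grid p u v 4 2] P"
    and Q: "Q = (grid_path p u v [(0, 2), (4, 2)] @ del_segs T (fst P), snd P)"
    using m Kink by (auto simp: Let_def T_def split: if_splits)
  show ?thesis unfolding Q
  proof (rule replaceable_sound[OF E rep])
    show "(polygonal [(0, 1/2), (3/4, 3/4), (1/4, 3/4), (1, 1/2)], polygonal [(0, 1/2), (1, 1/2)]) \<in> local_models \<or>
      (polygonal [(0, 1/2), (1, 1/2)], polygonal [(0, 1/2), (3/4, 3/4), (1/4, 3/4), (1, 1/2)]) \<in> local_models"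
      by (simp add: local_models_def)
  qed (use local_model_subset in \<open>auto simp: T_def segs_set_grid_path real_point_grid\<close>)
next
  case (Flip p u v)
  define T where "T = grid_crossing p u v @ grid_path p u v [(0, 2), (2, 3), (4, 2)]"
  have rep: "replaceable lo hi p u v T
      [grid p u v 0 0, grid p u v 4 4, grid p u v 0 4, grid p u v 4 0, grid p u v 0 2, grid p u v 4 2] P"
    and Q: "Q = ((grid_crossing p u v @ grid_path p u v [(0, 2), (2, 1), (4, 2)]) @ del_segs T (fst P), snd P)"
    using m Flip by (auto simp: Let_def T_def split: if_splits)
  show ?thesis unfolding Q
  proof (rule replaceable_sound[OF E rep])
    show "(crossing \<union> polygonal [(0, 1/2), (1/2, 3/4), (1, 1/2)], crossing \<union> polygonal [(0, 1/2), (1/2, 1/4), (1, 1/2)])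
       \<in> local_models \<or>
      (crossing \<union> polygonal [(0, 1/2), (1/2, 1/4), (1, 1/2)], crossing \<union> polygonal [(0, 1/2), (1/2, 3/4), (1, 1/2)])
       \<in> local_models"
      by (simp add: local_models_def)
  qed (use local_model_subset in \<open>auto simp: T_def segs_set_grid_path segs_set_grid_crossing real_point_grid
      image_Un crossing_def\<close>)
qed

lemma apply_moves_sound:
  assumes "\<And>i. E i \<subseteq> unit_square"
  shows "apply_moves lo hi ms P = Some Q \<Longrightarrow> planar_eq (region lo hi) (picture_set E P) (picture_set E Q)"
proof (induction ms arbitrary: P)
  case (Cons m ms)
  then obtain P' where P': "apply_move lo hi m P = Some P'" "apply_moves lo hi ms P' = Some Q"
    by (auto split: option.splits simp del: apply_move.simps)
  show ?case by (rule planar_eq_trans[OF apply_move_sound[OF assms P'(1)] Cons.IH[OF P'(2)]])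
qed simp

lemma same_picture_sound: "same_picture P Q \<Longrightarrow> picture_set E P = picture_set E Q"
  using segs_set_has_segs[of "fst P" "fst Q"] segs_set_has_segs[of "fst Q" "fst P"]
  by (auto simp: same_picture_def picture_set_eq)

lemma joined_sound:
  assumes "\<And>i. E i \<subseteq> unit_square" and "joined lo hi ms P ns Q"
  shows "planar_eq (region lo hi) (picture_set E P) (picture_set E Q)"
proof -
  obtain P' Q' where *: "apply_moves lo hi ms P = Some P'" "apply_moves lo hi ns Q = Some Q'" "same_picture P' Q'"
    using assms(2) by (auto simp: joined_def split: option.splits)
  have "planar_eq (region lo hi) (picture_set E P) (picture_set E P')"
    "planar_eq (region lo hi) (picture_set E Q) (picture_set E Q')"
    by (rule apply_moves_sound[OF assms(1)], rule *)+
  then show ?thesis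
    unfolding same_picture_sound[OF *(3), of E] by (rule planar_eq_trans[OF _ planar_eq_sym])
qed

section \<open>Explicit isotopies\<close>

definition shift_picture :: "ipoint \<Rightarrow> picture \<Rightarrow> picture" where
  "shift_picture d P =
     (map (\<lambda>s. ((fst d + fst (fst s), snd d + snd (fst s)), (fst d + fst (snd s), snd d + snd (snd s)))) (fst P),
      map (\<lambda>b. (fst b, (fst d + fst (fst (snd b)), snd d + snd (fst (snd b))), snd (snd b))) (snd P))"

definition join_pictures :: "picture list \<Rightarrow> picture" where
  "join_pictures Ps = (concat (map fst Ps), concat (map snd Ps))"

definition scaled_segments :: "int \<Rightarrow> segment list \<Rightarrow> picture" where
  "scaled_segments m S = (map (\<lambda>s. ((m * fst (fst s), m * snd (fst s)), (m * fst (snd s), m * snd (snd s)))) S, [])"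

text \<open>The parameter \<open>m\<close> is one eighth of the side of the square that contains the composite, so
  that the two components have side \<open>2 * m\<close>.\<close>

definition stack_legs :: "segment list" where
  "stack_legs = [((0, 8), (3, 7)), ((8, 8), (5, 7)), ((3, 5), (3, 3)), ((5, 5), (5, 3)),
     ((3, 1), (0, 0)), ((5, 1), (8, 0))]"

definition juxtapose_legs :: "segment list" where
  "juxtapose_legs = [((0, 8), (1, 5)), ((0, 0), (1, 3)), ((3, 5), (5, 5)), ((3, 3), (5, 3)),
     ((7, 5), (8, 8)), ((7, 3), (8, 0))]"

definition stack_picture :: "int \<Rightarrow> picture \<Rightarrow> picture \<Rightarrow> picture" where
  "stack_picture m P Q = join_pictures
     [shift_picture (3 * m, 5 * m) P, shift_picture (3 * m, m) Q, scaled_segments m stack_legs]"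

definition juxtapose_picture :: "int \<Rightarrow> picture \<Rightarrow> picture \<Rightarrow> picture" where
  "juxtapose_picture m P Q = join_pictures
     [shift_picture (m, 3 * m) P, shift_picture (5 * m, 3 * m) Q, scaled_segments m juxtapose_legs]"

definition crossing_picture :: "int \<Rightarrow> picture" where
  "crossing_picture m = scaled_segments m [((0, 0), (1, 1)), ((0, 1), (1, 0))]"

definition box_picture :: "nat \<Rightarrow> int \<Rightarrow> picture" where
  "box_picture i m = ([], [(i, (0, 0), m)])"

definition zero_picture :: "int \<Rightarrow> picture" where
  "zero_picture m = scaled_segments m [((0, 0), (2, 1)), ((2, 1), (4, 0)), ((0, 4), (2, 3)), ((2, 3), (4, 4))]"

definition infinity_picture :: "int \<Rightarrow> picture" where
  "infinity_picture m = scaled_segments m [((0, 0), (1, 2)), ((1, 2), (0, 4)), ((4, 0), (3, 2)), ((3, 2), (4, 4))]"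

definition closure_legs :: "int \<Rightarrow> picture" where
  "closure_legs m = scaled_segments m [((0, 2), (1, 4)), ((1, 4), (2, 2)), ((0, 0), (1, -2)), ((1, -2), (2, 0))]"

text \<open>The three strands that leave the box on the right form the model picture of type 3; the
  reflection in the antidiagonal of the square preserves the box and exchanges the two sides
  of this model.\<close>

definition braid_picture :: picture where
  "braid_picture =
     (grid_crossing (768, 1536) (192, -192) (192, 192) @
      grid_path (768, 1536) (192, -192) (192, 192) [(0, 2), (2, 3), (4, 2)] @
      [((0, 3072), (744, 2328)), ((792, 2328), (1536, 2304)), ((744, 2280), (768, 1536)),
       ((792, 2280), (1152, 1920)), ((2304, 1536), (3072, 3072)), ((1536, 768), (0, 0)),
       ((1920, 1152), (3072, 0))],
      [(0, (744, 2280), 48)])"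

definition braid_moves :: "move list" where
  "braid_moves = [
    Split (792,1752) (840,1704) (816,1728), Split (792,1704) (840,1752) (816,1728), Split (672,1440) (864,1248) (768,1344),
    Split (672,1248) (864,1440) (768,1344), Split (1920,1920) (2688,1152) (2304,1536), Split (1920,1152) (2688,1920) (2304,1536),
    Vertex (2688,1920) (2688,2304) [[(-2,-1,9216),(1,1,-3840)]], Merge (2304,1536) (2688,2304) (3072,3072),
    Vertex (1920,1920) (1728,1728) [[(2,1,-4224),(-2,1,3072),(-1,1,768),(0,1,-1152)]], Merge (2304,1536) (1728,1728) (1152,1920),
    Vertex (864,1248) (960,1248) [[(-3,-1,4608),(1,-1,576),(3,1,-2304)]], Merge (768,1344) (960,1248) (1152,1152),
    Vertex (864,1440) (816,1488) [[(1,-2,2400),(-1,-1,2496),(1,2,-3456),(1,1,-2112),(1,0,-672),(-1,1,0)]], Merge (768,1344) (816,1488) (864,1632),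
    Vertex (864,1632) (804,1524) [[(2,-3,3432),(-1,-2,4248),(1,3,-4800),(1,1,-2112),(1,0,-672),(-1,1,0)]], Merge (768,1344) (804,1524) (840,1704),
    Vertex (792,1704) (780,1716) [[(1,1,-2448),(2,-1,216),(-5,1,2496),(-1,-1,2544),(0,-1,1752)]], Merge (816,1728) (780,1716) (744,1704),
    Vertex (864,1824) (996,1836) [[(-10,3,5760),(1,3,-6096),(3,1,-3840)]], Merge (840,1752) (996,1836) (1152,1920),
    Vertex (672,1248) (576,1248) [[(3,-1,0),(-1,-1,2112)]], Merge (768,1344) (576,1248) (384,1152),
    Vertex (672,1440) (720,1488) [[(-1,-2,3936),(-1,2,-1920),(-5,1,2496)]], Merge (768,1344) (720,1488) (672,1632),
    Vertex (672,1632) (732,1524) [[(-2,-3,6504),(-1,3,-3264),(-5,1,2496)]], Merge (768,1344) (732,1524) (696,1704),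
    Vertex (792,1752) (780,1740) [[(2,1,-3240),(-1,3,-4368),(-1,1,-912)]], Merge (816,1728) (780,1740) (744,1752),
    Vertex (672,1824) (540,1836) [[(1,-2,3456),(-1,1,-1008),(-1,3,-4560)]], Merge (696,1752) (540,1836) (384,1920),
    Vertex (384,1152) (384,672) [[(2,1,0),(-7,-13,27648),(-2,-1,2880)]], Merge (768,1344) (384,672) (0,0),
    Vertex (2688,1152) (2688,768) [[(1,3,-3072),(1,-1,-768)]], Merge (2304,1536) (2688,768) (3072,0),
    Vertex (1920,1152) (1728,1344) [[(2,-1,-1152),(-2,-1,6144),(-1,-3,6912)]], Merge (2304,1536) (1728,1344) (1152,1152),
    Vertex (1152,1920) (1572,1644) [[(-2,-1,6144),(-1,3,-2304),(23,35,-66816),(2,1,-3432)]], Merge (840,1752) (1572,1644) (2304,1536),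
    Vertex (840,1704) (792,1536) [[(7,-9,9840),(-9,-61,114432),(-1,1,0),(0,1,-1344),(5,1,-5184)]], Merge (768,1344) (792,1536) (816,1728),
    Vertex (384,1920) (348,2412) [[(-13,-42,129024),(-2,1,-360)]], Merge (696,1752) (348,2412) (0,3072),
    Vertex (840,1752) (1560,1632) [[(35,27,-75216),(1,0,-816),(-1,3,-2304),(-1,0,2304)]], Merge (2304,1536) (1560,1632) (816,1728),
    Vertex (1152,1152) (1536,1440) [[(3,1,-3648),(9,-7,2496),(-4,-31,56832),(-1,0,2304)]], Merge (2304,1536) (1536,1440) (768,1344),
    Vertex (768,1344) (1536,1536) [[(11,-19,23856),(-4,-31,56832),(-1,0,2304),(1,2,0)],[(-4,-31,56832),(-1,0,2304),(0,-1,1704),(1,2,0)]],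
    Vertex (2304,1536) (1792,1536) [[(27,-35,38448),(4,15,-29184),(-1,-2,9216)],[(-3,-1,12288),(1,0,-1536),(-1,2,3072)]],
    Vertex (816,1728) (1536,1792) [[(-1,0,1792),(0,1,-1536),(1,5,-9216),(1,0,-744)]], Split (696,1704) (1536,1536) (701,1703),
    Vertex (701,1703) (420,1680) [[(-3,-2,7680),(-27,35,-12288),(0,-1,1704)]], Split (744,1704) (1536,1792) (753,1705),
    Vertex (753,1705) (1120,1680) [[(-33,19,16640),(5,-99,169728),(4,31,-53760),(1,0,-744)]], Split (696,1752) (0,3072) (667,1807),
    Vertex (667,1807) (420,2380) [[(-34,-139,427008),(-2,1,-264),(-2,23,-37800),(-29,55,-76176)]], Split (744,1752) (1536,1792) (843,1757),
    Vertex (843,1757) (1120,2380) [[(-52,47,-4352),(3,47,-82320),(-7,26,-35840),(99,5,-82416)]], Box 0 (420,1680) 700 (744,2280) 48,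
    Vertex (420,2380) (372,2700) [[(0,-1,3072),(-50,27,-24360),(-1,0,744)]], Merge (744,2328) (372,2700) (0,3072),
    Vertex (1120,2380) (1164,2060) [[(-251,43,308480),(-13,80,-123392),(4,31,-53760),(75,41,-152880),(80,11,-88968)]],
    Merge (792,2328) (1164,2060) (1536,1792), Vertex (1120,1680) (1164,2036) [[(-33,19,16640),(-67,-93,269568),(4,31,-53760),(2,-1,696)]],
    Merge (792,2280) (1164,2036) (1536,1792),
    Vertex (420,1680) (1140,1908) [[(-61,-93,260352),(-1,1,0),(-3,1,2816),(0,-1,2280)],[(-32,-1,50688),(-27,35,-12288),(-61,-93,260352),(19,-60,121752)]],
    Merge (744,2280) (1140,1908) (1536,1536)]"

definition braid_picture_moves :: "move list" where
  "braid_picture_moves = [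
    Split (1536,2304) (1536,768) (1536,1536), Split (768,1536) (2304,1536) (1536,1536), Split (1152,1920) (1728,1728) (1536,1792),
    Split (1536,2304) (1536,1536) (1536,1792), Split (1728,1728) (1920,1152) (1792,1536), Split (1536,1536) (2304,1536) (1792,1536),
    Vertex (2304,1536) (2432,2304) [[(-3,-1,12288),(3,1,-6912),(1,1,-3072)]], Merge (1792,1536) (2432,2304) (3072,3072),
    Vertex (1536,768) (768,768) [[(1,0,0),(0,-1,1536),(-1,-1,3072)]], Merge (1536,1536) (768,768) (0,0),
    Vertex (1728,1728) (1664,1664) [[(-2,1,2048),(0,1,-1536),(1,0,-1536)]], Merge (1536,1792) (1664,1664) (1792,1536),
    Vertex (768,1536) (1140,1908) [[(-1,1,0),(-1,-1,3072),(0,-1,2280)]], Merge (1536,1536) (1140,1908) (744,2280),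
    Vertex (1920,1152) (2432,768) [[(0,1,0),(1,-1,0),(1,-3,2816)]], Merge (1792,1536) (2432,768) (3072,0),
    Vertex (1536,2304) (1164,2060) [[(-1,1,-256),(1,3,-6912),(1,1,-3072),(2,-1,696)],[(80,13,-93624),(-6,5,3072),(1,31,-60672),(1,1,-3072)]],
    Merge (1536,1792) (1164,2060) (792,2328), Vertex (1152,1920) (1164,2036) [[(16,-77,162888),(-67,-93,269568),(31,33,-98304),(-3,1,2816)]],
    Merge (1536,1792) (1164,2036) (792,2280)]"

definition crossing_moves :: "move list" where
  "crossing_moves = [
    Split (1920,1920) (2688,1152) (2304,1536), Split (1920,1152) (2688,1920) (2304,1536),
    Vertex (768,1344) (768,1152) [[(-1,1,0),(0,-1,1728),(1,0,-384)]], Merge (384,1152) (768,1152) (1152,1152),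
    Vertex (2688,1152) (2688,768) [[(1,3,-3072),(1,-1,-768)]], Merge (2304,1536) (2688,768) (3072,0),
    Vertex (1920,1152) (1728,1344) [[(2,-1,-1152),(-2,-1,6144),(-1,-1,3840),(0,-1,1920)]], Merge (2304,1536) (1728,1344) (1152,1152),
    Vertex (2688,1920) (2688,2304) [[(-2,-1,9216),(1,1,-3840)]], Merge (2304,1536) (2688,2304) (3072,3072),
    Vertex (1920,1920) (1728,1728) [[(2,1,-4224),(-2,1,3072),(-1,3,-2304)]], Merge (2304,1536) (1728,1728) (1152,1920),
    Vertex (768,1728) (768,1920) [[(-3,1,1536),(0,1,-1152),(1,0,-384)]], Merge (384,1920) (768,1920) (1152,1920),
    Vertex (384,1152) (576,576) [[(2,1,0),(0,-1,1920),(-3,-1,4608)]], Merge (1152,1152) (576,576) (0,0),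
    Vertex (1152,1920) (1344,1728) [[(-2,-1,6144),(-1,3,-2304),(1,0,-384)]], Merge (384,1920) (1344,1728) (2304,1536),
    Vertex (384,1920) (1152,2304) [[(-5,-1,13056),(-1,3,-2304),(1,-2,6144)]], Merge (2304,1536) (1152,2304) (0,3072),
    Vertex (1152,1152) (1152,768) [[(-1,-2,5376),(-5,1,9984),(2,1,0)]], Merge (0,0) (1152,768) (2304,1536),
    Vertex (2304,1536) (1536,1536) [[(0,1,0),(1,-1,3072),(-1,-2,9216)]], Merge (0,0) (1536,1536) (3072,3072), Merge (0,3072) (1536,1536) (3072,0)]"

definition kink_moves :: "move list" where
  "kink_moves = [
    Split (1152,1152) (1920,384) (1536,768), Split (1152,384) (1920,1152) (1536,768),
    Vertex (1152,2688) (768,2784) [[(1,-2,6144),(-1,2,-2688),(-2,1,576)]], Merge (1536,2496) (768,2784) (0,3072),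
    Vertex (1536,2112) (1536,1920) [[(-1,1,0),(0,-1,2496),(1,0,-1152)]], Merge (1152,1920) (1536,1920) (1920,1920),
    Vertex (1920,384) (2304,384) [[(-1,2,3072),(1,-1,-768)]], Merge (1536,768) (2304,384) (3072,0),
    Vertex (1152,384) (768,384) [[(3,-1,0),(-1,-1,2304)]], Merge (1536,768) (768,384) (0,0),
    Vertex (1920,1152) (1728,1344) [[(1,-2,1920),(1,1,-2304),(1,2,-3072),(1,0,-1152)]], Merge (1536,768) (1728,1344) (1920,1920),
    Vertex (1920,1920) (1344,1344) [[(1,-1,768),(-1,3,-768),(1,1,-2304),(0,-1,2688),(1,0,-1152)]], Merge (1536,768) (1344,1344) (1152,1920),
    Vertex (1920,2688) (2304,2784) [[(-11,5,18432),(1,1,-3072),(2,1,-5568)]], Merge (1536,2496) (2304,2784) (3072,3072),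
    Vertex (1536,768) (1536,1280) [[(1,-1,0),(-2,1,6144)],[(-1,3,3072),(0,-1,2496),(1,0,-1152)]],
    Vertex (1152,1920) (1792,1408) [[(-1,3,-2304),(-3,-8,24576)]], Vertex (1152,1152) (1280,1408) [[(-1,2,-1024),(-1,-3,9024)]],
    Split (1536,1280) (0,0) (1026,855), Vertex (1026,855) (1024,1024) [[(1,0,0),(-2,-1,4352),(-1,-2,4096)]], Split (1536,1280) (3072,0) (2046,855),
    Vertex (2046,855) (2048,1024) [[(-1,11,3072),(1,-2,1024),(169,-2,-171008)]], Merge (1024,1024) (1536,1280) (1792,1408),
    Merge (1280,1408) (1536,1280) (2048,1024), Kink (1024,256) (256,0) (0,384), Vertex (2048,1024) (2048,512) [[(1,-1,0),(-2,1,6144)]],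
    Merge (3072,0) (2048,512) (1024,1024), Vertex (1024,1024) (1536,768) [[(1,0,0),(-1,-3,9024),(-2,1,6144)]],
    Vertex (1536,2496) (1536,2304) [[(5,-11,33792),(0,1,-768),(-3,-1,12288)]]]"

definition assoc_moves :: "move list" where
  "assoc_moves = [
    Merge (2592,1632) (2688,1920) (3072,3072), Vertex (1920,1920) (1584,1776) [[(2,1,-4224),(-3,1,6144),(-3,7,-5376)]],
    Merge (2016,1632) (1584,1776) (1152,1920), Merge (2592,1440) (2688,1152) (3072,0),
    Vertex (1920,1152) (1584,1296) [[(2,-1,-1152),(-3,-1,9216),(-3,-7,16128)]], Merge (2016,1440) (1584,1296) (1152,1152),
    Split (384,1152) (0,0) (383,1149), Vertex (383,1149) (300,1050) [[(9,5,0),(-1,0,1152),(-1,-3,3840)]], Split (1152,1152) (2016,1440) (1155,1153),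
    Vertex (1155,1153) (1260,1050) [[(-1,-2,4896),(-191,61,297216),(1,0,-1152)]], Split (384,1920) (0,3072) (383,1923),
    Vertex (383,1923) (300,2010) [[(-1,-2,6144),(-1,0,1152),(-1,3,-5376)]], Split (1152,1920) (2016,1632) (1155,1919),
    Vertex (1155,1919) (1260,2010) [[(-3,-1,7680),(-1,2,-1248),(1,0,-1152)]], Box 0 (300,1050) 960 (720,1440) 192,
    Vertex (1260,1050) (1464,1440) [[(-1,-1,3456),(-191,61,297216),(63,-58,37200),(-1,-2,5280),(65,-34,-10320)]],
    Merge (912,1440) (1464,1440) (2016,1440), Vertex (300,1050) (360,720) [[(9,5,0),(-1,-1,2160)]], Merge (720,1440) (360,720) (0,0),
    Vertex (1260,2010) (1464,1632) [[(-3,-1,7680),(-1,1,384),(0,1,-1440),(63,34,-112944)]], Merge (912,1632) (1464,1632) (2016,1632),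
    Vertex (300,2010) (360,2352) [[(-1,-3,9216),(-1,1,-912)]], Merge (720,1632) (360,2352) (0,3072), Split (720,1440) (0,0) (719,1438),
    Vertex (719,1438) (420,1200) [[(27,13,0),(-1,0,912),(-1,-2,3600)]], Split (912,1440) (2016,1440) (913,1440),
    Vertex (913,1440) (1020,1200) [[(-1,-1,3456),(-103,63,116928),(0,-1,1632),(1,0,-912)]], Split (720,1632) (0,3072) (719,1634),
    Vertex (719,1634) (420,1800) [[(-1,-3,9216),(-1,0,912),(-1,2,-2544)]], Split (912,1632) (2016,1632) (913,1632),
    Vertex (913,1632) (1020,1800) [[(-97,-69,308160),(-1,1,384),(0,1,-1440),(1,0,-912)]], Box 0 (420,1200) 600 (480,1440) 192,
    Vertex (1020,1800) (1344,1632) [[(-97,-69,308160),(-1,1,384),(3,1,-3072),(20,29,-55200),(-20,83,-79200),(2,1,-2976)]],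
    Merge (672,1632) (1344,1632) (2016,1632), Vertex (420,1200) (240,720) [[(2,1,0),(-1,-1,2112),(-1,-3,4800)]], Merge (480,1440) (240,720) (0,0),
    Vertex (420,1800) (240,2352) [[(-1,-2,6144),(-2,1,-288),(-1,3,-4416)]], Merge (480,1632) (240,2352) (0,3072),
    Vertex (1020,1200) (1344,1440) [[(-1,-1,3456),(-103,63,116928),(3,-1,0),(0,-1,1632),(2,-1,96)]], Merge (672,1440) (1344,1440) (2016,1440),
    Split (2016,1440) (672,1440) (2015,1440), Vertex (2015,1440) (784,828) [[(1,-1,768),(3,-1,0),(0,-1,1632),(-1,0,2016)]],
    Split (2208,1440) (2400,1440) (2209,1440), Vertex (2209,1440) (2224,828) [[(-1,-1,3840),(-204,-5,535968),(1,0,-2208)]],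
    Split (2016,1632) (672,1632) (2015,1632), Vertex (2015,1632) (784,2268) [[(187,131,-339456),(0,1,-1440),(3,1,-3072),(-1,0,2016)]],
    Split (2208,1632) (2400,1632) (2209,1632), Vertex (2209,1632) (2224,2268) [[(-1,1,768),(-212,5,541344),(1,0,-2208)]],
    Box 1 (784,828) 1440 (864,1440) 192, Vertex (784,828) (768,1440) [[(1,-1,768),(1,0,-480),(-153,-4,137952)]],
    Merge (864,1440) (768,1440) (672,1440), Vertex (784,2268) (768,1632) [[(1,1,-2304),(1,0,-480),(-159,4,130848)]],
    Merge (864,1632) (768,1632) (672,1632), Vertex (2224,2268) (1728,1632) [[(-1,1,768),(-3,1,6144),(153,292,-582048),(1,0,-1056)]],
    Merge (1056,1632) (1728,1632) (2400,1632), Vertex (2224,828) (1728,1440) [[(-197,-109,629760),(0,-1,1632),(-3,-1,9216),(1,0,-1056)]],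
    Merge (1056,1440) (1728,1440) (2400,1440)]"

definition assoc_moves2 :: "move list" where
  "assoc_moves2 = [
    Merge (480,1440) (384,1152) (0,0), Vertex (1152,1152) (1488,1296) [[(-2,-1,4992),(3,-1,0),(3,-7,6912)]],
    Merge (1056,1440) (1488,1296) (1920,1152), Vertex (1152,1920) (1488,1776) [[(-2,1,1920),(3,1,-3072),(3,7,-14592)]],
    Merge (1056,1632) (1488,1776) (1920,1920), Merge (480,1632) (384,1920) (0,3072), Split (1920,1152) (1056,1440) (1917,1153),
    Vertex (1917,1153) (1830,1050) [[(97,32,-148512),(1,-2,1824),(-1,0,1920)]], Split (2688,1152) (3072,0) (2689,1149),
    Vertex (2689,1149) (2790,1050) [[(1,2,-3072),(1,0,-1920),(1,-3,768)]], Split (1920,1920) (1056,1632) (1917,1919),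
    Vertex (1917,1919) (1830,2010) [[(1,2,-4320),(32,-11,-15840),(-1,0,1920)]], Split (2688,1920) (3072,3072) (2689,1923),
    Vertex (2689,1923) (2790,2010) [[(-112,-65,543744),(1,0,-1920),(1,3,-8448)]], Box 2 (1830,1050) 960 (2160,1440) 192,
    Vertex (2790,1050) (2712,720) [[(1,3,-3072),(1,-1,-912)]], Merge (2352,1440) (2712,720) (3072,0),
    Vertex (1830,1050) (1608,1440) [[(97,32,-148512),(1,-1,384),(-63,-55,225840),(21,-43,48000),(-65,-37,193680)]],
    Merge (2160,1440) (1608,1440) (1056,1440), Vertex (2790,2010) (2712,2352) [[(-112,-65,543744),(1,1,-3984)]],
    Merge (2352,1632) (2712,2352) (3072,3072), Vertex (1830,2010) (1608,1632) [[(1,1,-2688),(32,-11,-15840),(0,1,-1440),(-63,37,75696)]],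
    Merge (2160,1632) (1608,1632) (1056,1632), Split (2160,1440) (1056,1440) (2159,1440),
    Vertex (2159,1440) (2100,1200) [[(107,67,-209472),(1,-1,384),(0,-1,1632),(-1,0,2160)]], Split (2352,1440) (3072,0) (2353,1438),
    Vertex (2353,1438) (2700,1200) [[(1,3,-3072),(1,0,-2160),(1,-2,528)]], Split (2160,1632) (1056,1632) (2159,1632),
    Vertex (2159,1632) (2100,1800) [[(1,1,-2688),(101,-73,12480),(0,1,-1440),(-1,0,2160)]], Split (2352,1632) (3072,3072) (2353,1634),
    Vertex (2353,1634) (2700,1800) [[(-137,-75,651264),(1,0,-2160),(1,2,-5616)]], Box 2 (2100,1200) 600 (2400,1440) 192,
    Vertex (2700,1800) (2832,2352) [[(-137,-75,651264),(2,1,-6432),(1,2,-5856)]], Merge (2592,1632) (2832,2352) (3072,3072),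
    Vertex (2100,1200) (1728,1440) [[(107,67,-209472),(1,-1,384),(14,-87,127200),(-1,0,2700),(-1,-1,3840)]],
    Merge (2400,1440) (1728,1440) (1056,1440), Vertex (2700,1200) (2832,720) [[(1,2,-3072),(1,-1,-960),(1,-2,288)]],
    Merge (2592,1440) (2832,720) (3072,0), Vertex (2100,1800) (1728,1632) [[(1,1,-2688),(101,-73,12480),(0,1,-1440),(-3,1,6144),(-2,1,3168)]],
    Merge (2400,1632) (1728,1632) (1056,1632)]"

definition closure_moves :: "move list" where
  "closure_moves = [
    Split (1152,1152) (1920,384) (1536,768), Split (1152,384) (1920,1152) (1536,768),
    Vertex (1536,-3072) (1536,0) [[(1,-3,0),(-1,-1,2304)],[(1,-1,-768),(-1,-3,3072)]], Merge (0,0) (1536,0) (3072,0),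
    Vertex (3072,3072) (1728,4416) [[(2,-1,3072),(1,1,-4608)]], Merge (1920,2688) (1728,4416) (1536,6144),
    Vertex (1152,384) (768,384) [[(0,1,0),(-1,-1,2304)]], Merge (1536,768) (768,384) (0,0), Vertex (1920,384) (2304,384) [[(1,-1,-768),(0,1,0)]],
    Merge (1536,768) (2304,384) (3072,0), Vertex (1920,1152) (1728,1344) [[(1,-2,1920),(1,2,-3072),(1,1,-2304),(1,0,-1152)]],
    Merge (1536,768) (1728,1344) (1920,1920), Vertex (0,3072) (1344,4416) [[(-9,-1,19968),(-1,1,-1536)]], Merge (1152,2688) (1344,4416) (1536,6144),
    Vertex (1152,1152) (1344,1344) [[(-1,-2,4992),(-3,1,3840),(-1,2,0)]], Merge (1536,768) (1344,1344) (1152,1920),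
    Vertex (3072,0) (1664,640) [[(1,-2,0)]], Vertex (0,0) (1408,640) [[(-1,-1,2304)]], Split (1536,768) (1152,1920) (1408,1152),
    Vertex (1408,1152) (1280,1024) [[(-1,-2,4992),(-3,1,3840),(-1,1,768)]], Split (1536,768) (1920,1920) (1664,1152),
    Vertex (1664,1152) (1792,1024) [[(1,-2,1920),(1,1,-2304),(7,1,-9984)]], Merge (1280,1024) (1536,768) (1664,640),
    Merge (1408,640) (1536,768) (1792,1024), Kink (1280,1792) (128,0) (0,-384), Vertex (1792,1024) (1600,1472) [[(7,1,-9984),(0,-1,1920)]],
    Merge (1920,1920) (1600,1472) (1280,1024), Vertex (1280,1024) (1536,-3072) [[(1,-6,9600)],[(-3,-4,11136)]],
    Split (1152,1920) (1536,-3072) (1153,1907), Vertex (1153,1907) (-512,-512) [[(-13,1,23040),(0,-1,1920)]],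
    Split (1920,1920) (1536,-3072) (1919,1907), Vertex (1919,1907) (3584,-512) [[(1,0,-1152),(5,4,4608),(0,-1,1920)]],
    Split (1152,2688) (1536,6144) (1153,2697), Vertex (1153,2697) (-512,3584) [[(-9,-1,19968),(0,1,-2688)]],
    Split (1920,2688) (1536,6144) (1919,2697), Vertex (1919,2697) (3584,3584) [[(5,-4,16896),(1,0,-1152),(0,1,-2688)]],
    Box 0 (-512,-512) 4096 (0,0) 3072, Vertex (3584,3584) (2304,4608) [[(3,-1,1536),(4,5,-27648)]], Merge (3072,3072) (2304,4608) (1536,6144),
    Vertex (3584,-512) (2304,-1536) [[(3,1,-1536),(4,-5,-12288)]], Merge (3072,0) (2304,-1536) (1536,-3072),
    Vertex (-512,3584) (768,4608) [[(-3,-1,10752),(-4,5,-15360)]], Merge (0,3072) (768,4608) (1536,6144),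
    Vertex (-512,-512) (768,-1536) [[(-3,1,7680),(-4,-5,0)]], Merge (0,0) (768,-1536) (1536,-3072)]"

definition diamond_moves :: "move list" where
  "diamond_moves = [
    Vertex (768,1536) (-3072,1536) [[(-1,-3,9216),(-1,0,2304),(0,1,0)]], Vertex (2304,1536) (6144,1536) [[(1,-3,6144),(2,1,0),(0,1,0)]],
    Vertex (3072,3072) (3840,3840) [[(3,-1,1536),(1,1,0),(-1,2,3072)]], Merge (6144,1536) (3840,3840) (1536,6144),
    Vertex (0,0) (-768,-768) [[(-3,1,7680),(-1,-1,7680),(1,-2,6144)]], Merge (-3072,1536) (-768,-768) (1536,-3072),
    Vertex (0,3072) (-768,3840) [[(-3,-1,10752),(1,1,1536),(-1,1,3072)]], Merge (-3072,1536) (-768,3840) (1536,6144),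
    Vertex (3072,0) (3840,-768) [[(3,1,-1536),(1,-1,4608),(-1,-1,7680)]], Merge (6144,1536) (3840,-768) (1536,-3072)]"

text \<open>Three nested composites divide the side by 4 each time, from 3072 to 768, 192 and 48,
  and the shifts by multiples of 384, 96 and 24 stay integral. Both lists consist of isotopies and
  changes of the subdivision only.\<close>

lemma braid_joined:
  "joined 0 3072 braid_moves
     (juxtapose_picture 384 (stack_picture 96 (juxtapose_picture 24 (box_picture 0 48) (crossing_picture 48))
        (crossing_picture 192)) (crossing_picture 768))
     braid_picture_moves braid_picture"
  by code_simp

text \<open>The lower left corner of a reflected box is the image of the upper right corner. The
  content of the box is not reflected here; \<open>unit_picture_reflect\<close> accounts for it by
  applying \<open>tau\<close> to \<open>E\<close>.\<close>

definition reflect_picture :: "int \<Rightarrow> picture \<Rightarrow> picture" where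
  "reflect_picture m P =
     (map (\<lambda>s. ((m - snd (fst s), m - fst (fst s)), (m - snd (snd s), m - fst (snd s)))) (fst P),
      map (\<lambda>b. (fst b, (m - snd (fst (snd b)) - snd (snd b), m - fst (fst (snd b)) - snd (snd b)), snd (snd b)))
        (snd P))"

lemma braid_flip_joined:
  "joined 0 3072 [Flip (768, 1536) (192, -192) (192, 192)] braid_picture [] (reflect_picture 3072 braid_picture)"
  by code_simp

lemma crossing_joined:
  "joined 0 3072 crossing_moves (juxtapose_picture 384 (zero_picture 192) (crossing_picture 768))
     [] (crossing_picture 3072)"
  by code_simp

lemma kink_joined:
  "joined 0 3072 kink_moves (stack_picture 384 (zero_picture 192) (crossing_picture 768)) [] (zero_picture 768)"
  by code_simp

lemma assoc_joined:
  "joined 0 3072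
     assoc_moves (juxtapose_picture 384 (box_picture 0 768)
       (juxtapose_picture 96 (box_picture 1 192) (box_picture 2 192)))
     assoc_moves2 (juxtapose_picture 384
       (juxtapose_picture 96 (box_picture 0 192) (box_picture 1 192)) (box_picture 2 768))"
  by code_simp

text \<open>The bounds are -4 and 5 in units of the side 3072. They leave room for the closing arcs,
  and the box they define is symmetric about the centre of the unit square, hence invariant under
  \<open>tau\<close>.\<close>

lemma closure_joined:
  "joined (-12288) 15360 closure_moves
     (join_pictures [stack_picture 384 (box_picture 0 768) (crossing_picture 768), closure_legs 1536])
     [] (join_pictures [box_picture 0 3072, closure_legs 1536])"
  by code_simp

lemma diamond_joined:
  "joined (-12288) 15360 diamond_moves (join_pictures [infinity_picture 768, closure_legs 1536])
     [] (scaled_segments 1536 [((-2, 1), (1, 4)), ((1, 4), (4, 1)), ((4, 1), (1, -2)), ((1, -2), (-2, 1))])"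
  by code_simp

section \<open>Tangles\<close>

definition tangle_eq :: "plane set \<Rightarrow> plane set \<Rightarrow> bool" (infix "\<doteq>" 50) where
  "S \<doteq> T \<longleftrightarrow> planar_eq (open_box 0 1) S T"

lemma tangle_eq_refl [simp]: "S \<doteq> S"
  by (simp add: tangle_eq_def)

lemma tangle_eq_sym: "S \<doteq> T \<Longrightarrow> T \<doteq> S"
  unfolding tangle_eq_def by (rule planar_eq_sym)

lemma tangle_eq_trans [trans]: "S \<doteq> T \<Longrightarrow> T \<doteq> U \<Longrightarrow> S \<doteq> U"
  unfolding tangle_eq_def by (rule planar_eq_trans)

text \<open>Reflection in the diagonal from NW to SE. It exchanges rows with columns and keeps the
  order of the components, so a statement about \<open>juxtapose\<close> yields its counterpart
  about \<open>stack\<close>.\<close>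

definition tau :: "plane \<Rightarrow> plane" where
  "tau z = (1 - snd z, 1 - fst z)"

lemma tau_tau [simp]: "tau (tau z) = z"
  by (simp add: tau_def)

lemma tau_image_image [simp]: "tau ` tau ` S = S"
  by (simp add: image_image)

lemma tau_combination: "tau ((1 - s) *\<^sub>R a + s *\<^sub>R b) = (1 - s) *\<^sub>R tau a + s *\<^sub>R tau b"
  by (simp add: tau_def algebra_simps)

lemma tau_segment: "tau ` closed_segment a b = closed_segment (tau a) (tau b)"
  by (rule image_segment_pointwise) (rule tau_combination)

lemma tau_polygonal: "tau ` polygonal ps = polygonal (map tau ps)"
  by (induction ps rule: polygonal.induct) (simp_all add: image_Un tau_segment)

lemma tau_unit_square: "S \<subseteq> unit_square \<Longrightarrow> tau ` S \<subseteq> unit_square"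
  by (auto simp: tau_def)

lemma tau_crossing: "tau ` crossing = crossing"
  unfolding crossing_def image_Un tau_polygonal by (simp add: tau_def closed_segment_commute)

lemma tau_shrink: "tau ` shrink p S = shrink (3/4 - snd p, 3/4 - fst p) (tau ` S)"
  unfolding shrink_def image_image by (intro image_cong refl) (simp add: tau_def field_simps)

lemma tau_juxtapose: "tau ` juxtapose S T = stack (tau ` S) (tau ` T)"
  unfolding juxtapose_def stack_def image_Un tau_shrink tau_polygonal
  by (simp add: tau_def closed_segment_commute)

lemma tau_stack: "tau ` stack S T = juxtapose (tau ` S) (tau ` T)"
  by (metis tau_juxtapose tau_image_image)

lemma planar_eq_tau:
  assumes "planar_eq R S T" "tau ` R \<subseteq> R'"
  shows "planar_eq R' (tau ` S) (tau ` T)"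
proof -
  have lin: "linear (\<lambda>z::plane. (- snd z, - fst z))" "inj (\<lambda>z::plane. (- snd z, - fst z))"
    by (auto simp: linear_iff inj_on_def prod_eq_iff)
  have "tau = (\<lambda>z. (1, 1) + (- snd z, - fst z))" by (auto simp: tau_def)
  from planar_eq_context[OF lin assms(1), of "(1, 1)" R' "{}", folded this] show ?thesis
    using assms(2) by simp
qed

lemma tangle_eq_tau: "S \<doteq> T \<Longrightarrow> tau ` S \<doteq> tau ` T"
  unfolding tangle_eq_def by (rule planar_eq_tau) (auto simp: tau_def open_box_def)

lemma planar_eq_shrink:
  assumes "S \<doteq> T" and "shrink p (open_box 0 1) \<subseteq> R" "W \<inter> shrink p (open_box 0 1) = {}"
  shows "planar_eq R (shrink p S \<union> W) (shrink p T \<union> W)"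
  using planar_eq_context[of "\<lambda>z. (1/4) *\<^sub>R z" "open_box 0 1" S T p R W] assms
  by (simp add: tangle_eq_def shrink_def linear_iff algebra_simps inj_on_def)

lemma shrink_open_box:
  "shrink p (open_box 0 1) = {fst p <..< fst p + 1/4} \<times> {snd p <..< snd p + 1/4}"
proof (intro equalityI subsetI)
  fix z assume "z \<in> {fst p <..< fst p + 1/4} \<times> {snd p <..< snd p + 1/4}"
  then have "(4 * (fst z - fst p), 4 * (snd z - snd p)) \<in> open_box 0 1"
    by (cases z) (auto simp: open_box_def)
  moreover have "z = p + (1/4) *\<^sub>R (4 * (fst z - fst p), 4 * (snd z - snd p))"
    by (simp add: prod_eq_iff field_simps)
  ultimately show "z \<in> shrink p (open_box 0 1)" unfolding shrink_def by blast
next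
  fix z assume "z \<in> shrink p (open_box 0 1)"
  then show "z \<in> {fst p <..< fst p + 1/4} \<times> {snd p <..< snd p + 1/4}"
    by (cases p) (auto simp: shrink_def open_box_def)
qed

lemma shrink_subset:
  assumes "S \<subseteq> unit_square"
  shows "shrink p S \<subseteq> {fst p .. fst p + 1/4} \<times> {snd p .. snd p + 1/4}"
  unfolding shrink_def
proof (rule image_subsetI)
  fix w assume "w \<in> S"
  then have "w \<in> unit_square" using assms by blast
  then show "p + (1/4) *\<^sub>R w \<in> {fst p .. fst p + 1/4} \<times> {snd p .. snd p + 1/4}"
    by (cases p; cases w) auto
qed

lemma juxtapose_subset:
  assumes "S \<subseteq> unit_square" "T \<subseteq> unit_square"
  shows "juxtapose S T \<subseteq> unit_square"
proof -
  have "shrink (1/8, 3/8) S \<subseteq> unit_square" "shrink (5/8, 3/8) T \<subseteq> unit_square"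
    using shrink_subset[OF assms(1), of "(1/8, 3/8)"] shrink_subset[OF assms(2), of "(5/8, 3/8)"] by force+
  moreover have "polygonal ps \<subseteq> unit_square" if "set ps \<subseteq> unit_square" for ps
    using polygonal_subset_convex[OF convex_unit_square that] .
  ultimately show ?thesis
    unfolding juxtapose_def by (intro Un_least) (simp_all del: polygonal.simps)
qed

lemma stack_subset:
  assumes "S \<subseteq> unit_square" "T \<subseteq> unit_square"
  shows "stack S T \<subseteq> unit_square"
  using tau_unit_square[OF juxtapose_subset[OF tau_unit_square[OF assms(1)] tau_unit_square[OF assms(2)]]]
  by (simp add: tau_juxtapose)

lemma crossing_subset: "crossing \<subseteq> unit_square"
  unfolding crossing_def by (intro Un_least polygonal_subset_convex convex_unit_square) auto

definition zero_tangle :: "plane set" where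
  "zero_tangle = polygonal [(0, 0), (1/2, 1/4), (1, 0)] \<union> polygonal [(0, 1), (1/2, 3/4), (1, 1)]"

definition infinity_tangle :: "plane set" where
  "infinity_tangle = polygonal [(0, 0), (1/4, 1/2), (0, 1)] \<union> polygonal [(1, 0), (3/4, 1/2), (1, 1)]"

lemma zero_tangle_subset: "zero_tangle \<subseteq> unit_square"
  unfolding zero_tangle_def by (intro Un_least polygonal_subset_convex convex_unit_square) auto

lemma tau_zero_tangle: "tau ` zero_tangle = infinity_tangle"
  unfolding zero_tangle_def infinity_tangle_def image_Un tau_polygonal
  by (simp add: tau_def closed_segment_commute Un_ac)

lemma tau_infinity_tangle: "tau ` infinity_tangle = zero_tangle"
  by (metis tau_zero_tangle tau_image_image)

text \<open>The legs end at the corners of the small box and so miss its interior. This is why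
  \<open>tangle_eq\<close> is confined to the open square.\<close>

lemma juxtapose_cong_left:
  assumes "S \<doteq> S'" "T \<subseteq> unit_square"
  shows "juxtapose S T \<doteq> juxtapose S' T"
proof -
  define W where "W = shrink (5/8, 3/8) T \<union>
     polygonal [(0, 1), (1/8, 5/8)] \<union> polygonal [(0, 0), (1/8, 3/8)] \<union>
     polygonal [(3/8, 5/8), (5/8, 5/8)] \<union> polygonal [(3/8, 3/8), (5/8, 3/8)] \<union>
     polygonal [(7/8, 5/8), (1, 1)] \<union> polygonal [(7/8, 3/8), (1, 0)]"
  have "shrink (5/8, 3/8) T \<inter> shrink (1/8, 3/8) (open_box 0 1) = {}"
    using shrink_subset[OF assms(2), of "(5/8, 3/8)"] unfolding shrink_open_box by force
  then have W: "W \<inter> shrink (1/8, 3/8) (open_box 0 1) = {}"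
    unfolding W_def shrink_open_box
    by (auto simp: closed_segment_def field_simps disjoint_iff)
  have "planar_eq (open_box 0 1) (shrink (1/8, 3/8) S \<union> W) (shrink (1/8, 3/8) S' \<union> W)"
    by (rule planar_eq_shrink[OF assms(1) _ W]) (unfold shrink_open_box, auto simp: open_box_def)
  then show ?thesis by (simp only: tangle_eq_def juxtapose_def W_def Un_assoc)
qed

lemma stack_cong_left:
  assumes "S \<doteq> S'" "T \<subseteq> unit_square"
  shows "stack S T \<doteq> stack S' T"
  using tangle_eq_tau[OF juxtapose_cong_left[OF tangle_eq_tau[OF assms(1)] tau_unit_square[OF assms(2)]]]
  by (simp add: tau_juxtapose)

subsection \<open>Pictures of tangles\<close>

definition unit_picture :: "int \<Rightarrow> (nat \<Rightarrow> plane set) \<Rightarrow> picture \<Rightarrow> plane set" where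
  "unit_picture m E P = (\<lambda>z. (1 / of_int m) *\<^sub>R z) ` picture_set E P"

lemma planar_eq_unit_picture:
  assumes "\<And>i. E i \<subseteq> unit_square" "joined lo hi ms P ns Q" "0 < m"
  shows "planar_eq (open_box (of_int lo / of_int m) (of_int hi / of_int m)) (unit_picture m E P) (unit_picture m E Q)"
proof -
  have "(\<lambda>z. (1 / of_int m) *\<^sub>R z) ` region lo hi \<subseteq> open_box (of_int lo / of_int m) (of_int hi / of_int m)"
    using assms(3) by (auto simp: open_box_def divide_strict_right_mono)
  moreover have "linear (\<lambda>z::plane. (1 / real_of_int m) *\<^sub>R z)" "inj (\<lambda>z::plane. (1 / real_of_int m) *\<^sub>R z)"
    using assms(3) by (auto simp: linear_iff algebra_simps inj_on_def)
  ultimately show ?thesis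
    using planar_eq_context[of "\<lambda>z. (1 / real_of_int m) *\<^sub>R z" "region lo hi" _ _ 0 _ "{}"]
      joined_sound[OF assms(1,2)] by (simp add: unit_picture_def)
qed

lemma tangle_eq_unit_picture:
  assumes "\<And>i. E i \<subseteq> unit_square" "joined 0 m ms P ns Q" "0 < m"
  shows "unit_picture m E P \<doteq> unit_picture m E Q"
  using planar_eq_unit_picture[OF assms] assms(3) by (simp add: tangle_eq_def)

lemma scale_segment: "(\<lambda>z. c *\<^sub>R z) ` closed_segment a b = closed_segment (c *\<^sub>R a) (c *\<^sub>R (b::plane))"
  by (rule image_segment_pointwise) (simp add: algebra_simps)

lemma shift_segment: "(\<lambda>z. c + z) ` closed_segment a b = closed_segment (c + a) (c + (b::plane))"
  by (rule image_segment_pointwise) (simp add: algebra_simps)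

lemma picture_set_shift: "picture_set E (shift_picture d P) = (\<lambda>z. real_point d + z) ` picture_set E P"
proof -
  have 1: "segment_set ((fst d + fst (fst s), snd d + snd (fst s)), (fst d + fst (snd s), snd d + snd (snd s))) =
      (\<lambda>z. real_point d + z) ` segment_set s" for s
    by (simp add: segment_set_def shift_segment real_point_def)
  have 2: "box_set E (fst b, (fst d + fst (fst (snd b)), snd d + snd (fst (snd b))), snd (snd b)) =
      (\<lambda>z. real_point d + z) ` box_set E b" for b
    by (simp add: box_set_def image_image place_def real_point_def add.assoc[symmetric])
  show ?thesis
    unfolding picture_set_def shift_picture_def image_Un image_UN by (simp add: 1 2)
qed

lemma picture_set_join: "picture_set E (join_pictures Ps) = (\<Union>P\<in>set Ps. picture_set E P)"
  by (auto simp: picture_set_def join_pictures_def)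

lemma unit_picture_join: "unit_picture m E (join_pictures Ps) = (\<Union>P\<in>set Ps. unit_picture m E P)"
  by (auto simp: unit_picture_def picture_set_join)

lemma unit_picture_scaled:
  assumes "0 < m"
  shows "unit_picture (k * m) E (scaled_segments m S) = (\<lambda>z. (1 / of_int k) *\<^sub>R z) ` segs_set S"
proof -
  have "(\<lambda>z. (1 / of_int (k * m)) *\<^sub>R z) ` segment_set ((m * fst (fst s), m * snd (fst s)), (m * fst (snd s), m * snd (snd s)))
      = (\<lambda>z. (1 / of_int k) *\<^sub>R z) ` segment_set s" for s
    using assms by (simp add: segment_set_def scale_segment real_point_def)
  then show ?thesis
    by (simp add: unit_picture_def picture_set_def scaled_segments_def segs_set_def image_UN)
qed

lemma unit_picture_shrink:
  assumes "0 < m"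
  shows "unit_picture (8 * m) E (shift_picture (a * m, b * m) P) = shrink (of_int a / 8, of_int b / 8) (unit_picture (2 * m) E P)"
  using assms by (simp add: unit_picture_def picture_set_shift shrink_def image_image real_point_def scaleR_add_right)

lemma unit_picture_juxtapose:
  assumes "0 < m"
  shows "unit_picture (8 * m) E (juxtapose_picture m P Q) = juxtapose (unit_picture (2 * m) E P) (unit_picture (2 * m) E Q)"
  using unit_picture_shrink[OF assms, of E 1 3 P] unit_picture_shrink[OF assms, of E 5 3 Q]
    unit_picture_scaled[OF assms, of 8 E juxtapose_legs]
  by (simp add: juxtapose_picture_def unit_picture_join juxtapose_def juxtapose_legs_def image_Un
      segment_set_def scale_segment real_point_def Un_assoc)

lemma unit_picture_stack:
  assumes "0 < m"
  shows "unit_picture (8 * m) E (stack_picture m P Q) = stack (unit_picture (2 * m) E P) (unit_picture (2 * m) E Q)"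
  using unit_picture_shrink[OF assms, of E 3 5 P] unit_picture_shrink[OF assms, of E 3 1 Q]
    unit_picture_scaled[OF assms, of 8 E stack_legs]
  by (simp add: stack_picture_def unit_picture_join stack_def stack_legs_def image_Un
      segment_set_def scale_segment real_point_def Un_assoc)

lemma unit_picture_box: "0 < m \<Longrightarrow> unit_picture m E (box_picture i m) = E i"
  by (simp add: unit_picture_def picture_set_def box_picture_def box_set_def place_def real_point_def
      image_image zero_prod_def[symmetric])

lemma unit_picture_crossing: "0 < m \<Longrightarrow> unit_picture m E (crossing_picture m) = crossing"
  using unit_picture_scaled[of m 1 E "[((0, 0), (1, 1)), ((0, 1), (1, 0))]"]
  by (simp add: crossing_picture_def crossing_def segment_set_def real_point_def)

lemma unit_picture_zero: "0 < m \<Longrightarrow> unit_picture (4 * m) E (zero_picture m) = zero_tangle"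
  using unit_picture_scaled[of m 4 E "[((0, 0), (2, 1)), ((2, 1), (4, 0)), ((0, 4), (2, 3)), ((2, 3), (4, 4))]"]
  by (simp add: zero_picture_def zero_tangle_def segment_set_def real_point_def image_Un scale_segment Un_assoc)

lemma unit_picture_infinity: "0 < m \<Longrightarrow> unit_picture (4 * m) E (infinity_picture m) = infinity_tangle"
  using unit_picture_scaled[of m 4 E "[((0, 0), (1, 2)), ((1, 2), (0, 4)), ((4, 0), (3, 2)), ((3, 2), (4, 4))]"]
  by (simp add: infinity_picture_def infinity_tangle_def segment_set_def real_point_def image_Un scale_segment Un_assoc)

lemma unit_picture_reflect:
  assumes "0 < m"
  shows "unit_picture m E (reflect_picture m P) = tau ` unit_picture m (\<lambda>i. tau ` E i) P"
proof -
  have 1: "(\<lambda>z. (1 / of_int m) *\<^sub>R z) ` segment_set ((m - snd (fst s), m - fst (fst s)), (m - snd (snd s), m - fst (snd s))) =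
      tau ` (\<lambda>z. (1 / of_int m) *\<^sub>R z) ` segment_set s" for s
    unfolding segment_set_def scale_segment tau_segment
    using assms by (simp add: real_point_def tau_def diff_divide_distrib)
  have 2: "(\<lambda>z. (1 / of_int m) *\<^sub>R z) ` box_set E (fst b, (m - snd (fst (snd b)) - snd (snd b), m - fst (fst (snd b)) - snd (snd b)), snd (snd b)) =
      tau ` (\<lambda>z. (1 / of_int m) *\<^sub>R z) ` box_set (\<lambda>i. tau ` E i) b" for b
    unfolding box_set_def image_image fst_conv snd_conv
    by (intro image_cong refl) (use assms in \<open>simp add: prod_eq_iff place_def real_point_def tau_def field_simps\<close>)
  show ?thesis
    unfolding unit_picture_def picture_set_def reflect_picture_def image_Un image_UN
    by (simp add: 1[unfolded image_image] 2[unfolded image_image] image_image)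
qed

subsection \<open>Reduction of Conway tangles\<close>

definition right :: "plane set \<Rightarrow> plane set" where
  "right S = juxtapose S crossing"

definition below :: "plane set \<Rightarrow> plane set" where
  "below S = stack S crossing"

lemma right_subset: "S \<subseteq> unit_square \<Longrightarrow> right S \<subseteq> unit_square"
  by (simp add: right_def juxtapose_subset crossing_subset)

lemma right_cong: "S \<doteq> T \<Longrightarrow> right S \<doteq> right T"
  unfolding right_def by (rule juxtapose_cong_left[OF _ crossing_subset])

lemma below_cong: "S \<doteq> T \<Longrightarrow> below S \<doteq> below T"
  unfolding below_def by (rule stack_cong_left[OF _ crossing_subset])

lemma tau_right: "tau ` right S = below (tau ` S)"
  by (simp add: right_def below_def tau_juxtapose tau_crossing)

lemma tau_below: "tau ` below S = right (tau ` S)"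
  by (simp add: right_def below_def tau_stack tau_crossing)

definition braided :: "plane set \<Rightarrow> plane set" where
  "braided S = unit_picture 3072 (\<lambda>i. S) braid_picture"

lemma right_below_right_braided:
  assumes "S \<subseteq> unit_square"
  shows "right (below (right S)) \<doteq> braided S"
proof -
  define E where "E = (\<lambda>i::nat. S)"
  have "unit_picture 3072 E (juxtapose_picture 384 (stack_picture 96
      (juxtapose_picture 24 (box_picture 0 48) (crossing_picture 48)) (crossing_picture 192)) (crossing_picture 768))
      = right (below (right S))"
    using unit_picture_juxtapose[of 384 E "stack_picture 96 (juxtapose_picture 24 (box_picture 0 48) (crossing_picture 48))
        (crossing_picture 192)" "crossing_picture 768"]
      unit_picture_stack[of 96 E "juxtapose_picture 24 (box_picture 0 48) (crossing_picture 48)" "crossing_picture 192"]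
      unit_picture_juxtapose[of 24 E "box_picture 0 48" "crossing_picture 48"]
    by (simp add: unit_picture_crossing unit_picture_box right_def below_def) (simp add: E_def)
  then show ?thesis
    using tangle_eq_unit_picture[of E, OF _ braid_joined] assms by (simp add: braided_def E_def)
qed

text \<open>This is the only place where a deformation of type 3 is used.\<close>

lemma braided_flip:
  assumes "S \<subseteq> unit_square"
  shows "braided S \<doteq> tau ` braided (tau ` S)"
  using tangle_eq_unit_picture[of "\<lambda>i. S", OF _ braid_flip_joined] assms
  by (simp add: braided_def unit_picture_reflect)

text \<open>The left side deforms to \<open>braided S\<close>. The right side is the reflection of
  the left side taken for the reflected tangle, so it deforms to a reflected braid picture;
  \<open>braided_flip\<close> joins the two.\<close>

lemma braid_relation:
  assumes S: "S \<subseteq> unit_square"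
  shows "right (below (right S)) \<doteq> below (right (below S))"
proof -
  have "tau ` right (below (right (tau ` S))) \<doteq> tau ` braided (tau ` S)"
    by (rule tangle_eq_tau[OF right_below_right_braided[OF tau_unit_square[OF S]]])
  then have *: "below (right (below S)) \<doteq> tau ` braided (tau ` S)"
    by (simp add: tau_right tau_below)
  have "right (below (right S)) \<doteq> braided S"
    by (rule right_below_right_braided[OF S])
  also have "\<dots> \<doteq> tau ` braided (tau ` S)"
    by (rule braided_flip[OF S])
  also have "\<dots> \<doteq> below (right (below S))"
    by (rule tangle_eq_sym[OF *])
  finally show ?thesis .
qed

lemma right_zero: "right zero_tangle \<doteq> crossing"
proof -
  have "unit_picture 3072 (\<lambda>i. {}) (juxtapose_picture 384 (zero_picture 192) (crossing_picture 768)) = right zero_tangle"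
    using unit_picture_juxtapose[of 384 "\<lambda>i. {}" "zero_picture 192" "crossing_picture 768"]
      unit_picture_zero[of 192 "\<lambda>i. {}"]
    by (simp add: unit_picture_crossing right_def)
  then show ?thesis
    using tangle_eq_unit_picture[of "\<lambda>i. {}", OF _ crossing_joined] by (simp add: unit_picture_crossing)
qed

lemma below_zero: "below zero_tangle \<doteq> zero_tangle"
proof -
  have "unit_picture 3072 (\<lambda>i. {}) (stack_picture 384 (zero_picture 192) (crossing_picture 768)) = below zero_tangle"
    using unit_picture_stack[of 384 "\<lambda>i. {}" "zero_picture 192" "crossing_picture 768"]
      unit_picture_zero[of 192 "\<lambda>i. {}"]
    by (simp add: unit_picture_crossing below_def)
  then show ?thesis
    using tangle_eq_unit_picture[of "\<lambda>i. {}", OF _ kink_joined] unit_picture_zero[of 768 "\<lambda>i. {}"] by simp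
qed

lemma below_infinity: "below infinity_tangle \<doteq> crossing"
  using tangle_eq_tau[OF right_zero] by (simp add: tau_right tau_zero_tangle tau_crossing)

lemma right_infinity: "right infinity_tangle \<doteq> infinity_tangle"
  using tangle_eq_tau[OF below_zero] by (simp add: tau_below tau_zero_tangle)

text \<open>Needed because the construction attaches a whole twist at once, with its crossings
  grouped among themselves, while the reduction adds them to the tangle one at a time. The three
  components are boxes with arbitrary content, so one move sequence serves all tangles.\<close>

lemma juxtapose_assoc:
  assumes "S \<subseteq> unit_square" "T \<subseteq> unit_square" "U \<subseteq> unit_square"
  shows "juxtapose S (juxtapose T U) \<doteq> juxtapose (juxtapose S T) U"
proof -
  define E where "E = (\<lambda>i::nat. if i = 0 then S else if i = 1 then T else U)"
  have E: "E 0 = S" "E 1 = T" "E 2 = U" "\<And>i. E i \<subseteq> unit_square"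
    using assms by (simp_all add: E_def)
  have "unit_picture 3072 E (juxtapose_picture 384 (box_picture 0 768)
       (juxtapose_picture 96 (box_picture 1 192) (box_picture 2 192))) = juxtapose S (juxtapose T U)"
    using unit_picture_juxtapose[of 384 E "box_picture 0 768" "juxtapose_picture 96 (box_picture 1 192) (box_picture 2 192)"]
      unit_picture_juxtapose[of 96 E "box_picture 1 192" "box_picture 2 192"]
    by (simp add: unit_picture_box E(1-3)[simplified])
  moreover have "unit_picture 3072 E (juxtapose_picture 384 (juxtapose_picture 96 (box_picture 0 192) (box_picture 1 192))
       (box_picture 2 768)) = juxtapose (juxtapose S T) U"
    using unit_picture_juxtapose[of 384 E "juxtapose_picture 96 (box_picture 0 192) (box_picture 1 192)" "box_picture 2 768"]
      unit_picture_juxtapose[of 96 E "box_picture 0 192" "box_picture 1 192"]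
    by (simp add: unit_picture_box E(1-3)[simplified])
  ultimately show ?thesis
    using tangle_eq_unit_picture[of E, OF E(4) assoc_joined] by simp
qed

section \<open>Rows and columns of crossings over the two trivial tangles\<close>

definition H_twist :: "nat \<Rightarrow> plane set" where
  "H_twist m = (right ^^ m) zero_tangle"

definition V_twist :: "nat \<Rightarrow> plane set" where
  "V_twist m = (below ^^ m) infinity_tangle"

lemma H_twist_simps [simp]: "H_twist 0 = zero_tangle" "H_twist (Suc m) = right (H_twist m)"
  by (simp_all add: H_twist_def)

lemma V_twist_simps [simp]: "V_twist 0 = infinity_tangle" "V_twist (Suc m) = below (V_twist m)"
  by (simp_all add: V_twist_def)

lemma tau_V_twist: "tau ` V_twist m = H_twist m"
  by (induction m) (simp_all add: tau_infinity_tangle tau_below)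

lemma tau_H_twist: "tau ` H_twist m = V_twist m"
  by (metis tau_V_twist tau_image_image)

lemma H_twist_subset: "H_twist m \<subseteq> unit_square"
  by (induction m) (auto intro!: right_subset zero_tangle_subset del: subsetI)

lemma V_twist_subset: "V_twist m \<subseteq> unit_square"
  using tau_unit_square[OF H_twist_subset] by (simp add: tau_H_twist)

text \<open>The positive half twist of the braids on three strands, that is, their Garside element.
  By the braid relation it conjugates \<open>right\<close> into \<open>below\<close> and
  \<open>below\<close> into \<open>right\<close>.\<close>

definition half_turn :: "plane set \<Rightarrow> plane set" where
  "half_turn S = right (below (right S))"

lemma half_turn_cong: "S \<doteq> T \<Longrightarrow> half_turn S \<doteq> half_turn T"
  unfolding half_turn_def by (intro right_cong below_cong)

lemma below_half_turn: "S \<subseteq> unit_square \<Longrightarrow> below (half_turn S) \<doteq> half_turn (right S)"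
  unfolding half_turn_def by (rule tangle_eq_sym[OF braid_relation[OF right_subset]])

lemma right_half_turn: "S \<subseteq> unit_square \<Longrightarrow> right (half_turn S) \<doteq> half_turn (below S)"
  unfolding half_turn_def by (rule right_cong[OF braid_relation])

lemma tau_half_turn: "S \<subseteq> unit_square \<Longrightarrow> tau ` half_turn S \<doteq> half_turn (tau ` S)"
  unfolding half_turn_def tau_right tau_below
  by (rule tangle_eq_sym[OF braid_relation[OF tau_unit_square]])

text \<open>Write \<open>a\<close> for \<open>right\<close>, \<open>b\<close> for
  \<open>below\<close> and \<Delta> for the half turn. Then \<open>aa\<close> of the zero tangle is
  \<open>a\<close> of a crossing, hence \<open>ab\<close> of the infinity tangle, hence
  \<open>aba\<close> of it, as the innermost \<open>a\<close> only adds a kink. The induction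
  continues with \<open>a \<Delta> = \<Delta> b\<close>.\<close>

lemma H_twist_step: "H_twist (Suc (Suc m)) \<doteq> half_turn (V_twist m)"
proof (induction m)
  case 0
  have "right (right zero_tangle) \<doteq> right crossing"
    by (rule right_cong[OF right_zero])
  also have "right crossing \<doteq> right (below infinity_tangle)"
    by (rule right_cong[OF tangle_eq_sym[OF below_infinity]])
  also have "right (below infinity_tangle) \<doteq> half_turn infinity_tangle"
    unfolding half_turn_def by (intro right_cong below_cong tangle_eq_sym[OF right_infinity])
  finally show ?case by simp
next
  case (Suc m)
  have "H_twist (Suc (Suc (Suc m))) \<doteq> right (half_turn (V_twist m))"
    using right_cong[OF Suc.IH] by simp
  also have "\<dots> \<doteq> half_turn (V_twist (Suc m))"
    using right_half_turn[OF V_twist_subset] by simp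
  finally show ?case .
qed

lemma V_twist_step: "V_twist (Suc (Suc m)) \<doteq> half_turn (H_twist m)"
proof -
  have "V_twist (Suc (Suc m)) \<doteq> tau ` half_turn (V_twist m)"
    using tangle_eq_tau[OF H_twist_step] by (simp only: tau_H_twist)
  also have "\<dots> \<doteq> half_turn (H_twist m)"
    using tau_half_turn[OF V_twist_subset] by (simp only: tau_V_twist)
  finally show ?thesis .
qed

text \<open>Two crossings of a row are traded for a half turn of a column. The added crossing passes
  through the half turn, becomes a crossing on the right of the shorter column, and is absorbed
  there by the reflected induction hypothesis.\<close>

lemma below_H_twist_even: "even m \<Longrightarrow> below (H_twist m) \<doteq> H_twist m"
proof (induction m rule: nat_induct2)
  case 0
  show ?case by (simp add: below_zero)
next
  case 1
  then show ?case by simp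
next
  case (step m)
  then have "right (V_twist m) \<doteq> V_twist m"
    using tangle_eq_tau[of "below (H_twist m)" "H_twist m"] by (simp add: tau_below tau_H_twist)
  have "below (H_twist (Suc (Suc m))) \<doteq> below (half_turn (V_twist m))"
    by (rule below_cong[OF H_twist_step])
  also have "\<dots> \<doteq> half_turn (right (V_twist m))"
    by (rule below_half_turn[OF V_twist_subset])
  also have "\<dots> \<doteq> half_turn (V_twist m)"
    by (rule half_turn_cong) fact
  also have "\<dots> \<doteq> H_twist (Suc (Suc m))"
    by (rule tangle_eq_sym[OF H_twist_step])
  finally show ?case by simp
qed

lemma right_V_twist_even: "even m \<Longrightarrow> right (V_twist m) \<doteq> V_twist m"
  using tangle_eq_tau[OF below_H_twist_even] by (simp add: tau_below tau_H_twist)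

text \<open>Splitting off a half turn shortens the twist by two and exchanges rows with columns; a
  single crossing is both a row and a column.\<close>

lemma H_twist_V_twist_odd: "odd m \<Longrightarrow> H_twist m \<doteq> V_twist m"
proof (induction m rule: nat_induct2)
  case 0
  then show ?case by simp
next
  case 1
  show ?case
    using tangle_eq_trans[OF right_zero tangle_eq_sym[OF below_infinity]] by (simp only: One_nat_def H_twist_simps V_twist_simps)
next
  case (step m)
  have "H_twist (Suc (Suc m)) \<doteq> half_turn (V_twist m)" by (rule H_twist_step)
  also have "\<dots> \<doteq> half_turn (H_twist m)"
    using step by (intro half_turn_cong tangle_eq_sym[of "H_twist m"]) simp
  also have "\<dots> \<doteq> V_twist (Suc (Suc m))" by (rule tangle_eq_sym[OF V_twist_step])
  finally show ?case by simp
qed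

section \<open>Connection types and normal forms\<close>

datatype connection = Zero | Infinity | Cross

fun connect_right :: "connection \<Rightarrow> connection" where
  "connect_right Zero = Cross"
| "connect_right Cross = Zero"
| "connect_right Infinity = Infinity"

fun connect_below :: "connection \<Rightarrow> connection" where
  "connect_below Infinity = Cross"
| "connect_below Cross = Infinity"
| "connect_below Zero = Zero"

text \<open>The connection type says how the ends are joined: as in the zero tangle, as in the infinity
  tangle, or each to the opposite one.\<close>

fun connection_of :: "(nat \<Rightarrow> nat) \<Rightarrow> nat \<Rightarrow> connection" where
  "connection_of a 0 = Zero"
| "connection_of a (Suc 0) = (connect_right ^^ a 1) Zero"
| "connection_of a (Suc (Suc i)) =
     (if even (Suc (Suc i)) then (connect_below ^^ a (Suc (Suc i))) (connection_of a (Suc i))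
      else (connect_right ^^ a (Suc (Suc i))) (connection_of a (Suc i)))"

fun reduced :: "connection \<Rightarrow> plane set \<Rightarrow> bool" where
  "reduced Zero S \<longleftrightarrow> (\<exists>m. even m \<and> S \<doteq> H_twist m)"
| "reduced Infinity S \<longleftrightarrow> (\<exists>m. even m \<and> S \<doteq> V_twist m)"
| "reduced Cross S \<longleftrightarrow> (\<exists>m. odd m \<and> S \<doteq> H_twist m)"

lemma reduced_cong: "S \<doteq> T \<Longrightarrow> reduced c T \<Longrightarrow> reduced c S"
  by (cases c) (auto intro: tangle_eq_trans)

text \<open>For odd length the row may be replaced by the column, so this type can be continued in
  either direction: as a row on the right, as a column below.\<close>

lemma reduced_Cross: "reduced Cross S \<longleftrightarrow> (\<exists>m. odd m \<and> S \<doteq> V_twist m)"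
proof -
  have "S \<doteq> H_twist m \<longleftrightarrow> S \<doteq> V_twist m" if "odd m" for m
    using tangle_eq_trans[OF _ H_twist_V_twist_odd[OF that]] tangle_eq_trans[OF _ tangle_eq_sym[OF H_twist_V_twist_odd[OF that]]]
    by blast
  then show ?thesis by auto
qed

lemma reduced_right: "reduced c S \<Longrightarrow> reduced (connect_right c) (right S)"
proof (cases c)
  case Zero
  assume "reduced c S"
  then obtain m where "even m" "S \<doteq> H_twist m" using Zero by auto
  then have "odd (Suc m)" "right S \<doteq> H_twist (Suc m)" using right_cong by simp_all
  then show ?thesis unfolding Zero connect_right.simps reduced.simps by blast
next
  case Infinity
  assume "reduced c S"
  then obtain m where m: "even m" "S \<doteq> V_twist m" using Infinity by auto
  have "right S \<doteq> V_twist m"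
    by (rule tangle_eq_trans[OF right_cong[OF m(2)] right_V_twist_even[OF m(1)]])
  then show ?thesis unfolding Infinity connect_right.simps reduced.simps using m(1) by blast
next
  case Cross
  assume "reduced c S"
  then obtain m where "odd m" "S \<doteq> H_twist m" using Cross by auto
  then have "even (Suc m)" "right S \<doteq> H_twist (Suc m)" using right_cong by simp_all
  then show ?thesis unfolding Cross connect_right.simps reduced.simps by blast
qed

lemma reduced_below: "reduced c S \<Longrightarrow> reduced (connect_below c) (below S)"
proof (cases c)
  case Infinity
  assume "reduced c S"
  then obtain m where "even m" "S \<doteq> V_twist m" using Infinity by auto
  then have "odd (Suc m)" "below S \<doteq> V_twist (Suc m)" using below_cong by simp_all
  then show ?thesis unfolding Infinity connect_below.simps reduced_Cross by blast
next
  case Zero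
  assume "reduced c S"
  then obtain m where m: "even m" "S \<doteq> H_twist m" using Zero by auto
  have "below S \<doteq> H_twist m"
    by (rule tangle_eq_trans[OF below_cong[OF m(2)] below_H_twist_even[OF m(1)]])
  then show ?thesis unfolding Zero connect_below.simps reduced.simps using m(1) by blast
next
  case Cross
  assume "reduced c S"
  then obtain m where "odd m" "S \<doteq> V_twist m" unfolding Cross reduced_Cross by auto
  then have "even (Suc m)" "below S \<doteq> V_twist (Suc m)" using below_cong by simp_all
  then show ?thesis unfolding Cross connect_below.simps reduced.simps by blast
qed

lemma reduced_right_power: "reduced c S \<Longrightarrow> reduced ((connect_right ^^ k) c) ((right ^^ k) S)"
  by (induction k) (auto intro: reduced_right)

lemma reduced_below_power: "reduced c S \<Longrightarrow> reduced ((connect_below ^^ k) c) ((below ^^ k) S)"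
  by (induction k) (auto intro: reduced_below)

lemma horizontal_twist_subset: "horizontal_twist k \<subseteq> unit_square"
  by (induction k rule: horizontal_twist.induct) (auto intro!: juxtapose_subset crossing_subset del: subsetI)

lemma tau_horizontal_twist: "tau ` horizontal_twist k = vertical_twist k"
  by (induction k rule: horizontal_twist.induct) (simp_all add: tau_juxtapose tau_crossing)

lemma vertical_twist_subset: "vertical_twist k \<subseteq> unit_square"
  using tau_unit_square[OF horizontal_twist_subset] by (simp add: tau_horizontal_twist)

lemma juxtapose_horizontal_twist:
  assumes "S \<subseteq> unit_square" "k \<ge> 1"
  shows "juxtapose S (horizontal_twist k) \<doteq> (right ^^ k) S"
  using assms(2)
proof (induction k rule: nat_induct_at_least)
  case base
  show ?case by (simp add: right_def)
next
  case (Suc k)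
  then obtain j where k: "k = Suc j" by (cases k) auto
  have "juxtapose S (horizontal_twist (Suc k)) \<doteq> right (juxtapose S (horizontal_twist k))"
    using juxtapose_assoc[OF assms(1) horizontal_twist_subset crossing_subset] by (simp add: k right_def)
  also have "\<dots> \<doteq> right ((right ^^ k) S)" by (rule right_cong[OF Suc.IH])
  finally show ?case by simp
qed

lemma stack_vertical_twist:
  assumes "S \<subseteq> unit_square" "k \<ge> 1"
  shows "stack S (vertical_twist k) \<doteq> (below ^^ k) S"
proof -
  have "tau ` (right ^^ k) (tau ` S) = (below ^^ k) S"
    by (induction k) (simp_all add: tau_right)
  then show ?thesis
    using tangle_eq_tau[OF juxtapose_horizontal_twist[OF tau_unit_square[OF assms(1)] assms(2)]]
    by (simp add: tau_juxtapose tau_horizontal_twist)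
qed

lemma horizontal_twist_H_twist: "k \<ge> 1 \<Longrightarrow> horizontal_twist k \<doteq> H_twist k"
proof (induction k rule: nat_induct_at_least)
  case base
  show ?case using tangle_eq_sym[OF right_zero] by simp
next
  case (Suc k)
  then obtain j where k: "k = Suc j" by (cases k) auto
  show ?case using right_cong[OF Suc.IH] by (simp add: k right_def)
qed

lemma conway_tangle_subset: "conway_tangle a n \<subseteq> unit_square"
  by (induction a n rule: conway_tangle.induct)
    (auto intro!: juxtapose_subset stack_subset horizontal_twist_subset vertical_twist_subset del: subsetI)

lemma reduced_conway_tangle:
  "n \<ge> 1 \<Longrightarrow> \<forall>i\<in>{1..n}. a i \<ge> 1 \<Longrightarrow> reduced (connection_of a n) (conway_tangle a n)"
proof (induction a n rule: conway_tangle.induct)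
  case (2 a)
  have "reduced Zero zero_tangle" by (auto intro!: exI[of _ 0])
  then have "reduced (connection_of a (Suc 0)) (H_twist (a 1))"
    using reduced_right_power by (simp add: H_twist_def)
  then show ?case using reduced_cong[OF horizontal_twist_H_twist] 2 by simp
next
  case (3 a i)
  then have IH: "reduced (connection_of a (Suc i)) (conway_tangle a (Suc i))" and a: "a (Suc (Suc i)) \<ge> 1"
    by auto
  show ?case
    using reduced_cong[OF stack_vertical_twist[OF conway_tangle_subset a] reduced_below_power[OF IH]]
      reduced_cong[OF juxtapose_horizontal_twist[OF conway_tangle_subset a] reduced_right_power[OF IH]]
    by simp
qed simp

subsection \<open>Closures\<close>

definition numerator_closure :: "plane set \<Rightarrow> plane set" where
  "numerator_closure S = S \<union> (polygonal [(0, 1), (1/2, 2), (1, 1)] \<union> polygonal [(0, 0), (1/2, -1), (1, 0)])"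

definition denominator_closure :: "plane set \<Rightarrow> plane set" where
  "denominator_closure S = S \<union> (polygonal [(0, 1), (-1, 1/2), (0, 0)] \<union> polygonal [(1, 1), (2, 1/2), (1, 0)])"

text \<open>The square through the extreme vertices of both closures. It is invariant under
  \<open>tau\<close>, so that rows and columns end in the same trivial curve.\<close>

definition diamond :: "plane set" where
  "diamond = polygonal [(-1, 1/2), (1/2, 2), (2, 1/2), (1/2, -1), (-1, 1/2)]"

lemma tau_numerator_closure: "tau ` numerator_closure S = denominator_closure (tau ` S)"
  unfolding numerator_closure_def denominator_closure_def image_Un tau_polygonal
  by (simp add: tau_def closed_segment_commute)

lemma tau_diamond: "tau ` diamond = diamond"
  unfolding diamond_def tau_polygonal by (simp add: tau_def closed_segment_commute) blast

lemma numerator_closure_cong: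
  assumes "S \<doteq> T"
  shows "planar_eq (open_box (-4) 5) (numerator_closure S) (numerator_closure T)"
proof -
  define W where "W = polygonal [(0, 1), (1/2, 2), (1, 1::real)] \<union> polygonal [(0, 0), (1/2, -1), (1, 0::real)]"
  have "W \<inter> open_box 0 1 = {}"
    unfolding W_def by (auto simp: open_box_def closed_segment_def)
  moreover have "open_box 0 1 \<subseteq> open_box (-4) 5" by (auto simp: open_box_def)
  ultimately show ?thesis
    using planar_eq_context[of "\<lambda>x. x" "open_box 0 1" S T 0 "open_box (-4) 5" W] assms
    by (simp add: numerator_closure_def W_def tangle_eq_def linear_id[unfolded id_def])
qed

lemma unit_picture_closure_legs:
  "unit_picture 3072 E (join_pictures [P, closure_legs 1536]) = numerator_closure (unit_picture 3072 E P)"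
  using unit_picture_scaled[of 1536 2 E "[((0, 2), (1, 4)), ((1, 4), (2, 2)), ((0, 0), (1, -2)), ((1, -2), (2, 0))]"]
  by (simp add: unit_picture_join closure_legs_def numerator_closure_def image_Un segment_set_def scale_segment
      real_point_def Un_assoc)

text \<open>The bottom arc joins the two lower ends of the added crossing, so together they form a
  kink, which a deformation of type 1 removes.\<close>

lemma numerator_closure_below:
  assumes "S \<subseteq> unit_square"
  shows "planar_eq (open_box (-4) 5) (numerator_closure (below S)) (numerator_closure S)"
proof -
  define E where "E = (\<lambda>i::nat. S)"
  have "unit_picture 3072 E (stack_picture 384 (box_picture 0 768) (crossing_picture 768)) = below S"
    using unit_picture_stack[of 384 E "box_picture 0 768" "crossing_picture 768"]
    by (simp add: unit_picture_crossing unit_picture_box below_def) (simp add: E_def)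
  moreover have "unit_picture 3072 E (box_picture 0 3072) = S"
    by (simp add: unit_picture_box) (simp add: E_def)
  moreover have "\<And>i. E i \<subseteq> unit_square" using assms by (simp add: E_def)
  ultimately show ?thesis
    using planar_eq_unit_picture[of E, OF _ closure_joined, of 3072] by (simp add: unit_picture_closure_legs)
qed

lemma numerator_closure_infinity:
  "planar_eq (open_box (-4) 5) (numerator_closure infinity_tangle) diamond"
proof -
  have "unit_picture 3072 (\<lambda>i. {}) (scaled_segments 1536 [((-2, 1), (1, 4)), ((1, 4), (4, 1)), ((4, 1), (1, -2)), ((1, -2), (-2, 1))]) = diamond"
    using unit_picture_scaled[of 1536 2 "\<lambda>i. {}" "[((-2, 1), (1, 4)), ((1, 4), (4, 1)), ((4, 1), (1, -2)), ((1, -2), (-2, 1))]"]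
    by (simp add: diamond_def image_Un segment_set_def scale_segment real_point_def Un_assoc)
  then show ?thesis
    using planar_eq_unit_picture[of "\<lambda>i. {}", OF _ diamond_joined, of 3072] unit_picture_infinity[of 768 "\<lambda>i. {}"]
    by (simp add: unit_picture_closure_legs)
qed

lemma numerator_closure_V_twist: "planar_eq (open_box (-4) 5) (numerator_closure (V_twist m)) diamond"
proof (induction m)
  case 0
  show ?case by (simp add: numerator_closure_infinity)
next
  case (Suc m)
  show ?case using planar_eq_trans[OF numerator_closure_below[OF V_twist_subset] Suc.IH] by simp
qed

lemma numerator_closure_reduced:
  assumes "reduced c S" "c \<noteq> Zero"
  shows "planar_eq (open_box (-4) 5) (numerator_closure S) diamond"
proof -
  obtain m where "S \<doteq> V_twist m"
    using assms reduced_Cross by (cases c) auto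
  from planar_eq_trans[OF numerator_closure_cong[OF this] numerator_closure_V_twist] show ?thesis .
qed

lemma denominator_closure_reduced:
  assumes "reduced c S" "c \<noteq> Infinity"
  shows "planar_eq (open_box (-4) 5) (denominator_closure S) diamond"
proof -
  obtain m where "S \<doteq> H_twist m"
    using assms by (cases c) auto
  then have "tau ` S \<doteq> V_twist m" using tangle_eq_tau[of S "H_twist m"] by (simp add: tau_H_twist)
  from planar_eq_trans[OF numerator_closure_cong[OF this] numerator_closure_V_twist]
  have "planar_eq (open_box (-4) 5) (tau ` numerator_closure (tau ` S)) (tau ` diamond)"
    by (rule planar_eq_tau) (auto simp: tau_def open_box_def)
  then show ?thesis by (simp add: tau_numerator_closure tau_diamond)
qed

lemma conway_closure_eq:
  "conway_closure a n = (if odd n then numerator_closure else denominator_closure) (conway_tangle a n)"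
  by (simp add: conway_closure_def numerator_closure_def denominator_closure_def)

lemma conway_closure_diamond:
  assumes "n \<ge> 1" "\<forall>i\<in>{1..n}. a i \<ge> 1"
    and "connection_of a n \<noteq> (if odd n then Zero else Infinity)"
  shows "planar_eq (open_box (-4) 5) (conway_closure a n) diamond"
  using numerator_closure_reduced[OF reduced_conway_tangle[OF assms(1,2)]]
    denominator_closure_reduced[OF reduced_conway_tangle[OF assms(1,2)]] assms(3)
  by (simp add: conway_closure_eq split: if_splits)

section \<open>From the plane to the sphere\<close>

definition stereographic :: "space \<Rightarrow> plane" where
  "stereographic p = (fst p / (1 - snd (snd p)), fst (snd p) / (1 - snd (snd p)))"

abbreviation north :: space where
  "north \<equiv> (0, 0, 1)"

lemma S2_iff: "p \<in> S2 \<longleftrightarrow> (fst p)\<^sup>2 + (fst (snd p))\<^sup>2 + (snd (snd p))\<^sup>2 = 1"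
  by (cases p) (simp add: norm_Pair add.assoc)

lemma inverse_stereographic_eq:
  "inverse_stereographic z = (2 * fst z / ((fst z)\<^sup>2 + (snd z)\<^sup>2 + 1), 2 * snd z / ((fst z)\<^sup>2 + (snd z)\<^sup>2 + 1),
     ((fst z)\<^sup>2 + (snd z)\<^sup>2 - 1) / ((fst z)\<^sup>2 + (snd z)\<^sup>2 + 1))"
  by (simp add: inverse_stereographic_def split_beta)

lemma sum_squares_plus_one_pos: "0 < (x::real)\<^sup>2 + y\<^sup>2 + 1"
  by (smt (verit) zero_le_power2)

lemma inverse_stereographic_S2: "inverse_stereographic z \<in> S2"
proof -
  define w where "w = (fst z)\<^sup>2 + (snd z)\<^sup>2"
  have w: "w + 1 \<noteq> 0" using sum_squares_plus_one_pos[of "fst z" "snd z"] by (simp add: w_def)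
  have "(2 * fst z)\<^sup>2 + (2 * snd z)\<^sup>2 + (w - 1)\<^sup>2 = (w + 1)\<^sup>2"
    by (simp add: w_def power2_eq_square algebra_simps)
  then have "((2 * fst z)\<^sup>2 + (2 * snd z)\<^sup>2 + (w - 1)\<^sup>2) / (w + 1)\<^sup>2 = 1" using w by simp
  then show ?thesis
    unfolding S2_iff inverse_stereographic_eq fst_conv snd_conv w_def[symmetric]
    by (simp add: power_divide add_divide_distrib)
qed

lemma stereographic_inverse [simp]: "stereographic (inverse_stereographic z) = z"
proof -
  define w where "w = (fst z)\<^sup>2 + (snd z)\<^sup>2"
  have w: "w + 1 \<noteq> 0" using sum_squares_plus_one_pos[of "fst z" "snd z"] by (simp add: w_def)
  have "1 - (w - 1) / (w + 1) = 2 / (w + 1)" using w by (simp add: field_simps)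
  then show ?thesis
    unfolding stereographic_def inverse_stereographic_eq fst_conv snd_conv w_def[symmetric]
    using w by (simp add: prod_eq_iff)
qed

lemma inj_inverse_stereographic: "inj inverse_stereographic"
  by (metis injI stereographic_inverse)

lemma S2_height: "p \<in> S2 \<Longrightarrow> p \<noteq> north \<Longrightarrow> snd (snd p) < 1"
proof -
  assume p: "p \<in> S2" "p \<noteq> north"
  then have e: "(fst p)\<^sup>2 + (fst (snd p))\<^sup>2 + (snd (snd p))\<^sup>2 = 1" by (simp only: S2_iff)
  then have "(snd (snd p))\<^sup>2 \<le> 1\<^sup>2" by (smt (verit) one_power2 zero_le_power2)
  then have "snd (snd p) \<le> 1" by (rule power2_le_imp_le) simp
  moreover have "snd (snd p) \<noteq> 1"
  proof
    assume "snd (snd p) = 1"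
    then have "(fst p)\<^sup>2 + (fst (snd p))\<^sup>2 = 0" using e by simp
    then show False using p \<open>snd (snd p) = 1\<close> by (simp add: sum_power2_eq_zero_iff prod_eq_iff)
  qed
  ultimately show ?thesis by simp
qed

lemma norm_stereographic:
  assumes "p \<in> S2" "p \<noteq> north"
  shows "(norm (stereographic p))\<^sup>2 = (1 + snd (snd p)) / (1 - snd (snd p))"
proof -
  define h where "h = snd (snd p)"
  have h: "1 - h > 0" using S2_height[OF assms] by (simp add: h_def)
  have "(fst p)\<^sup>2 + (fst (snd p))\<^sup>2 = (1 - h) * (1 + h)"
    using assms(1) unfolding S2_iff h_def by (simp add: power2_eq_square algebra_simps)
  moreover have "(norm (stereographic p))\<^sup>2 = ((fst p)\<^sup>2 + (fst (snd p))\<^sup>2) / (1 - h)\<^sup>2"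
    by (simp add: stereographic_def norm_Pair h_def power_divide add_divide_distrib)
  ultimately show ?thesis using h by (simp add: power2_eq_square h_def[symmetric])
qed

lemma inverse_stereographic_stereographic:
  assumes "p \<in> S2" "p \<noteq> north"
  shows "inverse_stereographic (stereographic p) = p"
proof -
  define h where "h = snd (snd p)"
  have h: "1 - h > 0" using S2_height[OF assms] by (simp add: h_def)
  have "(fst (stereographic p))\<^sup>2 + (snd (stereographic p))\<^sup>2 = (1 + h) / (1 - h)"
    using norm_stereographic[OF assms] unfolding h_def
    by (cases "stereographic p") (simp add: norm_Pair)
  moreover have "(1 + h) / (1 - h) + 1 = 2 / (1 - h)" "(1 + h) / (1 - h) - 1 = 2 * h / (1 - h)"
    using h by (simp_all add: field_simps)
  ultimately show ?thesis
    unfolding inverse_stereographic_eq using h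
    by (simp add: prod_eq_iff stereographic_def h_def[symmetric])
qed

lemma continuous_inverse_stereographic: "continuous_on S inverse_stereographic"
proof -
  have "(fst z)\<^sup>2 + (snd z)\<^sup>2 + 1 \<noteq> 0" for z :: plane
    using sum_squares_plus_one_pos[of "fst z" "snd z"] by linarith
  then show ?thesis
    unfolding inverse_stereographic_eq[abs_def] by (intro continuous_intros) auto
qed

lemma continuous_stereographic: "(\<And>p. p \<in> S \<Longrightarrow> snd (snd p) < 1) \<Longrightarrow> continuous_on S stereographic"
  unfolding stereographic_def[abs_def] by (intro continuous_intros) force+

subsection \<open>Alexander isotopy\<close>

text \<open>The Alexander trick: conjugation by a homothety shrinks the support of \<open>h\<close>
  to the origin as \<open>t\<close> tends to 0.\<close>

definition alexander :: "(plane \<Rightarrow> plane) \<Rightarrow> real \<Rightarrow> plane \<Rightarrow> plane" where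
  "alexander h t z = (if t = 0 then z else t *\<^sub>R h ((1 / t) *\<^sub>R z))"

lemma alexander_fixed:
  assumes "\<And>z. r \<le> norm z \<Longrightarrow> h z = z" "r \<le> norm z" "0 \<le> r" "0 \<le> t" "t \<le> 1"
  shows "alexander h t z = z"
proof (cases "t = 0")
  case False
  then have t: "0 < t" using assms by simp
  have "t * norm z \<le> 1 * norm z" using assms(5) by (intro mult_right_mono) auto
  then have "norm z \<le> norm ((1 / t) *\<^sub>R z)" using t by (simp add: field_simps)
  then have "h ((1 / t) *\<^sub>R z) = (1 / t) *\<^sub>R z" using assms by (intro assms(1)) linarith
  then show ?thesis using t by (simp add: alexander_def)
qed (simp add: alexander_def)

lemma alexander_inverse: "(\<And>z. h (g z) = z) \<Longrightarrow> alexander h t (alexander g t z) = z"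
  by (simp add: alexander_def)

text \<open>At \<open>t = 0\<close> continuity comes from a uniform estimate. The map
  \<open>h\<close> moves points by a bounded amount, because it is continuous and fixes everything
  outside a ball, and \<open>alexander h t\<close> moves them by at most \<open>t\<close> times this
  bound.\<close>

lemma continuous_alexander:
  assumes cont: "continuous_on UNIV h" and fix_out: "\<And>z. r \<le> norm z \<Longrightarrow> h z = z"
  shows "continuous_on ({0..1} \<times> UNIV) (\<lambda>x. alexander h (fst x) (snd x))"
proof -
  have "compact ((\<lambda>z. h z - z) ` cball 0 r)"
    by (intro compact_continuous_image continuous_intros continuous_on_subset[OF cont]) auto
  then obtain M where M: "\<forall>y\<in>(\<lambda>z. h z - z) ` cball 0 r. norm y \<le> M"
    using compact_imp_bounded bounded_iff by metis
  have bound: "norm (h z - z) \<le> max M 0" for z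
    using M fix_out[of z] by (cases "norm z \<le> r") (auto simp: le_max_iff_disj)
  have close: "norm (alexander h t z - z) \<le> t * max M 0" if "0 \<le> t" for t z
  proof (cases "t = 0")
    case False
    have "alexander h t z - z = t *\<^sub>R (h ((1 / t) *\<^sub>R z) - (1 / t) *\<^sub>R z)"
      using False by (simp add: alexander_def scaleR_diff_right)
    then show ?thesis using bound[of "(1 / t) *\<^sub>R z"] that by (simp add: mult_left_mono)
  qed (simp add: alexander_def)
  have "continuous (at x within {0..1} \<times> UNIV) (\<lambda>x. alexander h (fst x) (snd x))"
    if x: "x \<in> {0..1} \<times> UNIV" for x
  proof (cases "fst x = 0")
    case True
    have "((\<lambda>y. alexander h (fst y) (snd y) - snd y) \<longlongrightarrow> 0) (at x within {0..1} \<times> UNIV)"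
    proof (rule Lim_null_comparison)
      show "\<forall>\<^sub>F y in at x within {0..1} \<times> UNIV. norm (alexander h (fst y) (snd y) - snd y) \<le> fst y * max M 0"
        unfolding eventually_at_filter by (rule always_eventually) (auto intro!: close)
      have "((\<lambda>y. fst y * max M 0) \<longlongrightarrow> fst x * max M 0) (at x within {0..1} \<times> UNIV)"
        by (intro tendsto_intros)
      then show "((\<lambda>y. fst y * max M 0) \<longlongrightarrow> 0) (at x within {0..1} \<times> UNIV)" using True by simp
    qed
    moreover have "((\<lambda>y. snd y) \<longlongrightarrow> snd x) (at x within {0..1} \<times> UNIV)" by (intro tendsto_intros)
    ultimately have "((\<lambda>y. (alexander h (fst y) (snd y) - snd y) + snd y) \<longlongrightarrow> 0 + snd x) (at x within {0..1} \<times> UNIV)"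
      by (rule tendsto_add)
    then show ?thesis using True by (simp add: continuous_within alexander_def)
  next
    case False
    define U where "U = ({0<..} \<times> UNIV :: (real \<times> plane) set)"
    have "continuous_on U (\<lambda>x. fst x *\<^sub>R h ((1 / fst x) *\<^sub>R snd x))"
      unfolding U_def by (intro continuous_intros continuous_on_compose2[OF cont]) auto
    then have "continuous_on U (\<lambda>x. alexander h (fst x) (snd x))"
      by (rule continuous_on_eq) (auto simp: U_def alexander_def)
    moreover have "open U" unfolding U_def by (intro open_Times) auto
    moreover have "x \<in> U" using x False by (auto simp: U_def)
    ultimately have "isCont (\<lambda>x. alexander h (fst x) (snd x)) x"
      by (simp add: continuous_on_eq_continuous_at)
    then show ?thesis by (rule continuous_at_imp_continuous_at_within)
  qed
  then show ?thesis by (simp add: continuous_on_eq_continuous_within)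
qed

definition sphere_isotopy :: "(plane \<Rightarrow> plane) \<Rightarrow> real \<times> space \<Rightarrow> space" where
  "sphere_isotopy h x = (if snd x = north then north
     else inverse_stereographic (alexander h (fst x) (stereographic (snd x))))"

lemma inverse_stereographic_north: "inverse_stereographic z \<noteq> north"
proof
  assume e: "inverse_stereographic z = north"
  then have "stereographic north = z" by (metis stereographic_inverse)
  then have "z = 0" by (simp add: stereographic_def zero_prod_def)
  then show False using e by (simp add: inverse_stereographic_eq)
qed

lemma sphere_isotopy_S2: "sphere_isotopy h x \<in> S2"
  unfolding sphere_isotopy_def using inverse_stereographic_S2 by (auto simp: norm_Pair)

text \<open>Near the pole every stage of the isotopy is the identity. The circle of radius
  \<open>r\<close> has the height \<open>c\<close> on the sphere; below it the formula is a
  composition of continuous maps, above it nothing moves, and the two closed pieces are pasted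
  together.\<close>

lemma continuous_sphere_isotopy:
  assumes cont: "continuous_on UNIV h" and fix_out: "\<And>z. r \<le> norm z \<Longrightarrow> h z = z" and r: "0 < r"
  shows "continuous_on ({0..1} \<times> S2) (sphere_isotopy h)"
proof -
  define c where "c = (r\<^sup>2 - 1) / (r\<^sup>2 + 1)"
  have rp: "0 < r\<^sup>2 + 1" by (simp add: add_nonneg_pos)
  have c1: "c < 1" using rp by (simp add: c_def field_simps)
  define A where "A = {0..1::real} \<times> (S2 \<inter> {p. snd (snd p) \<le> c})"
  define B where "B = {0..1::real} \<times> (S2 \<inter> {p. c \<le> snd (snd p)})"
  have "continuous_on A (\<lambda>x. inverse_stereographic (alexander h (fst x) (stereographic (snd x))))"
  proof (rule continuous_on_compose2[OF continuous_inverse_stereographic])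
    have "continuous_on A (\<lambda>x. (fst x, stereographic (snd x)))"
      by (intro continuous_intros continuous_on_compose2[OF continuous_stereographic[of "{p. snd (snd p) < 1}"]])
         (use c1 in \<open>auto simp: A_def\<close>)
    moreover have "(\<lambda>x. (fst x, stereographic (snd x))) ` A \<subseteq> {0..1} \<times> UNIV" by (auto simp: A_def)
    ultimately show "continuous_on A (\<lambda>x. alexander h (fst x) (stereographic (snd x)))"
      using continuous_on_compose2[OF continuous_alexander[of h r, OF cont fix_out]] by fastforce
  qed auto
  then have "continuous_on A (sphere_isotopy h)"
    by (rule continuous_on_eq) (use c1 in \<open>auto simp: A_def sphere_isotopy_def\<close>)
  moreover have "continuous_on B (sphere_isotopy h)"
  proof (rule continuous_on_eq[of _ snd])
    fix x assume x: "x \<in> B"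
    show "snd x = sphere_isotopy h x"
    proof (cases "snd x = north")
      case False
      have p: "snd x \<in> S2" "c \<le> snd (snd (snd x))" "0 \<le> fst x" "fst x \<le> 1" using x by (auto simp: B_def)
      define k where "k = snd (snd (snd x))"
      have k: "k < 1" "c \<le> k" using S2_height[OF p(1) False] p(2) by (auto simp: k_def)
      have "r\<^sup>2 - 1 \<le> k * (r\<^sup>2 + 1)" using k(2) rp by (simp add: c_def pos_divide_le_eq)
      then have "r\<^sup>2 \<le> (1 + k) / (1 - k)" using k(1) by (simp add: pos_le_divide_eq algebra_simps)
      then have "r\<^sup>2 \<le> (norm (stereographic (snd x)))\<^sup>2"
        by (simp only: norm_stereographic[OF p(1) False] k_def)
      then have "r \<le> norm (stereographic (snd x))" by (rule power2_le_imp_le) simp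
      then have "alexander h (fst x) (stereographic (snd x)) = stereographic (snd x)"
        using alexander_fixed[of r h, OF fix_out] r p by simp
      then show ?thesis using False inverse_stereographic_stereographic[OF p(1) False] by (simp add: sphere_isotopy_def)
    qed (simp add: sphere_isotopy_def)
  qed (intro continuous_intros)
  moreover have "closed A" "closed B"
    unfolding A_def B_def by (intro closed_Times closed_Int closed_Collect_le continuous_intros; simp)+
  ultimately have "continuous_on (A \<union> B) (sphere_isotopy h)" by (intro continuous_on_closed_Un)
  moreover have "A \<union> B = {0..1} \<times> S2" unfolding A_def B_def by auto
  ultimately show ?thesis by simp
qed

lemma sphere_isotopy_inverse:
  assumes "\<And>z. h (g z) = z" "p \<in> S2"
  shows "sphere_isotopy h (t, sphere_isotopy g (t, p)) = p"
proof (cases "p = north")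
  case False
  then show ?thesis
    using inverse_stereographic_stereographic[OF assms(2) False]
    by (simp add: sphere_isotopy_def inverse_stereographic_north alexander_inverse[of h g, OF assms(1)])
qed (simp add: sphere_isotopy_def)

text \<open>At each time the inverse is the Alexander isotopy of the inverse homeomorphism at the
  same time, so both directions have the same continuity proof.\<close>

lemma ambient_isotopic_supported_homeo:
  assumes h: "supported_homeo R h" and R: "bounded R"
  shows "ambient_isotopic (inverse_stereographic ` P) (inverse_stereographic ` (h ` P))"
proof -
  obtain g where g: "homeomorphism UNIV UNIV h g" and fix_out: "\<And>z. z \<notin> R \<Longrightarrow> h z = z"
    using h unfolding supported_homeo_def by auto
  have hg: "\<And>z. h (g z) = z" "\<And>z. g (h z) = z" using g unfolding homeomorphism_def by blast+
  obtain r where r: "0 < r" "R \<subseteq> ball 0 r" using R bounded_subset_ballD by blast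
  have fh: "h z = z" if "r \<le> norm z" for z using that r fix_out[of z] by force
  have fg: "g z = z" if "r \<le> norm z" for z using fh[OF that] hg(2)[of z] by simp
  have ch: "continuous_on ({0..1} \<times> S2) (sphere_isotopy h)"
    by (rule continuous_sphere_isotopy[OF homeomorphism_cont1[OF g] fh r(1)])
  have cg: "continuous_on ({0..1} \<times> S2) (sphere_isotopy g)"
    by (rule continuous_sphere_isotopy[OF homeomorphism_cont2[OF g] fg r(1)])
  have slice: "continuous_on S2 (\<lambda>p. F (t, p))"
    if "continuous_on ({0..1} \<times> S2) F" "t \<in> {0..1}" for F :: "real \<times> space \<Rightarrow> space" and t
    by (rule continuous_on_compose2[OF that(1)]) (use that(2) in \<open>auto intro!: continuous_intros\<close>)
  have "\<exists>k. homeomorphism S2 S2 (\<lambda>p. sphere_isotopy h (t, p)) k" if "t \<in> {0..1}" for t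
  proof (rule exI[of _ "\<lambda>p. sphere_isotopy g (t, p)"], rule homeomorphismI)
    show "continuous_on S2 (\<lambda>p. sphere_isotopy h (t, p))" "continuous_on S2 (\<lambda>p. sphere_isotopy g (t, p))"
      using slice[OF ch that] slice[OF cg that] .
  qed ((rule image_subsetI, rule sphere_isotopy_S2)+, (rule sphere_isotopy_inverse; (rule hg | assumption))+)
  moreover have "sphere_isotopy h (0, p) = p" if "p \<in> S2" for p
    using that inverse_stereographic_stereographic[OF that] by (simp add: sphere_isotopy_def alexander_def)
  moreover have "(\<lambda>p. sphere_isotopy h (1, p)) ` inverse_stereographic ` P = inverse_stereographic ` h ` P"
    unfolding image_image
    by (intro image_cong refl) (simp add: sphere_isotopy_def inverse_stereographic_north alexander_def)
  moreover have "inverse_stereographic ` Q \<subseteq> S2" for Q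
    by (rule image_subsetI, rule inverse_stereographic_S2)
  ultimately show ?thesis
    unfolding ambient_isotopic_def using ch by blast
qed

section \<open>From planar to spherical deformations\<close>

definition deformable :: "space set \<Rightarrow> space set \<Rightarrow> bool" where
  "deformable = equivclp (\<lambda>K L. ambient_isotopic K L \<or> type1_deformation K L \<or> type3_deformation K L)"

lemma local_replacement_inverse_stereographic:
  assumes "inj (frame p u v)" "replaces (frame p u v) A B P Q"
  shows "local_replacement A B (inverse_stereographic ` P) (inverse_stereographic ` Q)"
proof -
  define e where "e = frame p u v"
  let ?\<sigma> = "inverse_stereographic"
  have im: "(?\<sigma> \<circ> e) ` S = ?\<sigma> ` e ` S" for S by (simp add: image_comp)
  have c: "continuous_on unit_square (?\<sigma> \<circ> e)"
    unfolding e_def frame_def[abs_def]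
    by (intro continuous_on_compose continuous_inverse_stereographic continuous_intros)
  have i: "inj_on (?\<sigma> \<circ> e) unit_square"
    unfolding e_def by (rule inj_on_subset[OF inj_compose[OF inj_inverse_stereographic assms(1)] subset_UNIV])
  have r: "?\<sigma> ` P \<inter> ?\<sigma> ` e ` unit_square = ?\<sigma> ` e ` A" "?\<sigma> ` Q \<inter> ?\<sigma> ` e ` unit_square = ?\<sigma> ` e ` B"
    "?\<sigma> ` P - ?\<sigma> ` e ` unit_square = ?\<sigma> ` Q - ?\<sigma> ` e ` unit_square"
    using assms(2) unfolding replaces_def e_def[symmetric]
    by (simp_all only: image_Int[OF inj_inverse_stereographic, symmetric]
        image_set_diff[OF inj_inverse_stereographic, symmetric])
  have s: "?\<sigma> ` S \<subseteq> S2" for S by (rule image_subsetI, rule inverse_stereographic_S2)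
  show ?thesis
    unfolding local_replacement_def
    by (intro conjI exI[of _ "?\<sigma> \<circ> e"]) (simp_all only: im s c i r)
qed

lemma deformable_planar_eq:
  assumes "planar_eq R P Q" "bounded R"
  shows "deformable (inverse_stereographic ` P) (inverse_stereographic ` Q)"
  unfolding deformable_def
proof (rule equivclp_transport[OF assms(1)[unfolded planar_eq_def]])
  fix P Q assume el: "elementary R P Q"
  let ?r = "\<lambda>K L. ambient_isotopic K L \<or> type1_deformation K L \<or> type3_deformation K L"
  consider (homeo) h where "supported_homeo R h" "Q = h ` P"
    | (loc) p u v A B where "(A, B) \<in> local_models" "inj (frame p u v)" "frame p u v ` unit_square \<subseteq> R"
        "replaces (frame p u v) A B P Q"
    using el unfolding elementary_def by blast
  then have "?r (inverse_stereographic ` P) (inverse_stereographic ` Q)"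
  proof cases
    case homeo
    then show ?thesis using ambient_isotopic_supported_homeo[OF homeo(1) assms(2)] by simp
  next
    case loc
    have "local_replacement A B (inverse_stereographic ` P) (inverse_stereographic ` Q)"
      by (rule local_replacement_inverse_stereographic[OF loc(2,4)])
    then show ?thesis
      using loc(1) unfolding local_models_def type1_deformation_def type3_deformation_def by auto
  qed
  then show "equivclp ?r (inverse_stereographic ` P) (inverse_stereographic ` Q)" by (rule r_into_equivclp)
qed

subsection \<open>The trivial curve\<close>

text \<open>The Minkowski functional of the diamond about the origin. The origin lies inside the
  diamond but not at its centre, hence the unequal coefficients for the two sides on which
  \<open>x + y\<close> is constant.\<close>

definition diamond_gauge :: "plane \<Rightarrow> real" where
  "diamond_gauge z = max (max (2 * (fst z + snd z) / 5) (- 2 * (fst z + snd z)))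
     (max (2 * (fst z - snd z) / 3) (2 * (snd z - fst z) / 3))"

text \<open>Both terms increase along rays, which makes the radial map injective. On the diamond the
  first is 1/3 and the second at most 1/3; from norm 4 on, the second is the norm itself and
  dominates, since the gauge is at most three times the norm.\<close>

definition radial_profile :: "plane \<Rightarrow> real" where
  "radial_profile z = max (diamond_gauge z / 3) (min (norm z) (2 * norm z - 4))"

text \<open>The diamond lies outside the disc of radius \<open>1/3\<close>. The radial map pulls it onto the
  boundary circle and is the identity far away.\<close>

definition radial_map :: "plane \<Rightarrow> plane" where
  "radial_map z = (radial_profile z / norm z) *\<^sub>R z"

lemma diamond_gauge_pos: "z \<noteq> 0 \<Longrightarrow> 0 < diamond_gauge z"
  by (cases z) (auto simp: diamond_gauge_def zero_prod_def less_max_iff_disj)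

lemma diamond_gauge_le: "diamond_gauge z \<le> 3 * norm z"
proof -
  obtain x y where z: "z = (x, y)" by (cases z)
  have n2: "(norm z)\<^sup>2 = x\<^sup>2 + y\<^sup>2" by (simp add: z norm_Pair)
  have q: "(3/2 :: real)\<^sup>2 = 9/4" by (simp add: power2_eq_square)
  have sq: "0 \<le> (x - y)\<^sup>2" "0 \<le> (x + y)\<^sup>2" "0 \<le> x\<^sup>2" "0 \<le> y\<^sup>2" by simp_all
  have A: "\<bar>x + y\<bar> \<le> 3/2 * norm z"
  proof (rule power2_le_imp_le)
    have k: "9/4 * (x\<^sup>2 + y\<^sup>2) = (x + y)\<^sup>2 + ((x - y)\<^sup>2 + (x\<^sup>2 + y\<^sup>2) / 4)"
      by (simp add: power2_eq_square field_simps)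
    show "\<bar>x + y\<bar>\<^sup>2 \<le> (3/2 * norm z)\<^sup>2"
      unfolding power_mult_distrib n2 power2_abs q k using sq by simp
  qed simp
  have B: "\<bar>x - y\<bar> \<le> 3/2 * norm z"
  proof (rule power2_le_imp_le)
    have k: "9/4 * (x\<^sup>2 + y\<^sup>2) = (x - y)\<^sup>2 + ((x + y)\<^sup>2 + (x\<^sup>2 + y\<^sup>2) / 4)"
      by (simp add: power2_eq_square field_simps)
    show "\<bar>x - y\<bar>\<^sup>2 \<le> (3/2 * norm z)\<^sup>2"
      unfolding power_mult_distrib n2 power2_abs q k using sq by simp
  qed simp
  define n where "n = norm z"
  have "0 \<le> n" "x + y \<le> 3/2 * n" "- (x + y) \<le> 3/2 * n" "x - y \<le> 3/2 * n" "- (x - y) \<le> 3/2 * n"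
    using order_trans[OF abs_ge_self A] order_trans[OF abs_ge_minus_self A]
      order_trans[OF abs_ge_self B] order_trans[OF abs_ge_minus_self B] by (simp_all only: n_def norm_ge_zero)
  then have "max (max (2 * (x + y) / 5) (- 2 * (x + y))) (max (2 * (x - y) / 3) (2 * (y - x) / 3)) \<le> 3 * n"
    unfolding max.bounded_iff by (intro conjI; argo)
  then show ?thesis by (simp only: diamond_gauge_def n_def z fst_conv snd_conv)
qed

lemma diamond_gauge_scale: "0 \<le> c \<Longrightarrow> diamond_gauge (c *\<^sub>R z) = c * diamond_gauge z"
  by (simp add: diamond_gauge_def max_mult_distrib_left distrib_left right_diff_distrib mult.left_commute)

lemma radial_profile_pos: "z \<noteq> 0 \<Longrightarrow> 0 < radial_profile z"
  using diamond_gauge_pos[of z] by (simp add: radial_profile_def less_max_iff_disj)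

lemma norm_radial_map: "norm (radial_map z) = radial_profile z"
proof (cases "z = 0")
  case True
  then show ?thesis by (simp add: radial_map_def radial_profile_def diamond_gauge_def)
next
  case False
  then show ?thesis using radial_profile_pos[OF False] by (simp add: radial_map_def)
qed

lemma continuous_radial_profile: "continuous_on UNIV radial_profile"
  unfolding radial_profile_def diamond_gauge_def by (intro continuous_intros) auto

lemma continuous_radial_map: "continuous_on UNIV radial_map"
proof -
  have "isCont radial_map z" for z
  proof (cases "z = 0")
    case True
    have "isCont radial_profile 0"
      using continuous_radial_profile by (simp add: continuous_on_eq_continuous_at del: split_paired_All)
    then have "(radial_profile \<longlongrightarrow> 0) (at 0)"
      by (simp add: isCont_def radial_profile_def diamond_gauge_def)
    then have "((\<lambda>z. norm (radial_map z)) \<longlongrightarrow> 0) (at 0)" by (simp only: norm_radial_map)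
    then have "(radial_map \<longlongrightarrow> 0) (at 0)" by (rule tendsto_norm_zero_cancel)
    moreover have "radial_map 0 = 0" by (simp add: radial_map_def)
    ultimately show ?thesis using True by (simp only: isCont_def)
  next
    case False
    have "isCont radial_profile z"
      using continuous_radial_profile by (simp add: continuous_on_eq_continuous_at del: split_paired_All)
    then show ?thesis using False unfolding radial_map_def[abs_def] by (intro continuous_intros) auto
  qed
  then show ?thesis by (simp add: continuous_on_eq_continuous_at del: split_paired_All)
qed

lemma radial_profile_strict:
  assumes "z \<noteq> 0" "0 < a" "a < b"
  shows "radial_profile (a *\<^sub>R z) < radial_profile (b *\<^sub>R z)"
proof -
  have 1: "a * diamond_gauge z < b * diamond_gauge z" "a * norm z < b * norm z"
    using assms diamond_gauge_pos[OF assms(1)] by auto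
  have 2: "radial_profile (c *\<^sub>R z) = max (c * diamond_gauge z / 3) (min (c * norm z) (2 * (c * norm z) - 4))"
    if "0 < c" for c
    using that by (simp add: radial_profile_def diamond_gauge_scale)
  have "max (A / 3) (min p (2 * p - 4)) < max (B / 3) (min q (2 * q - 4))" if "A < B" "p < q" for A B p q :: real
    using that by (auto simp: max_def min_def)
  from this[OF 1] show ?thesis
    unfolding 2[OF assms(2)] 2[OF less_trans[OF assms(2,3)]] .
qed

text \<open>The image has the direction of the point, and its norm is \<open>radial_profile\<close>,
  which is strictly increasing along rays.\<close>

lemma inj_radial_map: "inj radial_map"
proof (rule injI)
  fix z w assume eq: "radial_map z = radial_map w"
  then have f: "radial_profile z = radial_profile w" by (metis norm_radial_map)
  show "z = w"
  proof (cases "z = 0 \<or> w = 0")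
    case True
    have "radial_profile 0 = 0" by (simp add: radial_profile_def diamond_gauge_def)
    then show ?thesis using True f radial_profile_pos[of z] radial_profile_pos[of w]
      by (metis less_irrefl)
  next
    case False
    define a where "a = norm z / norm w"
    have a: "0 < a" using False by (simp add: a_def)
    have "(1 / norm z) *\<^sub>R z = (1 / norm w) *\<^sub>R w"
    proof -
      have "(1 / radial_profile v) *\<^sub>R radial_map v = (1 / norm v) *\<^sub>R v" if "v \<noteq> 0" for v
        using radial_profile_pos[OF that] by (simp add: radial_map_def)
      then show ?thesis using eq f False by metis
    qed
    then have "norm z *\<^sub>R ((1 / norm z) *\<^sub>R z) = norm z *\<^sub>R ((1 / norm w) *\<^sub>R w)" by simp
    then have z: "z = a *\<^sub>R w" using False by (simp add: a_def)
    have "a = 1"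
      using radial_profile_strict[of w a 1] radial_profile_strict[of w 1 a] f a False
      unfolding z by (cases a "1::real" rule: linorder_cases) auto
    then show ?thesis using z by simp
  qed
qed

lemma supported_radial_map: "supported_homeo (ball 0 4) radial_map"
proof (rule supported_homeoI[OF continuous_radial_map inj_radial_map])
  fix z :: plane assume "z \<notin> ball 0 4"
  then have "4 \<le> norm z" by simp
  then have "radial_profile z = norm z" using diamond_gauge_le[of z] by (simp add: radial_profile_def)
  then show "radial_map z = z" using \<open>4 \<le> norm z\<close> by (auto simp: radial_map_def)
qed simp

lemma diamond_iff: "z \<in> diamond \<longleftrightarrow> diamond_gauge z = 1"
proof -
  obtain x y where z: "z = (x, y)" by (cases z)
  have seg: "z \<in> closed_segment a b \<longleftrightarrow> (\<exists>u. 0 \<le> u \<and> u \<le> 1 \<and> z = (1 - u) *\<^sub>R a + u *\<^sub>R b)" for a b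
    by (auto simp: closed_segment_def)
  have 1: "z \<in> closed_segment (-1, 1/2) (1/2, 2) \<longleftrightarrow> y - x = 3/2 \<and> -1 \<le> x \<and> x \<le> 1/2"
    unfolding seg unfolding z by (auto simp: field_simps intro!: exI[of _ "2 * (x + 1) / 3"])
  have 2: "z \<in> closed_segment (1/2, 2) (2, 1/2) \<longleftrightarrow> x + y = 5/2 \<and> 1/2 \<le> x \<and> x \<le> 2"
    unfolding seg unfolding z by (auto simp: field_simps intro!: exI[of _ "2 * (x - 1/2) / 3"])
  have 3: "z \<in> closed_segment (2, 1/2) (1/2, -1) \<longleftrightarrow> x - y = 3/2 \<and> 1/2 \<le> x \<and> x \<le> 2"
    unfolding seg unfolding z by (auto simp: field_simps intro!: exI[of _ "2 * (2 - x) / 3"])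
  have 4: "z \<in> closed_segment (1/2, -1) (-1, 1/2) \<longleftrightarrow> x + y = -1/2 \<and> -1 \<le> x \<and> x \<le> 1/2"
    unfolding seg unfolding z by (auto simp: field_simps intro!: exI[of _ "2 * (1/2 - x) / 3"])
  show ?thesis
    by (simp add: diamond_def 1 2 3 4) (simp add: z diamond_gauge_def max_def; linarith)
qed

text \<open>The number 13/6 solves \<open>2 * n - 4 = 1/3\<close>. The bound follows from the
  equations of the sides and \<open>2 * (x\<^sup>2 + y\<^sup>2) = (x + y)\<^sup>2 + (x -
  y)\<^sup>2\<close>.\<close>

lemma norm_diamond: "z \<in> diamond \<Longrightarrow> norm z \<le> 13/6"
proof -
  assume "z \<in> diamond"
  then have g: "diamond_gauge z = 1" by (simp only: diamond_iff)
  obtain x y where z: "z = (x, y)" by (cases z)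
  have b: "x + y \<le> 5/2" "-1/2 \<le> x + y" "\<bar>x - y\<bar> \<le> 3/2"
    using g by (auto simp: diamond_gauge_def z max_def split: if_splits)
  have "\<bar>x + y\<bar> \<le> \<bar>5/2\<bar>" "\<bar>x - y\<bar> \<le> \<bar>3/2\<bar>" using b by linarith+
  then have "(x + y)\<^sup>2 \<le> (5/2)\<^sup>2" "(x - y)\<^sup>2 \<le> (3/2)\<^sup>2"
    unfolding abs_le_square_iff .
  then have "x\<^sup>2 + y\<^sup>2 \<le> (13/6)\<^sup>2" by (simp add: power2_eq_square algebra_simps)
  then have "(norm z)\<^sup>2 \<le> (13/6)\<^sup>2" by (simp add: z norm_Pair)
  then show ?thesis by (rule power2_le_imp_le) simp
qed

lemma radial_map_diamond: "radial_map ` diamond = sphere 0 (1/3)"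
proof (intro equalityI subsetI)
  fix w assume "w \<in> radial_map ` diamond"
  then obtain z where z: "w = radial_map z" "z \<in> diamond" by auto
  have "diamond_gauge z = 1" "norm z \<le> 13/6" using z(2) norm_diamond by (simp_all only: diamond_iff)
  then have "radial_profile z = 1/3" by (simp add: radial_profile_def)
  then show "w \<in> sphere 0 (1/3)" using z by (simp add: norm_radial_map)
next
  fix w :: plane assume "w \<in> sphere 0 (1/3)"
  then have w: "norm w = 1/3" "w \<noteq> 0" by auto
  define g where "g = diamond_gauge w"
  have g: "0 < g" using diamond_gauge_pos[OF w(2)] by (simp add: g_def)
  define z where "z = (1 / g) *\<^sub>R w"
  have z: "diamond_gauge z = 1" unfolding z_def using g by (simp add: diamond_gauge_scale g_def)
  then have zd: "z \<in> diamond" by (simp only: diamond_iff)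
  have p: "radial_profile z = 1/3" using z norm_diamond[OF zd] by (simp add: radial_profile_def)
  have "norm z = 1 / (3 * g)" unfolding z_def using g by (simp add: w(1))
  then have "radial_map z = w" unfolding radial_map_def p using g by (simp add: z_def)
  then show "w \<in> radial_map ` diamond" using zd by auto
qed

definition round_curve :: "real \<Rightarrow> space" where
  "round_curve t = (3/5 * cos (2 * pi * t), 3/5 * sin (2 * pi * t), - 4/5)"

lemma round_curve_derivative:
  "(round_curve has_vector_derivative (- 6/5 * pi * sin (2 * pi * t), 6/5 * pi * cos (2 * pi * t), 0)) (at t)"
  unfolding round_curve_def[abs_def]
  by (rule has_vector_derivative_Pair has_vector_derivative_const | 
      (rule has_real_derivative_iff_has_vector_derivative[THEN iffD1], auto intro!: derivative_eq_intros))+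

lemma inj_round_curve: "inj_on round_curve {0..<1}"
proof (rule inj_onI)
  fix s t :: real assume s: "s \<in> {0..<1}" and t: "t \<in> {0..<1}" and e: "round_curve s = round_curve t"
  have "cos (2 * pi * s) = cos (2 * pi * t)" "sin (2 * pi * s) = sin (2 * pi * t)"
    using e by (auto simp: round_curve_def)
  then obtain n where n: "2 * pi * s = 2 * pi * t + 2 * pi * of_int n"
    using sin_cos_eq_iff by metis
  then have "2 * pi * s = 2 * pi * (t + of_int n)" by (simp add: algebra_simps)
  then have "s = t + of_int n" by (simp only: mult_cancel_left) simp
  then have "real_of_int n < 1" "real_of_int n > -1" using s t by auto
  then have "n = 0" by linarith
  then show "s = t" using \<open>s = t + of_int n\<close> by simp
qed

lemma generic_round_curve: "generic_immersion round_curve" "double_points round_curve = {}"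
proof -
  show d: "double_points round_curve = {}"
    using inj_round_curve by (auto simp: double_points_def inj_on_def)
  have v: "vector_derivative round_curve (at t) = (- 6/5 * pi * sin (2 * pi * t), 6/5 * pi * cos (2 * pi * t), 0)" for t
    by (rule vector_derivative_at[OF round_curve_derivative])
  have per: "round_curve (t + 1) = round_curve t" for t
    by (simp add: round_curve_def distrib_left)
  have "round_curve t \<in> S2" for t
  proof -
    have "(3/5)\<^sup>2 * (1 - u) + (3/5)\<^sup>2 * u + (- 4/5)\<^sup>2 = 1" for u :: real
      by (simp add: power2_eq_square field_simps)
    then show ?thesis
      unfolding S2_iff round_curve_def fst_conv snd_conv power_mult_distrib cos_squared_eq .
  qed
  moreover have "round_curve C1_differentiable_on UNIV"
    unfolding C1_differentiable_on_def
    by (rule exI[of _ "\<lambda>t. (- 6/5 * pi * sin (2 * pi * t), 6/5 * pi * cos (2 * pi * t), 0)"])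
      (intro conjI ballI round_curve_derivative continuous_intros)
  moreover have "vector_derivative round_curve (at t) \<noteq> 0" for t
    using sin_zero_abs_cos_one[of "2 * pi * t"] by (auto simp: v zero_prod_def)
  ultimately have "immersion_of_circle round_curve"
    unfolding immersion_of_circle_def using per by blast
  then show "generic_immersion round_curve"
    using d inj_round_curve unfolding generic_immersion_def inj_on_def by (metis finite.emptyI)
qed

text \<open>A circle about the origin goes to a circle of latitude. For radius 1/3 the denominator
  \<open>x\<^sup>2 + y\<^sup>2 + 1\<close> is 10/9, which gives the factor 9/5, hence the radius
  3/5, and the height -4/5.\<close>

lemma round_curve_image: "inverse_stereographic ` sphere 0 (1/3) = range round_curve"
proof -
  have *: "inverse_stereographic (x, y) = (9/5 * x, 9/5 * y, - 4/5)" if "x\<^sup>2 + y\<^sup>2 = 1/9" for x y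
    unfolding inverse_stereographic_def split that by simp
  have sph: "(x, y) \<in> sphere 0 (1/3) \<longleftrightarrow> x\<^sup>2 + y\<^sup>2 = 1/9" for x y :: real
  proof -
    have "sqrt (x\<^sup>2 + y\<^sup>2) = 1/3 \<longleftrightarrow> x\<^sup>2 + y\<^sup>2 = (1/3)\<^sup>2"
      by (metis real_sqrt_pow2 real_sqrt_unique sum_power2_ge_zero zero_le_divide_1_iff zero_le_numeral)
    then show ?thesis by (simp add: norm_Pair power2_eq_square)
  qed
  show ?thesis
  proof (intro equalityI subsetI)
    fix p assume "p \<in> inverse_stereographic ` sphere 0 (1/3)"
    then obtain z where "z \<in> sphere 0 (1/3)" "p = inverse_stereographic z" by blast
    moreover obtain x y where "z = (x, y)" by (cases z)
    ultimately have xy: "x\<^sup>2 + y\<^sup>2 = 1/9" "p = inverse_stereographic (x, y)" using sph by auto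
    then have "(3 * x)\<^sup>2 + (3 * y)\<^sup>2 = 1" by (simp add: power_mult_distrib)
    then obtain u where u: "3 * x = cos u" "3 * y = sin u" using sincos_total_2pi by metis
    have "p = round_curve (u / (2 * pi))"
      unfolding xy(2) *[OF xy(1)] round_curve_def using u by (simp add: field_simps)
    then show "p \<in> range round_curve" by simp
  next
    fix p assume "p \<in> range round_curve"
    then obtain t where t: "p = round_curve t" by blast
    have "(1/3)\<^sup>2 * (1 - u) + (1/3)\<^sup>2 * u = 1/9" for u :: real
      by (simp add: power2_eq_square field_simps)
    then have e: "(1/3 * cos (2 * pi * t))\<^sup>2 + (1/3 * sin (2 * pi * t))\<^sup>2 = 1/9"
      unfolding power_mult_distrib cos_squared_eq .
    have "p = inverse_stereographic (1/3 * cos (2 * pi * t), 1/3 * sin (2 * pi * t))"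
      unfolding *[OF e] t round_curve_def by simp
    then show "p \<in> inverse_stereographic ` sphere 0 (1/3)"
      using iffD2[OF sph e] by blast
  qed
qed

lemma trivial_round_curve: "trivial_spherical_curve (range round_curve)"
  unfolding trivial_spherical_curve_def using generic_round_curve by blast

lemma deformable_diamond: "deformable (inverse_stereographic ` diamond) (range round_curve)"
  using deformable_planar_eq[OF planar_eq_homeo[OF supported_radial_map, of diamond]]
  by (simp add: radial_map_diamond round_curve_image)

lemma two_bridge_trivial:
  assumes "n \<ge> 1" "\<forall>i\<in>{1..n}. a i \<ge> 1" "two_bridge_knot_projection a n K"
    and "connection_of a n \<noteq> (if odd n then Zero else Infinity)"
  shows "one_three_homotopic K (range round_curve)"
proof -
  have "deformable (inverse_stereographic ` conway_closure a n) (inverse_stereographic ` diamond)"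
    by (rule deformable_planar_eq[OF conway_closure_diamond[OF assms(1,2,4)] bounded_open_box])
  then have 1: "deformable (inverse_stereographic ` conway_closure a n) (range round_curve)"
    using deformable_diamond unfolding deformable_def by (rule equivclp_trans)
  have "ambient_isotopic (inverse_stereographic ` conway_closure a n) K"
    using assms(3) by (simp only: two_bridge_knot_projection_def)
  then have 2: "deformable (inverse_stereographic ` conway_closure a n) K"
    unfolding deformable_def by (intro r_into_equivclp disjI1)
  have "deformable K (range round_curve)"
    using equivclp_trans[OF equivclp_sym[OF 2[unfolded deformable_def]] 1[unfolded deformable_def]]
    unfolding deformable_def .
  moreover have "knot_projection (range round_curve)"
    unfolding knot_projection_def using generic_round_curve by blast
  ultimately show ?thesis
    using assms(3) unfolding one_three_homotopic_def deformable_def two_bridge_knot_projection_def by blast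
qed

section \<open>Curves with two strands\<close>

text \<open>Otherwise four nonzero pairwise orthogonal vectors would be independent in a space of
  dimension three.\<close>

lemma orthogonal_three:
  fixes a b c d :: space
  assumes nz: "a \<noteq> 0" "b \<noteq> 0" "c \<noteq> 0" and "a \<bullet> b = 0" "a \<bullet> c = 0" "b \<bullet> c = 0"
    and "d \<bullet> a = 0" "d \<bullet> b = 0" "d \<bullet> c = 0"
  shows "d = 0"
proof (rule ccontr)
  assume d: "d \<noteq> 0"
  have "pairwise orthogonal {a, b, c, d}"
    using assms by (auto simp: pairwise_def orthogonal_def inner_commute)
  moreover have "0 \<notin> {a, b, c, d}" using nz d by auto
  ultimately have "independent {a, b, c, d}" by (rule pairwise_orthogonal_independent)
  then have "card {a, b, c, d} \<le> DIM(space)" using independent_bound by blast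
  moreover have "a \<noteq> b" "a \<noteq> c" "a \<noteq> d" "b \<noteq> c" "b \<noteq> d" "c \<noteq> d"
    using assms d by (metis inner_eq_zero_iff)+
  ultimately show False by simp
qed

text \<open>Near \<open>t0\<close> the curve \<open>\<gamma>\<close> is the zero set of \<open>\<Phi>\<close> on the sphere, and \<open>\<Phi>\<close> changes sign along
  \<open>\<gamma>\<close> at \<open>t1\<close>. So the two branches at \<open>t1\<close> cannot lie in a half-plane that avoids the branches at \<open>t0\<close>.\<close>

lemma transversal_branches:
  fixes \<gamma> D :: "real \<Rightarrow> space" and F :: "plane \<Rightarrow> space" and L :: "plane \<Rightarrow> real"
  assumes S2: "\<And>t. norm (\<gamma> t) = 1" and FS2: "\<And>z. norm (F z) = 1"
    and D: "\<And>t. (\<gamma> has_vector_derivative D t) (at t)" and cD: "continuous_on UNIV D"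
    and eq: "\<gamma> t1 = \<gamma> t0" and ind: "\<nexists>c. D t1 = c *\<^sub>R D t0" and nz: "D t0 \<noteq> 0"
    and F: "continuous_on UNIV F" "inj F" and lift: "\<And>t. F (\<delta> t) = \<gamma> t" and c\<delta>: "continuous_on UNIV \<delta>"
    and L: "bounded_linear L" and \<eta>: "0 < \<eta>"
    and side: "\<And>u. 0 < \<bar>u\<bar> \<Longrightarrow> \<bar>u\<bar> < \<eta> \<Longrightarrow> 0 < L (\<delta> (t0 + u) - \<delta> t0) \<and> L (\<delta> (t1 + u) - \<delta> t0) < 0"
  shows False
proof -
  interpret L: bounded_linear L by (rule L)
  define q T where "q = \<gamma> t0" and "T = D t0"
  \<comment> \<open>The part of the second velocity that is orthogonal to the first. Together with
    the position \<open>q\<close> it completes \<open>T\<close> to an orthogonal basis of the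
    space.\<close>
  define e where "e = D t1 - ((D t1 \<bullet> T) / (T \<bullet> T)) *\<^sub>R T"
  have TT: "T \<bullet> T > 0" using nz by (simp add: T_def)
  have "e \<noteq> 0" using ind by (auto simp: e_def T_def)
  have eT: "e \<bullet> T = 0" using TT by (simp add: e_def inner_diff_left)
  have "D t1 \<bullet> e = e \<bullet> e + ((D t1 \<bullet> T) / (T \<bullet> T)) * (T \<bullet> e)"
    by (simp add: e_def inner_diff_left inner_diff_right inner_commute algebra_simps)
  then have De: "D t1 \<bullet> e > 0" using eT \<open>e \<noteq> 0\<close> by (simp add: inner_commute)
  have tangent: "\<gamma> t \<bullet> D t = 0" for t
  proof -
    have "((\<lambda>t. \<gamma> t \<bullet> \<gamma> t) has_vector_derivative (\<gamma> t \<bullet> D t + D t \<bullet> \<gamma> t)) (at t)"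
      by (rule bounded_bilinear.has_vector_derivative[OF bounded_bilinear_inner D D])
    moreover have "(\<lambda>t. \<gamma> t \<bullet> \<gamma> t) = (\<lambda>t. 1)" using S2 by (auto simp: dot_square_norm)
    ultimately show ?thesis
      using vector_derivative_unique_at[OF _ has_vector_derivative_const] by (fastforce simp: inner_commute)
  qed
  have qT: "q \<bullet> T = 0" using tangent[of t0] by (simp add: q_def T_def)
  have "q \<bullet> D t1 = 0" using tangent[of t1] eq by (simp add: q_def)
  then have qe: "q \<bullet> e = 0" using qT by (simp add: e_def inner_diff_right)
  have qq: "q \<bullet> q = 1" using S2[of t0] by (simp add: q_def dot_square_norm)
  have deriv: "((\<lambda>t. \<gamma> t \<bullet> w) has_real_derivative D t \<bullet> w) (at t)" for w t
    unfolding has_real_derivative_iff_has_vector_derivative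
    by (rule bounded_linear.has_vector_derivative[OF bounded_linear_inner_left D])
  \<comment> \<open>The coordinate along \<open>T\<close> is strictly increasing on the branch at
    \<open>t0\<close>; its inverse \<open>g\<close> presents this branch as a graph over that
    coordinate.\<close>
  define f where "f = (\<lambda>t. \<gamma> t \<bullet> T)"
  have "isCont (\<lambda>t. D t \<bullet> T) t0"
    using cD by (intro continuous_intros) (simp add: continuous_on_eq_continuous_at)
  then have "\<forall>\<^sub>F t in at t0. 0 < D t \<bullet> T"
    using TT by (intro order_tendstoD(1)[of _ "D t0 \<bullet> T"]) (auto simp: isCont_def T_def)
  then obtain r0 where r0: "0 < r0" "\<And>t. t \<noteq> t0 \<Longrightarrow> dist t t0 < r0 \<Longrightarrow> 0 < D t \<bullet> T"
    unfolding eventually_at by auto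
  define r where "r = min r0 \<eta> / 2"
  have r: "0 < r" "r < r0" "r < \<eta>" using r0(1) \<eta> by (auto simp: r_def)
  define I where "I = {t0 - r..t0 + r}"
  have Dpos: "0 < D t \<bullet> T" if "t \<in> I" for t
    using that r r0(2)[of t] TT by (cases "t = t0") (auto simp: I_def dist_real_def T_def)
  have mono: "f s < f t" if "s \<in> I" "t \<in> I" "s < t" for s t
    unfolding f_def using that
    by (intro DERIV_pos_imp_increasing[of s t "\<lambda>t. \<gamma> t \<bullet> T"]) (auto intro!: exI[of _ "D _ \<bullet> T"] deriv Dpos simp: I_def)
  have inj: "inj_on f I" using mono by (intro linorder_inj_onI) (auto simp: less_imp_neq)
  have cf: "continuous_on S f" for S
    unfolding f_def by (rule DERIV_continuous_on[OF DERIV_subset[OF deriv]]) auto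
  define g where "g = the_inv_into I f"
  have g: "g (f t) = t" if "t \<in> I" for t unfolding g_def by (rule the_inv_into_f_f[OF inj that])
  define J where "J = {f (t0 - r)<..<f (t0 + r)}"
  have J: "y \<in> f ` I" if "y \<in> J" for y
  proof -
    have "\<exists>t\<ge>t0 - r. t \<le> t0 + r \<and> f t = y"
      using that r(1) by (intro IVT') (auto simp: J_def intro: cf)
    then show ?thesis by (auto simp: I_def)
  qed
  have gJ: "g y \<in> I" "f (g y) = y" if "y \<in> J" for y using J[OF that] g by auto
  have cg: "continuous_on J g"
    by (rule continuous_on_subset[OF continuous_on_inv[of I f g]]) (use cf g J in \<open>auto simp: I_def\<close>)
  have t0: "t0 \<in> I" "f t0 = 0" "f t1 = 0" using r qT eq by (auto simp: I_def f_def q_def)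
  have J0: "0 \<in> J" using mono[of "t0 - r" t0] mono[of t0 "t0 + r"] r(1) t0 by (auto simp: J_def I_def)
  have g0: "g 0 = t0" using g[OF t0(1)] t0(2) by simp
  have openJ: "open J" by (simp add: J_def)
  have c\<gamma>: "continuous_on S \<gamma>" for S
    by (rule continuous_on_vector_derivative[of S \<gamma> D]) (rule has_vector_derivative_at_within[OF D])
  define Ob where "Ob = {x::space. x \<bullet> T \<in> J}"
  have openOb: "open Ob"
  proof -
    have "continuous_on UNIV (\<lambda>x::space. x \<bullet> T)" by (intro continuous_intros)
    from open_vimage[OF openJ this] show ?thesis by (simp add: Ob_def vimage_def)
  qed
  have c\<gamma>g: "continuous_on Ob (\<lambda>x. \<gamma> (g (x \<bullet> T)))"
    by (rule continuous_on_compose2[OF c\<gamma>[of UNIV]], rule continuous_on_compose2[OF cg])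
       (auto simp: Ob_def intro!: continuous_intros)
  \<comment> \<open>The height in direction \<open>e\<close> above the point of the branch at
    \<open>t0\<close> with the same coordinate along \<open>T\<close>.\<close>
  define \<Phi> where "\<Phi> = (\<lambda>x. x \<bullet> e - \<gamma> (g (x \<bullet> T)) \<bullet> e)"
  have c\<Phi>: "continuous_on Ob \<Phi>" unfolding \<Phi>_def by (intro continuous_intros c\<gamma>g)
  \<comment> \<open>Within the domain of \<Phi>, positive products with \<open>q\<close> exclude the
    second point of the sphere that has the same coordinates along \<open>T\<close> and
    \<open>e\<close>.\<close>
  define N where "N = Ob \<inter> {x. 0 < x \<bullet> q} \<inter> (Ob \<inter> (\<lambda>x. \<gamma> (g (x \<bullet> T)) \<bullet> q) -` {0<..})"
  have "open N"
    unfolding N_def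
    by (intro open_Int openOb continuous_open_preimage continuous_intros c\<gamma>g) (auto intro!: open_Collect_less continuous_intros)
  have zero: "x = \<gamma> (g (x \<bullet> T))" if x: "norm x = 1" "x \<in> N" "\<Phi> x = 0" for x
  proof -
    define y where "y = \<gamma> (g (x \<bullet> T))"
    have xJ: "x \<bullet> T \<in> J" using x by (simp add: N_def Ob_def)
    have pos: "0 < x \<bullet> q" "0 < y \<bullet> q" using x by (auto simp: N_def y_def)
    define k where "k = (x - y) \<bullet> q"
    have "y \<bullet> T = x \<bullet> T" using gJ(2)[OF xJ] by (simp add: y_def f_def)
    moreover have "y \<bullet> e = x \<bullet> e" using x(3) by (simp add: \<Phi>_def y_def)
    ultimately have "x - y - k *\<^sub>R q = 0"
      using qT qe qq eT TT \<open>e \<noteq> 0\<close>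
      by (intro orthogonal_three[of T e q]) (auto simp: inner_diff_left inner_diff_right k_def inner_commute)
    then have xy: "x = y + k *\<^sub>R q" by (simp add: algebra_simps)
    have "x \<bullet> x = y \<bullet> y" using x(1) S2 by (simp add: dot_square_norm y_def)
    then have "k * (2 * (y \<bullet> q) + k) = 0"
      unfolding xy using qq by (simp add: inner_add_left inner_add_right inner_commute algebra_simps)
    moreover have "x \<bullet> q = y \<bullet> q + k" unfolding xy using qq by (simp add: inner_add_left)
    ultimately have "k = 0" using pos by auto
    then show ?thesis using xy by (simp add: y_def)
  qed
  \<comment> \<open>The subtracted term has derivative 0 at \<open>t1\<close>, because it runs along
    the branch at \<open>t0\<close>, whose velocity there is \<open>T\<close> and orthogonal to
    \<open>e\<close>.\<close>
  have "DERIV (\<lambda>t. \<Phi> (\<gamma> t)) t1 :> D t1 \<bullet> e"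
  proof -
    have "isCont g 0" using cg openJ J0 by (simp add: continuous_on_eq_continuous_at)
    have dg: "DERIV g 0 :> inverse (D t0 \<bullet> T)"
      by (rule DERIV_inverse_function[where f = f and x = 0 and a = "f (t0 - r)" and b = "f (t0 + r)"])
        (use \<open>isCont g 0\<close> J0 deriv[of T t0] TT gJ(2) g0 in \<open>auto simp: J_def T_def f_def\<close>)
    have "DERIV (\<lambda>t. g (f t)) t1 :> inverse (D t0 \<bullet> T) * (D t1 \<bullet> T)"
      using DERIV_chain2[of g _ f t1, unfolded t0(3), OF dg] deriv[of T t1] by (simp add: f_def)
    then have "DERIV (\<lambda>t. \<gamma> (g (f t)) \<bullet> e) t1 :> (D t0 \<bullet> e) * (inverse (D t0 \<bullet> T) * (D t1 \<bullet> T))"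
      using DERIV_chain2[of "\<lambda>s. \<gamma> s \<bullet> e" _ "\<lambda>t. g (f t)" t1, unfolded t0(3) g0, OF deriv] by simp
    moreover have "D t0 \<bullet> e = 0" using eT by (simp add: T_def inner_commute)
    ultimately have "DERIV (\<lambda>t. \<gamma> (g (f t)) \<bullet> e) t1 :> 0" by simp
    from DERIV_diff[OF deriv[of e t1] this] show ?thesis by (simp add: \<Phi>_def f_def)
  qed
  moreover have \<Phi>1: "\<Phi> (\<gamma> t1) = 0" using t0 g0 eq by (simp add: \<Phi>_def f_def)
  ultimately obtain d1 d2 where d: "0 < d1" "\<And>u. 0 < u \<Longrightarrow> u < d1 \<Longrightarrow> 0 < \<Phi> (\<gamma> (t1 + u))"
    "0 < d2" "\<And>u. 0 < u \<Longrightarrow> u < d2 \<Longrightarrow> \<Phi> (\<gamma> (t1 - u)) < 0"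
    using DERIV_pos_inc_right[of "\<lambda>t. \<Phi> (\<gamma> t)" "D t1 \<bullet> e" t1] DERIV_pos_inc_left[of "\<lambda>t. \<Phi> (\<gamma> t)" "D t1 \<bullet> e" t1] De
    by auto
  define p where "p = \<delta> t0"
  have Fp: "F p = q" by (simp add: p_def lift q_def)
  have \<delta>1: "\<delta> t1 = p" using F(2) lift eq by (metis injD p_def)
  have "q \<in> N" using J0 qT qq g0 by (simp add: N_def Ob_def flip: q_def)
  then have "p \<in> F -` N" using Fp by simp
  moreover have "open (F -` N)"
    by (rule open_vimage[OF \<open>open N\<close> F(1)])
  ultimately obtain \<rho> where \<rho>: "0 < \<rho>" "ball p \<rho> \<subseteq> F -` N" using open_contains_ball by blast
  have "isCont \<delta> t1" using c\<delta> by (simp add: continuous_on_eq_continuous_at)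
  then obtain d3 where d3: "0 < d3" "\<And>t. dist t t1 < d3 \<Longrightarrow> dist (\<delta> t) (\<delta> t1) < \<rho>"
    using \<rho>(1) unfolding continuous_at_eps_delta by blast
  define u where "u = min (min d1 d2) (min d3 \<eta>) / 2"
  have u: "0 < u" "u < d1" "u < d2" "u < d3" "u < \<eta>" using d d3(1) \<eta> by (auto simp: u_def)
  \<comment> \<open>\<Phi> has opposite signs at the ends of this segment, so it vanishes somewhere
    on it, at a point of the branch at \<open>t0\<close>. But the segment lies in the half-plane
    where \<open>L\<close> is negative, and that branch does not.\<close>
  define C where "C = closed_segment (\<delta> (t1 - u)) (\<delta> (t1 + u))"
  have ends: "\<delta> (t1 - u) \<in> ball p \<rho>" "\<delta> (t1 + u) \<in> ball p \<rho>"
    using d3(2)[of "t1 - u"] d3(2)[of "t1 + u"] u \<delta>1 by (auto simp: dist_real_def dist_commute)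
  then have CN: "C \<subseteq> F -` N" using \<rho>(2) closed_segment_subset[OF _ _ convex_ball] unfolding C_def by blast
  have neg: "L (z - p) < 0" if z: "z \<in> C" for z
  proof -
    obtain s where s: "0 \<le> s" "s \<le> 1" "z = (1 - s) *\<^sub>R \<delta> (t1 - u) + s *\<^sub>R \<delta> (t1 + u)"
      using z unfolding C_def closed_segment_def by auto
    have "z - p = (1 - s) *\<^sub>R (\<delta> (t1 - u) - p) + s *\<^sub>R (\<delta> (t1 + u) - p)"
      using s(3) by (simp add: algebra_simps)
    then have "L (z - p) = (1 - s) * L (\<delta> (t1 - u) - p) + s * L (\<delta> (t1 + u) - p)"
      by (simp add: L.add L.scale)
    moreover have "L (\<delta> (t1 - u) - p) < 0" "L (\<delta> (t1 + u) - p) < 0"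
      using side[of "- u"] side[of u] u by (auto simp: p_def)
    ultimately show ?thesis using s(1,2)
      by (smt (verit) mult_nonneg_nonpos mult_pos_neg)
  qed
  have "continuous_on C (\<lambda>z. \<Phi> (F z))"
    by (rule continuous_on_compose2[OF c\<Phi> continuous_on_subset[OF F(1)]]) (use CN in \<open>auto simp: N_def\<close>)
  then have "connected ((\<lambda>z. \<Phi> (F z)) ` C)"
    by (rule connected_continuous_image) (simp add: C_def)
  moreover have "\<Phi> (F (\<delta> (t1 - u))) \<in> (\<lambda>z. \<Phi> (F z)) ` C" "\<Phi> (F (\<delta> (t1 + u))) \<in> (\<lambda>z. \<Phi> (F z)) ` C"
    by (auto simp: C_def)
  moreover have "\<Phi> (F (\<delta> (t1 - u))) < 0" "0 < \<Phi> (F (\<delta> (t1 + u)))" using d u by (simp_all add: lift)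
  ultimately have "0 \<in> (\<lambda>z. \<Phi> (F z)) ` C"
    using connectedD_interval[of "(\<lambda>z. \<Phi> (F z)) ` C" "\<Phi> (F (\<delta> (t1 - u)))" "\<Phi> (F (\<delta> (t1 + u)))" 0] by simp
  then obtain z where z: "z \<in> C" "\<Phi> (F z) = 0" by auto
  define t where "t = g (F z \<bullet> T)"
  have zN: "F z \<in> N" using z CN by auto
  have "F z = \<gamma> t" unfolding t_def by (rule zero[OF FS2 zN z(2)])
  then have "z = \<delta> t" using F(2) lift by (metis injD)
  have "t \<in> I" unfolding t_def using zN by (intro gJ(1)) (simp add: N_def Ob_def)
  show False
  proof (cases "t = t0")
    case True
    then show False using neg[OF z(1)] \<open>z = \<delta> t\<close> by (simp add: p_def L.zero)
  next
    case False
    then have "0 < L (\<delta> (t0 + (t - t0)) - \<delta> t0)"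
      using \<open>t \<in> I\<close> r by (intro side[THEN conjunct1]) (auto simp: I_def)
    then show False using neg[OF z(1)] \<open>z = \<delta> t\<close> by (simp add: p_def)
  qed
qed

text \<open>Crossings of the model are copies of one straight crossing under translations,
  homotheties and \<open>tau\<close>, all of which keep the two diagonal directions. So the local
  picture may be fixed with slope 1 for \<open>A\<close> and slope -1 for \<open>B\<close>.\<close>

definition crosses :: "plane set \<Rightarrow> plane set \<Rightarrow> plane \<Rightarrow> bool" where
  "crosses A B p \<longleftrightarrow> (\<exists>\<epsilon>>0. \<forall>q\<in>ball p \<epsilon>.
     (q \<in> A \<longleftrightarrow> fst (q - p) = snd (q - p)) \<and> (q \<in> B \<longleftrightarrow> fst (q - p) = - snd (q - p)))"

text \<open>Tells the quadrant of a vector, and thereby identifies one of the four rays of a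
  straight crossing.\<close>

definition signs :: "plane \<Rightarrow> plane" where
  "signs w = (sgn (fst w), sgn (snd w))"

definition diagonal_signs :: "plane set" where
  "diagonal_signs = {1, -1} \<times> {1, -1}"

lemma continuous_sgn_constant:
  fixes f :: "real \<Rightarrow> real"
  assumes "continuous_on {0<..<\<eta>} f" "\<And>u. u \<in> {0<..<\<eta>} \<Longrightarrow> f u \<noteq> 0"
  obtains a where "a \<in> {1, -1}" "\<And>u. u \<in> {0<..<\<eta>} \<Longrightarrow> sgn (f u) = a"
proof -
  have "connected (f ` {0<..<\<eta>})" by (intro connected_continuous_image assms connected_Ioo)
  moreover have "0 \<notin> f ` {0<..<\<eta>}" using assms(2) by auto
  ultimately have "(\<forall>u\<in>{0<..<\<eta>}. 0 < f u) \<or> (\<forall>u\<in>{0<..<\<eta>}. f u < 0)"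
    using connectedD_interval[of "f ` {0<..<\<eta>}" _ _ 0] assms(2) by (metis imageI linorder_neqE_linordered_idom less_imp_le)
  then show ?thesis using that[of 1] that[of "- 1"] by fastforce
qed

text \<open>The smooth curve \<open>\<gamma>\<close> and the straight crossings of \<open>A\<close>
  and \<open>B\<close> lie on different sides of the homeomorphism \<open>\<phi>\<close>. Read in
  the plane, the curve becomes \<open>\<delta>\<close>, of which only continuity is known.
  Smoothness is available for \<open>\<gamma>\<close>, straightness for \<open>\<delta>\<close>, and
  the arguments switch between the two.\<close>

locale two_strands =
  fixes \<gamma> :: "real \<Rightarrow> space" and \<phi> \<psi> :: "space \<Rightarrow> space" and A B :: "plane set"
  assumes generic: "generic_immersion \<gamma>"
    and homeo: "homeomorphism S2 S2 \<phi> \<psi>"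
    and image: "\<phi> ` inverse_stereographic ` (A \<union> B) = range \<gamma>"
    and closed_strands: "closed A" "closed B"
    and crossing_point: "\<And>p. p \<in> A \<Longrightarrow> p \<in> B \<Longrightarrow> crosses A B p \<or> crosses B A p"
begin

definition "lifted z = \<phi> (inverse_stereographic z)"
definition "\<delta> t = stereographic (\<psi> (\<gamma> t))"

lemma lifted_props: "continuous_on UNIV lifted" "inj lifted" "norm (lifted z) = 1"
proof -
  have s: "inverse_stereographic z \<in> S2" for z by (rule inverse_stereographic_S2)
  show "continuous_on UNIV lifted"
    unfolding lifted_def[abs_def]
    by (rule continuous_on_compose2[OF homeomorphism_cont1[OF homeo] continuous_inverse_stereographic])
       (use s in blast)
  show "inj lifted"
  proof (rule injI)
    fix z w assume "lifted z = lifted w"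
    then have "\<psi> (\<phi> (inverse_stereographic z)) = \<psi> (\<phi> (inverse_stereographic w))"
      by (simp only: lifted_def)
    then have "inverse_stereographic z = inverse_stereographic w"
      by (simp only: homeomorphism_apply1[OF homeo s])
    then show "z = w" by (rule injD[OF inj_inverse_stereographic])
  qed
  have "lifted z \<in> S2"
    using homeomorphism_image1[OF homeo] s unfolding lifted_def by blast
  then show "norm (lifted z) = 1" by simp
qed

lemma \<delta>_props: "lifted (\<delta> t) = \<gamma> t" "\<delta> t \<in> A \<union> B" "\<psi> (\<gamma> t) = inverse_stereographic (\<delta> t)"
proof -
  obtain z where z: "z \<in> A \<union> B" "\<gamma> t = \<phi> (inverse_stereographic z)" using image by blast
  have "\<psi> (\<gamma> t) = inverse_stereographic z"
    using z(2) homeomorphism_apply1[OF homeo inverse_stereographic_S2] by simp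
  then show "\<psi> (\<gamma> t) = inverse_stereographic (\<delta> t)" "\<delta> t \<in> A \<union> B" "lifted (\<delta> t) = \<gamma> t"
    using z by (simp_all add: \<delta>_def lifted_def)
qed

lemma \<delta>_eq_iff: "\<delta> s = \<delta> t \<longleftrightarrow> \<gamma> s = \<gamma> t"
  using \<delta>_props(1) by (metis \<delta>_def)

lemma immersion:
  "\<gamma> (t + 1) = \<gamma> t" "\<gamma> t \<in> S2" "vector_derivative \<gamma> (at t) \<noteq> 0"
  "(\<gamma> has_vector_derivative vector_derivative \<gamma> (at t)) (at t)"
  "continuous_on UNIV (\<lambda>t. vector_derivative \<gamma> (at t))"
proof -
  have im: "immersion_of_circle \<gamma>" using generic by (simp add: generic_immersion_def)
  then show "\<gamma> (t + 1) = \<gamma> t" "\<gamma> t \<in> S2" "vector_derivative \<gamma> (at t) \<noteq> 0"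
    unfolding immersion_of_circle_def by blast+
  have "\<gamma> C1_differentiable_on UNIV" using im by (simp add: immersion_of_circle_def)
  then obtain D where D: "\<And>t. (\<gamma> has_vector_derivative D t) (at t)" "continuous_on UNIV D"
    unfolding C1_differentiable_on_def by auto
  then have "vector_derivative \<gamma> (at t) = D t" for t by (intro vector_derivative_at)
  then show "(\<gamma> has_vector_derivative vector_derivative \<gamma> (at t)) (at t)"
    "continuous_on UNIV (\<lambda>t. vector_derivative \<gamma> (at t))" using D by simp_all
qed

lemma continuous_\<delta>: "continuous_on S \<delta>"
proof -
  have "continuous_on UNIV \<gamma>"
    using immersion(4) by (intro continuous_on_vector_derivative) (auto intro: has_vector_derivative_at_within)
  then have "continuous_on UNIV (\<lambda>t. \<psi> (\<gamma> t))"
    by (rule continuous_on_compose2[OF homeomorphism_cont2[OF homeo]]) (use immersion(2) in blast)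
  moreover have "snd (snd (\<psi> (\<gamma> t))) < 1" for t
    unfolding \<delta>_props(3) by (rule S2_height[OF inverse_stereographic_S2 inverse_stereographic_north])
  ultimately have "continuous_on UNIV \<delta>"
    unfolding \<delta>_def[abs_def]
    by (intro continuous_on_compose2[OF continuous_stereographic[of "{p. snd (snd p) < 1}"]]) auto
  then show ?thesis by (rule continuous_on_subset) simp
qed

lemma \<delta>_period: "\<delta> (t + of_int k) = \<delta> t"
proof -
  have 1: "\<delta> (t + 1) = \<delta> t" for t by (simp add: \<delta>_def immersion(1))
  show ?thesis
  proof (induction k rule: int_induct[where k = 0])
    case (step1 i)
    then show ?case using 1[of "t + of_int i"] by (simp add: add.assoc)
  next
    case (step2 i)
    then show ?case using 1[of "t + of_int (i - 1)"] by (simp add: add.assoc)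
  qed simp
qed

lemma \<delta>_surj:
  assumes "z \<in> A \<union> B"
  obtains t where "0 \<le> t" "t < 1" "\<delta> t = z"
proof -
  have "lifted z \<in> range \<gamma>" using assms image unfolding lifted_def by blast
  then obtain s where "\<gamma> s = lifted z" by auto
  then have "\<delta> s = z" using \<delta>_props(1) lifted_props(2) by (metis injD)
  then have "\<delta> (frac s) = z" using \<delta>_period[of "frac s" "floor s"] by (simp add: frac_def)
  then show ?thesis using that[of "frac s"] frac_lt_1[of s] frac_ge_0[of s] by simp
qed

text \<open>The component of \<open>\<gamma>\<close> in the direction of its velocity at
  \<open>s\<close> has a positive derivative there, so it is smaller shortly before \<open>s\<close>
  and larger shortly after.\<close>

lemma local_injective: "\<exists>\<eta>>0. \<forall>u. 0 < \<bar>u\<bar> \<longrightarrow> \<bar>u\<bar> < \<eta> \<longrightarrow> \<delta> (s + u) \<noteq> \<delta> s"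
proof -
  define T where "T = vector_derivative \<gamma> (at s)"
  have d: "DERIV (\<lambda>t. \<gamma> t \<bullet> T) s :> T \<bullet> T"
    unfolding has_real_derivative_iff_has_vector_derivative T_def
    by (rule bounded_linear.has_vector_derivative[OF bounded_linear_inner_left immersion(4)])
  have "0 < T \<bullet> T" using immersion(3) by (simp add: T_def)
  then obtain d1 d2 where "0 < d1" "\<And>u. 0 < u \<Longrightarrow> u < d1 \<Longrightarrow> \<gamma> s \<bullet> T < \<gamma> (s + u) \<bullet> T"
    and "0 < d2" "\<And>u. 0 < u \<Longrightarrow> u < d2 \<Longrightarrow> \<gamma> (s - u) \<bullet> T < \<gamma> s \<bullet> T"
    using DERIV_pos_inc_right[OF d] DERIV_pos_inc_left[OF d] by auto
  then have "\<delta> (s + u) \<noteq> \<delta> s" if "0 < \<bar>u\<bar>" "\<bar>u\<bar> < min d1 d2" for u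
    unfolding \<delta>_eq_iff using that by (cases "0 < u") (force, smt (verit) diff_minus_eq_add)
  then show ?thesis using \<open>0 < d1\<close> \<open>0 < d2\<close> by (intro exI[of _ "min d1 d2"]) simp
qed

text \<open>The branch on which the curve leaves a crossing \<open>\<delta> s\<close>, forwards or backwards in time.\<close>

definition germ :: "real \<Rightarrow> real \<Rightarrow> plane \<Rightarrow> bool" where
  "germ s \<tau> \<sigma> \<longleftrightarrow> (\<exists>\<eta>>0. \<forall>u. 0 < u \<longrightarrow> u < \<eta> \<longrightarrow> signs (\<delta> (s + \<tau> * u) - \<delta> s) = \<sigma>)"

lemma germ_unique:
  assumes "germ s \<tau> \<sigma>" "germ s \<tau> \<rho>"
  shows "\<sigma> = \<rho>"
proof -
  obtain a b where ab: "0 < a" "\<And>u. 0 < u \<Longrightarrow> u < a \<Longrightarrow> signs (\<delta> (s + \<tau> * u) - \<delta> s) = \<sigma>"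
    "0 < b" "\<And>u. 0 < u \<Longrightarrow> u < b \<Longrightarrow> signs (\<delta> (s + \<tau> * u) - \<delta> s) = \<rho>"
    using assms unfolding germ_def by blast
  show ?thesis using ab(1,3) ab(2)[of "min a b / 2"] ab(4)[of "min a b / 2"] by simp
qed

lemma germ_period: "germ (s + of_int k) \<tau> \<sigma> \<longleftrightarrow> germ s \<tau> \<sigma>"
proof -
  have "\<delta> (s + of_int k + \<tau> * u) = \<delta> (s + \<tau> * u)" for u
    using \<delta>_period[of "s + \<tau> * u" k] by (simp add: algebra_simps)
  then show ?thesis by (simp add: germ_def \<delta>_period)
qed

section \<open>The curve at a single crossing\<close>

context
  fixes p :: plane
  assumes pA: "p \<in> A" and pB: "p \<in> B"
begin

lemma local_cross: "\<exists>\<epsilon>>0. \<forall>q\<in>ball p \<epsilon>. q \<in> A \<union> B \<longleftrightarrow> \<bar>fst (q - p)\<bar> = \<bar>snd (q - p)\<bar>"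
  using crossing_point[OF pA pB] unfolding crosses_def abs_eq_iff by (metis Un_iff)

text \<open>Near the crossing the curve lies on the two diagonals and does not return to
  \<open>p\<close> at once. So neither coordinate of the difference vanishes, and each keeps its
  sign on the chosen side of \<open>s\<close>.\<close>

lemma germ_exists:
  assumes s: "\<delta> s = p" and \<tau>: "\<tau> \<in> {1, -1}"
  obtains \<sigma> where "\<sigma> \<in> diagonal_signs" "germ s \<tau> \<sigma>"
proof -
  obtain \<epsilon> where \<epsilon>: "0 < \<epsilon>" "\<And>q. q \<in> ball p \<epsilon> \<Longrightarrow> q \<in> A \<union> B \<longleftrightarrow> \<bar>fst (q - p)\<bar> = \<bar>snd (q - p)\<bar>"
    using local_cross by blast
  obtain \<eta>1 where \<eta>1: "0 < \<eta>1" "\<And>u. 0 < \<bar>u\<bar> \<Longrightarrow> \<bar>u\<bar> < \<eta>1 \<Longrightarrow> \<delta> (s + u) \<noteq> \<delta> s" using local_injective[of s] by blast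
  have "isCont \<delta> s" using continuous_\<delta>[of UNIV] by (simp add: continuous_on_eq_continuous_at)
  then obtain \<eta>2 where \<eta>2: "0 < \<eta>2" "\<And>t. dist t s < \<eta>2 \<Longrightarrow> dist (\<delta> t) (\<delta> s) < \<epsilon>"
    using \<epsilon>(1) unfolding continuous_at_eps_delta by blast
  define \<eta> where "\<eta> = min \<eta>1 \<eta>2"
  define w where "w = (\<lambda>u. \<delta> (s + \<tau> * u) - p)"
  have nz: "fst (w u) \<noteq> 0" "snd (w u) \<noteq> 0" if "u \<in> {0<..<\<eta>}" for u
  proof -
    have u: "\<bar>\<tau> * u\<bar> = u" using that \<tau> by auto
    have "\<delta> (s + \<tau> * u) \<noteq> p" using \<eta>1(2)[of "\<tau> * u"] that u s by (auto simp: \<eta>_def)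
    moreover have "\<delta> (s + \<tau> * u) \<in> ball p \<epsilon>"
      using \<eta>2(2)[of "s + \<tau> * u"] that u s by (auto simp: \<eta>_def dist_real_def dist_commute)
    then have "\<bar>fst (w u)\<bar> = \<bar>snd (w u)\<bar>" unfolding w_def using \<epsilon>(2) \<delta>_props(2) by blast
    ultimately show "fst (w u) \<noteq> 0" "snd (w u) \<noteq> 0" by (auto simp: w_def prod_eq_iff)
  qed
  have cw: "continuous_on {0<..<\<eta>} w"
    unfolding w_def by (intro continuous_intros continuous_on_compose2[OF continuous_\<delta>[of UNIV]]) auto
  obtain a where a: "a \<in> {1, -1}" "\<And>u. u \<in> {0<..<\<eta>} \<Longrightarrow> sgn (fst (w u)) = a"
    using continuous_sgn_constant[of \<eta> "\<lambda>u. fst (w u)"] nz(1) continuous_on_fst[OF cw] by blast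
  obtain b where b: "b \<in> {1, -1}" "\<And>u. u \<in> {0<..<\<eta>} \<Longrightarrow> sgn (snd (w u)) = b"
    using continuous_sgn_constant[of \<eta> "\<lambda>u. snd (w u)"] nz(2) continuous_on_snd[OF cw] by blast
  have "0 < \<eta>" using \<eta>1 \<eta>2 by (simp add: \<eta>_def)
  then have "germ s \<tau> (a, b)" unfolding germ_def using a(2) b(2) s by (auto simp: signs_def w_def intro!: exI[of _ \<eta>])
  moreover have "(a, b) \<in> diagonal_signs" using a(1) b(1) unfolding diagonal_signs_def by blast
  ultimately show ?thesis using that by blast
qed

text \<open>Points on the ray that tend to \<open>p\<close> have parameters with an accumulation
  point \<open>l\<close>, and \<open>\<delta>\<close> maps it to \<open>p\<close>. A parameter of
  the sequence close to \<open>l\<close> lies on one side of it, where the sign pattern is that of a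
  germ; so this germ is \<sigma>.\<close>

lemma germ_covers:
  assumes \<sigma>: "\<sigma> \<in> diagonal_signs"
  obtains s \<tau> where "0 \<le> s" "s < 1" "\<delta> s = p" "\<tau> \<in> {1, -1}" "germ s \<tau> \<sigma>"
proof -
  obtain \<epsilon> where \<epsilon>: "0 < \<epsilon>" "\<And>q. q \<in> ball p \<epsilon> \<Longrightarrow> q \<in> A \<union> B \<longleftrightarrow> \<bar>fst (q - p)\<bar> = \<bar>snd (q - p)\<bar>"
    using local_cross by blast
  have \<sigma>1: "\<bar>fst \<sigma>\<bar> = 1" "\<bar>snd \<sigma>\<bar> = 1" "norm \<sigma> \<le> 2" "signs \<sigma> = \<sigma>"
    using \<sigma> by (auto simp: diagonal_signs_def norm_Pair signs_def real_le_lsqrt)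
  \<comment> \<open>The summand 3 keeps all these points in the ball of radius \<epsilon>, as the
    norm of \<sigma> is at most 2.\<close>
  define x where "x = (\<lambda>n. p + (\<epsilon> / (real n + 3)) *\<^sub>R \<sigma>)"
  have signs_x: "signs (x n - p) = \<sigma>" "x n \<noteq> p" for n
  proof -
    define c where "c = \<epsilon> / (real n + 3)"
    have pos: "0 < c" using \<epsilon>(1) unfolding c_def by (intro divide_pos_pos) auto
    have xc: "x n = p + c *\<^sub>R \<sigma>" by (simp add: x_def c_def)
    show "signs (x n - p) = \<sigma>" using pos \<sigma>1(4) by (simp add: xc signs_def sgn_mult)
    show "x n \<noteq> p" using pos \<sigma>1(1) by (auto simp: xc)
  qed
  have xP: "x n \<in> A \<union> B" for n
  proof -
    have "norm ((\<epsilon> / (real n + 3)) *\<^sub>R \<sigma>) \<le> \<epsilon> / (real n + 3) * 2" using \<sigma>1(3) \<epsilon>(1) by (simp add: divide_right_mono)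
    also have "\<dots> < \<epsilon>" using \<epsilon>(1) by (simp add: field_simps add_pos_nonneg)
    finally have "x n \<in> ball p \<epsilon>" by (simp add: x_def dist_norm)
    then show ?thesis using \<epsilon>(2) \<sigma>1(1,2) by (simp add: x_def abs_mult)
  qed
  have "\<exists>t. 0 \<le> t \<and> t < 1 \<and> \<delta> t = x n" for n using \<delta>_surj[OF xP[of n]] by metis
  then obtain t where t: "\<And>n. 0 \<le> t n" "\<And>n. t n < 1" "\<And>n. \<delta> (t n) = x n" by metis
  have "t n \<in> {0..1}" for n using t(1,2)[of n] by simp
  then obtain l r where l: "l \<in> {0..1}" "strict_mono r" "(t \<circ> r) \<longlonglongrightarrow> l"
    using compact_Icc[of 0 "1::real"] unfolding compact_def by blast
  have "(\<lambda>n. \<epsilon> / (real n + 3)) \<longlonglongrightarrow> 0"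
    by (intro tendsto_divide_0[OF tendsto_const] filterlim_at_top_imp_at_infinity
        filterlim_tendsto_add_at_top[OF _ filterlim_real_sequentially, of _ 3, simplified add.commute] tendsto_const)
  then have "x \<longlonglongrightarrow> p + 0 *\<^sub>R \<sigma>" unfolding x_def by (intro tendsto_intros)
  then have "(x \<circ> r) \<longlonglongrightarrow> p" using LIMSEQ_subseq_LIMSEQ[OF _ l(2)] by simp
  moreover have "(\<lambda>n. \<delta> ((t \<circ> r) n)) \<longlonglongrightarrow> \<delta> l"
    using continuous_\<delta>[of UNIV] l(3)
    by (intro isCont_tendsto_compose[of l \<delta>]) (simp add: continuous_on_eq_continuous_at)
  ultimately have \<delta>l: "\<delta> l = p" using LIMSEQ_unique t(3) by (simp add: o_def)
  obtain \<rho>1 \<rho>2 where g: "germ l 1 \<rho>1" "germ l (-1) \<rho>2"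
    using germ_exists[OF \<delta>l, of 1] germ_exists[OF \<delta>l, of "-1"] by (metis insertI1 insertI2)
  then obtain \<eta>1 \<eta>2 where \<eta>: "0 < \<eta>1" "\<And>u. 0 < u \<Longrightarrow> u < \<eta>1 \<Longrightarrow> signs (\<delta> (l + u) - p) = \<rho>1"
    "0 < \<eta>2" "\<And>u. 0 < u \<Longrightarrow> u < \<eta>2 \<Longrightarrow> signs (\<delta> (l - u) - p) = \<rho>2"
    unfolding germ_def \<delta>l by auto
  obtain n where n: "dist ((t \<circ> r) n) l < min \<eta>1 \<eta>2"
    using l(3) \<eta>(1,3) unfolding lim_sequentially by (metis min_less_iff_conj order_refl)
  define v where "v = t (r n)"
  have v: "\<bar>v - l\<bar> < \<eta>1" "\<bar>v - l\<bar> < \<eta>2" "signs (\<delta> v - p) = \<sigma>" "v \<noteq> l"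
    using n t(3)[of "r n"] signs_x[of "r n"] \<delta>l by (auto simp: v_def dist_real_def)
  have "\<exists>\<tau>\<in>{1, -1}. germ l \<tau> \<sigma>"
  proof (cases "l < v")
    case True
    then have "\<rho>1 = \<sigma>" using \<eta>(2)[of "v - l"] v by simp
    then show ?thesis using g by auto
  next
    case False
    then have "\<rho>2 = \<sigma>" using \<eta>(4)[of "l - v"] v by simp
    then show ?thesis using g by auto
  qed
  then obtain \<tau> where \<tau>: "\<tau> \<in> {1, -1}" "germ l \<tau> \<sigma>" by auto
  have "germ (frac l) \<tau> \<sigma>" "\<delta> (frac l) = p"
    using \<tau>(2) germ_period[of "frac l" "floor l"] \<delta>_period[of "frac l" "floor l"] \<delta>l by (simp_all add: frac_def)
  then show ?thesis using that[of "frac l" \<tau>] \<tau>(1) frac_lt_1[of l] frac_ge_0[of l] by simp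
qed

text \<open>Suppose that both germs at \<open>t0\<close> lie in one half-plane. The two rays in the
  other half-plane are then reached at other parameters, and since there are no triple points this
  is a single parameter \<open>s1\<close>. So two transversal branches would touch without changing
  sides, which \<open>transversal_branches\<close> excludes.\<close>

lemma no_turn:
  assumes t0: "0 \<le> t0" "t0 < 1" "\<delta> t0 = p" and g: "germ t0 1 \<sigma>" "germ t0 (-1) \<sigma>'"
    and L: "L = fst \<or> L = snd" and a: "a \<in> {1, -1}" "L \<sigma> = a" "L \<sigma>' = a"
  shows False
proof -
  have "\<exists>\<rho>1 \<rho>2. \<rho>1 \<in> diagonal_signs \<and> \<rho>2 \<in> diagonal_signs \<and> \<rho>1 \<noteq> \<rho>2 \<and> L \<rho>1 = - a \<and> L \<rho>2 = - a"
  proof (cases "L = fst")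
    case True
    then show ?thesis using a(1) by (intro exI[of _ "(- a, 1)"] exI[of _ "(- a, -1)"]) (auto simp: diagonal_signs_def)
  next
    case False
    then have "L = snd" using L by simp
    then show ?thesis using a(1) by (intro exI[of _ "(1, - a)"] exI[of _ "(-1, - a)"]) (auto simp: diagonal_signs_def)
  qed
  then obtain \<rho>1 \<rho>2 where \<rho>: "\<rho>1 \<in> diagonal_signs" "\<rho>2 \<in> diagonal_signs" "\<rho>1 \<noteq> \<rho>2" "L \<rho>1 = - a" "L \<rho>2 = - a" by blast
  obtain s1 \<tau>1 where 1: "0 \<le> s1" "s1 < 1" "\<delta> s1 = p" "\<tau>1 \<in> {1, -1}" "germ s1 \<tau>1 \<rho>1" by (rule germ_covers[OF \<rho>(1)])
  obtain s2 \<tau>2 where 2: "0 \<le> s2" "s2 < 1" "\<delta> s2 = p" "\<tau>2 \<in> {1, -1}" "germ s2 \<tau>2 \<rho>2" by (rule germ_covers[OF \<rho>(2)])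
  have ne: "s \<noteq> t0" if "\<tau> \<in> {1, -1}" "germ s \<tau> \<rho>" "L \<rho> = - a" for s \<tau> \<rho>
  proof
    assume "s = t0"
    then have "\<rho> = \<sigma> \<or> \<rho> = \<sigma>'" using that g germ_unique by blast
    then show False using that(3) a by auto
  qed
  have n1: "s1 \<noteq> t0" and n2: "s2 \<noteq> t0" using ne 1(4,5) 2(4,5) \<rho>(4,5) by blast+
  have eq: "\<gamma> s1 = \<gamma> t0" "\<gamma> s2 = \<gamma> t0" using 1(3) 2(3) t0(3) \<delta>_eq_iff by metis+
  have triple: "\<forall>r\<in>{0..<1}. \<forall>s\<in>{0..<1}. \<forall>t\<in>{0..<1}. \<gamma> r = \<gamma> s \<and> \<gamma> s = \<gamma> t \<longrightarrow> r = s \<or> s = t \<or> r = t"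
    and trans: "\<forall>s\<in>{0..<1}. \<forall>t\<in>{0..<1}. s \<noteq> t \<and> \<gamma> s = \<gamma> t \<longrightarrow>
        (\<nexists>c. vector_derivative \<gamma> (at s) = c *\<^sub>R vector_derivative \<gamma> (at t))"
    using generic unfolding generic_immersion_def by blast+
  have mem: "s1 \<in> {0..<1}" "s2 \<in> {0..<1}" "t0 \<in> {0..<1}" using 1 2 t0 by auto
  have s12: "s2 = s1"
    using triple[rule_format, OF mem(1,2,3)] eq n1 n2 by auto
  have "\<tau>1 \<noteq> \<tau>2" using germ_unique 1(5) 2(5) \<rho>(3) s12 by blast
  then have "germ s1 1 \<rho>1 \<and> germ s1 (-1) \<rho>2 \<or> germ s1 1 \<rho>2 \<and> germ s1 (-1) \<rho>1"
    using 1(4,5) 2(4,5) s12 by auto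
  then have "\<exists>\<mu>1 \<mu>2. germ s1 1 \<mu>1 \<and> germ s1 (-1) \<mu>2 \<and> L \<mu>1 = - a \<and> L \<mu>2 = - a"
    using \<rho>(4,5) by blast
  then obtain \<mu>1 \<mu>2 where \<mu>: "germ s1 1 \<mu>1" "germ s1 (-1) \<mu>2" "L \<mu>1 = - a" "L \<mu>2 = - a" by blast
  have both: "\<exists>\<eta>>0. \<forall>u. 0 < \<bar>u\<bar> \<and> \<bar>u\<bar> < \<eta> \<longrightarrow> sgn (L (\<delta> (s + u) - p)) = c"
    if hyp: "germ s 1 \<mu>" "germ s (-1) \<mu>'" "L \<mu> = c" "L \<mu>' = c" "\<delta> s = p" for s \<mu> \<mu>' c
  proof -
    obtain d1 d2 where d: "0 < d1" "\<And>u. 0 < u \<Longrightarrow> u < d1 \<Longrightarrow> signs (\<delta> (s + u) - p) = \<mu>"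
      "0 < d2" "\<And>u. 0 < u \<Longrightarrow> u < d2 \<Longrightarrow> signs (\<delta> (s - u) - p) = \<mu>'"
      using hyp(1,2,5) unfolding germ_def by auto
    have Ls: "sgn (L w) = L (signs w)" for w using L by (auto simp: signs_def)
    have "sgn (L (\<delta> (s + u) - p)) = c" if "0 < \<bar>u\<bar>" "\<bar>u\<bar> < min d1 d2" for u
    proof (cases "0 < u")
      case True
      then show ?thesis using d(2)[of u] that hyp(3) by (simp add: Ls)
    next
      case False
      then show ?thesis using d(4)[of "- u"] that hyp(4) by (simp add: Ls)
    qed
    then show ?thesis using d(1,3) by (intro exI[of _ "min d1 d2"]) auto
  qed
  obtain e0 where e0: "0 < e0" "\<And>u. 0 < \<bar>u\<bar> \<Longrightarrow> \<bar>u\<bar> < e0 \<Longrightarrow> sgn (L (\<delta> (t0 + u) - p)) = a"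
    using both[OF g a(2,3) t0(3)] by blast
  obtain e1 where e1: "0 < e1" "\<And>u. 0 < \<bar>u\<bar> \<Longrightarrow> \<bar>u\<bar> < e1 \<Longrightarrow> sgn (L (\<delta> (s1 + u) - p)) = - a"
    using both[OF \<mu> 1(3)] by blast
  have bl: "bounded_linear (\<lambda>w. a * L w)"
    using L bounded_linear_fst bounded_linear_snd by (auto intro: bounded_linear_const_mult)
  show False
  proof (rule transversal_branches[of \<gamma> lifted "\<lambda>t. vector_derivative \<gamma> (at t)" s1 t0 \<delta> "\<lambda>w. a * L w" "min e0 e1"])
    show "norm (\<gamma> t) = 1" for t using immersion(2)[of t] by simp
    show "\<nexists>c. vector_derivative \<gamma> (at s1) = c *\<^sub>R vector_derivative \<gamma> (at t0)"
      using trans mem n1 eq(1) by blast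
    show "0 < a * L (\<delta> (t0 + u) - \<delta> t0) \<and> a * L (\<delta> (s1 + u) - \<delta> t0) < 0"
      if "0 < \<bar>u\<bar>" "\<bar>u\<bar> < min e0 e1" for u
      using e0(2)[of u] e1(2)[of u] that a(1) t0(3)
      by (auto simp: sgn_if split: if_splits)
  qed (use lifted_props immersion \<delta>_props eq(1) continuous_\<delta> bl e0(1) e1(1) in auto)
qed

text \<open>By \<open>no_turn\<close> for both coordinates the two germs lie in opposite quadrants.
  The product \<open>c\<close> of the signs is then the same for both and tells which diagonal the
  curve follows.\<close>

lemma stays_on_strand:
  assumes t0: "0 \<le> t0" "t0 < 1" "\<delta> t0 = p"
  shows "\<exists>\<eta>>0. (\<forall>u. \<bar>u\<bar> < \<eta> \<longrightarrow> \<delta> (t0 + u) \<in> A) \<or> (\<forall>u. \<bar>u\<bar> < \<eta> \<longrightarrow> \<delta> (t0 + u) \<in> B)"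
proof -
  obtain \<sigma> where \<sigma>: "\<sigma> \<in> diagonal_signs" "germ t0 1 \<sigma>" using germ_exists[OF t0(3), of 1] by auto
  obtain \<sigma>' where \<sigma>': "\<sigma>' \<in> diagonal_signs" "germ t0 (-1) \<sigma>'" using germ_exists[OF t0(3), of "-1"] by auto
  have "fst \<sigma> * snd \<sigma> = fst \<sigma>' * snd \<sigma>'"
    using no_turn[OF t0 \<sigma>(2) \<sigma>'(2), of fst "fst \<sigma>"] no_turn[OF t0 \<sigma>(2) \<sigma>'(2), of snd "snd \<sigma>"] \<sigma>(1) \<sigma>'(1)
    by (auto simp: diagonal_signs_def)
  then obtain c where c: "fst \<sigma> * snd \<sigma> = c" "fst \<sigma>' * snd \<sigma>' = c" "c = 1 \<or> c = -1"
    using \<sigma>(1) by (auto simp: diagonal_signs_def)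
  obtain d1 d2 where d: "0 < d1" "\<And>u. 0 < u \<Longrightarrow> u < d1 \<Longrightarrow> signs (\<delta> (t0 + u) - p) = \<sigma>"
    "0 < d2" "\<And>u. 0 < u \<Longrightarrow> u < d2 \<Longrightarrow> signs (\<delta> (t0 - u) - p) = \<sigma>'"
    using \<sigma>(2) \<sigma>'(2) t0(3) unfolding germ_def by auto
  have sg: "sgn (fst (\<delta> (t0 + u) - p)) * sgn (snd (\<delta> (t0 + u) - p)) = c" if "0 < \<bar>u\<bar>" "\<bar>u\<bar> < min d1 d2" for u
  proof (cases "0 < u")
    case True
    then show ?thesis using d(2)[of u] that c(1) by (auto simp: signs_def)
  next
    case False
    then show ?thesis using d(4)[of "- u"] that c(2) by (auto simp: signs_def)
  qed
  have diag: "\<exists>\<eta>>0. \<forall>u. \<bar>u\<bar> < \<eta> \<longrightarrow> \<delta> (t0 + u) \<in> (if c = 1 then X else Y)" if X: "crosses X Y p" "X \<union> Y = A \<union> B" for X Y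
  proof -
    obtain \<epsilon> where \<epsilon>: "0 < \<epsilon>" "\<And>q. q \<in> ball p \<epsilon> \<Longrightarrow>
        (q \<in> X \<longleftrightarrow> fst (q - p) = snd (q - p)) \<and> (q \<in> Y \<longleftrightarrow> fst (q - p) = - snd (q - p))"
      using X(1) unfolding crosses_def by blast
    have "isCont \<delta> t0" using continuous_\<delta>[of UNIV] by (simp add: continuous_on_eq_continuous_at)
    then obtain d3 where d3: "0 < d3" "\<And>t. dist t t0 < d3 \<Longrightarrow> dist (\<delta> t) (\<delta> t0) < \<epsilon>"
      using \<epsilon>(1) unfolding continuous_at_eps_delta by blast
    have "\<delta> (t0 + u) \<in> (if c = 1 then X else Y)" if u: "\<bar>u\<bar> < min d3 (min d1 d2)" for u
    proof -
      have q: "\<delta> (t0 + u) \<in> ball p \<epsilon>" using d3(2)[of "t0 + u"] u t0(3) by (simp add: dist_real_def dist_commute)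
      show ?thesis
      proof (cases "u = 0")
        case True
        then show ?thesis using \<epsilon>(2)[OF q] t0(3) by simp
      next
        case False
        have "\<delta> (t0 + u) \<in> X \<union> Y" using \<delta>_props(2) X(2) by simp
        then show ?thesis using \<epsilon>(2)[OF q] sg[of u] False u c(3) by (auto simp: sgn_if split: if_splits)
      qed
    qed
    then show ?thesis using d3(1) d(1,3) by (intro exI[of _ "min d3 (min d1 d2)"]) auto
  qed
  show ?thesis
    using crossing_point[OF pA pB] diag[of A B] diag[of B A] by (cases "c = 1") auto
qed

end

lemma locally_on_strand:
  "\<exists>\<eta>>0. (\<forall>u. \<bar>u\<bar> < \<eta> \<longrightarrow> \<delta> (t + u) \<in> A) \<or> (\<forall>u. \<bar>u\<bar> < \<eta> \<longrightarrow> \<delta> (t + u) \<in> B)"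
proof -
  have far: "\<exists>\<eta>>0. \<forall>u. \<bar>u\<bar> < \<eta> \<longrightarrow> \<delta> (t + u) \<notin> X" if X: "closed X" "\<delta> t \<notin> X" for X
  proof -
    have "open (\<delta> -` (- X))" using continuous_\<delta>[of UNIV] X(1) by (intro open_vimage) auto
    then obtain \<eta> where "0 < \<eta>" "ball t \<eta> \<subseteq> \<delta> -` (- X)" using X(2) open_contains_ball by blast
    then show ?thesis by (intro exI[of _ \<eta>]) (auto simp: subset_iff dist_real_def)
  qed
  consider "\<delta> t \<notin> A" | "\<delta> t \<notin> B" | "\<delta> t \<in> A" "\<delta> t \<in> B" by blast
  then show ?thesis
  proof cases
    case 1
    then show ?thesis using far[OF closed_strands(1)] \<delta>_props(2) by blast
  next
    case 2
    then show ?thesis using far[OF closed_strands(2)] \<delta>_props(2) by blast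
  next
    case 3
    \<comment> \<open>The conditions of a generic immersion speak of parameters in
      \<open>{0..<1}\<close>, so the parameter is reduced modulo 1.\<close>
    have e: "\<delta> (t + u) = \<delta> (frac t + u)" for u
      using \<delta>_period[of "frac t + u" "floor t"] by (simp add: frac_def algebra_simps)
    then have "\<delta> (frac t) = \<delta> t" using e[of 0] by simp
    from stays_on_strand[OF 3 frac_ge_0 frac_lt_1 this] show ?thesis by (simp add: e)
  qed
qed

text \<open>The parameters at which the curve stays locally in \<open>A\<close>, or in
  \<open>B\<close>, form two open sets that cover the line. They are disjoint, since near a crossing
  the strands have only one common point and the curve leaves it. By connectedness the curve remains
  on one strand, although it runs through all points of both.\<close>

lemma one_strand: "A \<subseteq> B \<or> B \<subseteq> A"
proof -
  define U where "U = (\<lambda>X. {t. \<exists>\<eta>>0. \<forall>u. \<bar>u\<bar> < \<eta> \<longrightarrow> \<delta> (t + u) \<in> X})"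
  have openU: "open (U X)" for X
  proof (rule openI)
    fix t assume "t \<in> U X"
    then obtain \<eta> where \<eta>: "0 < \<eta>" "\<And>u. \<bar>u\<bar> < \<eta> \<Longrightarrow> \<delta> (t + u) \<in> X" by (auto simp: U_def)
    have "s \<in> U X" if "s \<in> ball t (\<eta> / 2)" for s
    proof -
      have "\<delta> (s + u) \<in> X" if u: "\<bar>u\<bar> < \<eta> / 2" for u
      proof -
        have "\<bar>t - s\<bar> < \<eta> / 2" using \<open>s \<in> ball t (\<eta> / 2)\<close> by (simp add: dist_real_def)
        then have "\<bar>s - t + u\<bar> < \<eta>" using u by linarith
        from \<eta>(2)[OF this] show ?thesis by simp
      qed
      then show ?thesis using \<eta>(1) by (auto simp: U_def intro!: exI[of _ "\<eta> / 2"])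
    qed
    then show "\<exists>e>0. ball t e \<subseteq> U X" using \<eta>(1) by (intro exI[of _ "\<eta> / 2"]) auto
  qed
  have cover: "U A \<union> U B = UNIV"
  proof -
    have "t \<in> U A \<union> U B" for t using locally_on_strand[of t] unfolding U_def by blast
    then show ?thesis by blast
  qed
  have disj: "U A \<inter> U B = {}"
  proof (rule ccontr)
    assume "U A \<inter> U B \<noteq> {}"
    then obtain t where "t \<in> U A" "t \<in> U B" by blast
    then obtain e1 e2 where e: "0 < e1" "\<And>u. \<bar>u\<bar> < e1 \<Longrightarrow> \<delta> (t + u) \<in> A" "0 < e2" "\<And>u. \<bar>u\<bar> < e2 \<Longrightarrow> \<delta> (t + u) \<in> B"
      by (auto simp: U_def)
    have pA: "\<delta> t \<in> A" "\<delta> t \<in> B" using e(2)[of 0] e(4)[of 0] e(1,3) by simp_all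
    obtain \<epsilon> where \<epsilon>: "0 < \<epsilon>" "\<And>q. q \<in> ball (\<delta> t) \<epsilon> \<Longrightarrow> q \<in> A \<Longrightarrow> q \<in> B \<Longrightarrow> q = \<delta> t"
    proof -
      have "\<exists>\<epsilon>>0. \<forall>q\<in>ball (\<delta> t) \<epsilon>. q \<in> A \<longrightarrow> q \<in> B \<longrightarrow> fst (q - \<delta> t) = 0 \<and> snd (q - \<delta> t) = 0"
        using crossing_point[OF pA] unfolding crosses_def
      proof (elim disjE exE conjE)
        fix \<epsilon> :: real assume "0 < \<epsilon>" "\<forall>q\<in>ball (\<delta> t) \<epsilon>. (q \<in> A \<longleftrightarrow> fst (q - \<delta> t) = snd (q - \<delta> t)) \<and> (q \<in> B \<longleftrightarrow> fst (q - \<delta> t) = - snd (q - \<delta> t))"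
        then show ?thesis by (intro exI[of _ \<epsilon>]) auto
      next
        fix \<epsilon> :: real assume "0 < \<epsilon>" "\<forall>q\<in>ball (\<delta> t) \<epsilon>. (q \<in> B \<longleftrightarrow> fst (q - \<delta> t) = snd (q - \<delta> t)) \<and> (q \<in> A \<longleftrightarrow> fst (q - \<delta> t) = - snd (q - \<delta> t))"
        then show ?thesis by (intro exI[of _ \<epsilon>]) auto
      qed
      then obtain \<epsilon> where e0: "0 < \<epsilon>" "\<forall>q\<in>ball (\<delta> t) \<epsilon>. q \<in> A \<longrightarrow> q \<in> B \<longrightarrow> fst (q - \<delta> t) = 0 \<and> snd (q - \<delta> t) = 0"
        by blast
      show ?thesis
      proof (rule that[OF e0(1)])
        fix q assume "q \<in> ball (\<delta> t) \<epsilon>" "q \<in> A" "q \<in> B"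
        then have "fst (q - \<delta> t) = 0 \<and> snd (q - \<delta> t) = 0" using e0(2) by blast
        then show "q = \<delta> t" by (simp add: prod_eq_iff)
      qed
    qed
    have "isCont \<delta> t" using continuous_\<delta>[of UNIV] by (simp add: continuous_on_eq_continuous_at)
    then obtain d3 where d3: "0 < d3" "\<And>s. dist s t < d3 \<Longrightarrow> dist (\<delta> s) (\<delta> t) < \<epsilon>"
      using \<epsilon>(1) unfolding continuous_at_eps_delta by blast
    obtain d4 where d4: "0 < d4" "\<And>u. 0 < \<bar>u\<bar> \<Longrightarrow> \<bar>u\<bar> < d4 \<Longrightarrow> \<delta> (t + u) \<noteq> \<delta> t" using local_injective[of t] by blast
    define u where "u = min (min e1 e2) (min d3 d4) / 2"
    have u: "0 < u" "u < e1" "u < e2" "u < d3" "u < d4" using e d3 d4 by (auto simp: u_def)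
    have "\<delta> (t + u) = \<delta> t"
      using d3(2)[of "t + u"] u by (intro \<epsilon>(2) e(2) e(4)) (auto simp: dist_real_def dist_commute)
    then show False using d4(2)[of u] u by simp
  qed
  have "U A = {} \<or> U B = {}"
    using connectedD[OF connected_UNIV openU[of A] openU[of B]] cover disj by simp
  then have "U A = UNIV \<or> U B = UNIV" using cover by blast
  moreover have "\<delta> t \<in> X" if tU: "t \<in> U X" for t X
  proof -
    obtain \<eta> where "0 < \<eta>" "\<forall>u. \<bar>u\<bar> < \<eta> \<longrightarrow> \<delta> (t + u) \<in> X" using tU unfolding U_def by blast
    then show ?thesis by (auto dest!: spec[of _ 0])
  qed
  ultimately have "(\<forall>t. \<delta> t \<in> A) \<or> (\<forall>t. \<delta> t \<in> B)" by blast
  then show ?thesis using \<delta>_surj by (metis UnI1 UnI2 subsetI)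
qed

end

subsection \<open>Strands of Conway tangles\<close>

text \<open>The corners of the strand that starts at NW; the other strand has the remaining
  two.\<close>

fun ends :: "connection \<Rightarrow> plane set" where
  "ends Zero = {(0, 1), (1, 1)}"
| "ends Infinity = {(0, 1), (0, 0)}"
| "ends Cross = {(0, 1), (1, 0)}"

text \<open>A strand is any closed set with the right corners, not necessarily an arc:
  \<open>one_strand\<close> asks for closed sets, so self-crossings of a strand are left free.
  Common points stay in the open square, where pieces attached at its boundary do not disturb
  them.\<close>

definition strands :: "connection \<Rightarrow> plane set \<Rightarrow> plane set \<Rightarrow> plane set \<Rightarrow> bool" where
  "strands c S A B \<longleftrightarrow> S = A \<union> B \<and> closed A \<and> closed B \<and> A \<subseteq> unit_square \<and> B \<subseteq> unit_square \<and>
     A \<inter> corners = ends c \<and> B \<inter> corners = corners - ends c \<and>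
     (\<forall>p. p \<in> A \<longrightarrow> p \<in> B \<longrightarrow> p \<in> open_box 0 1 \<and> (crosses A B p \<or> crosses B A p))"

lemma strandsI:
  assumes "S = A \<union> B" "closed A" "closed B" "A \<subseteq> unit_square" "B \<subseteq> unit_square"
    "A \<inter> corners = ends c" "B \<inter> corners = corners - ends c"
    "\<And>p. p \<in> A \<Longrightarrow> p \<in> B \<Longrightarrow> p \<in> open_box 0 1 \<and> (crosses A B p \<or> crosses B A p)"
  shows "strands c S A B"
  unfolding strands_def by (intro conjI allI impI assms)

lemma corners_mem [simp]: "(0, 0) \<in> corners" "(1, 0) \<in> corners" "(0, 1) \<in> corners" "(1, 1) \<in> corners"
  by (simp_all add: corners_def)

lemma strands_corner:
  "strands c S A B \<Longrightarrow> x \<in> corners \<Longrightarrow> (x \<in> A \<longleftrightarrow> x \<in> ends c) \<and> (x \<in> B \<longleftrightarrow> x \<notin> ends c)"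
  unfolding strands_def by blast

lemma crosses_local:
  assumes "crosses A B p" "open U" "p \<in> U" "A \<inter> U = A' \<inter> U" "B \<inter> U = B' \<inter> U"
  shows "crosses A' B' p"
proof -
  obtain \<epsilon> where \<epsilon>: "0 < \<epsilon>" "\<And>q. q \<in> ball p \<epsilon> \<Longrightarrow>
      (q \<in> A \<longleftrightarrow> fst (q - p) = snd (q - p)) \<and> (q \<in> B \<longleftrightarrow> fst (q - p) = - snd (q - p))"
    using assms(1) unfolding crosses_def by blast
  obtain r where r: "0 < r" "ball p r \<subseteq> U" using assms(2,3) open_contains_ball by blast
  have "(q \<in> A' \<longleftrightarrow> fst (q - p) = snd (q - p)) \<and> (q \<in> B' \<longleftrightarrow> fst (q - p) = - snd (q - p))"
    if "q \<in> ball p (min \<epsilon> r)" for q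
  proof -
    have "q \<in> ball p \<epsilon>" "q \<in> U" using that r(2) by auto
    then show ?thesis using \<epsilon>(2)[of q] assms(4,5) by blast
  qed
  then show ?thesis unfolding crosses_def using \<epsilon>(1) r(1) by (intro exI[of _ "min \<epsilon> r"] conjI ballI) auto
qed

lemma mem_shrink: "q \<in> shrink b A \<longleftrightarrow> 4 *\<^sub>R (q - b) \<in> A"
proof
  assume "4 *\<^sub>R (q - b) \<in> A"
  then have "b + (1/4) *\<^sub>R (4 *\<^sub>R (q - b)) \<in> shrink b A" unfolding shrink_def by blast
  then show "q \<in> shrink b A" by simp
qed (auto simp: shrink_def)

lemma crosses_shrink:
  assumes "crosses A B (4 *\<^sub>R (p - b))"
  shows "crosses (shrink b A) (shrink b B) p"
proof -
  obtain \<epsilon> where \<epsilon>: "0 < \<epsilon>" "\<And>q. q \<in> ball (4 *\<^sub>R (p - b)) \<epsilon> \<Longrightarrow>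
      (q \<in> A \<longleftrightarrow> fst (q - 4 *\<^sub>R (p - b)) = snd (q - 4 *\<^sub>R (p - b))) \<and>
      (q \<in> B \<longleftrightarrow> fst (q - 4 *\<^sub>R (p - b)) = - snd (q - 4 *\<^sub>R (p - b)))"
    using assms unfolding crosses_def by blast
  have "(q \<in> shrink b A \<longleftrightarrow> fst (q - p) = snd (q - p)) \<and> (q \<in> shrink b B \<longleftrightarrow> fst (q - p) = - snd (q - p))"
    if q: "q \<in> ball p (\<epsilon> / 4)" for q
  proof -
    have e: "4 *\<^sub>R (q - b) - 4 *\<^sub>R (p - b) = 4 *\<^sub>R (q - p)" by (simp add: algebra_simps)
    have "4 *\<^sub>R (p - b) - 4 *\<^sub>R (q - b) = 4 *\<^sub>R (p - q)" by (simp add: algebra_simps)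
    then have "dist (4 *\<^sub>R (p - b)) (4 *\<^sub>R (q - b)) = 4 * dist p q" by (simp only: dist_norm norm_scaleR abs_numeral)
    then have "4 *\<^sub>R (q - b) \<in> ball (4 *\<^sub>R (p - b)) \<epsilon>" using q by simp
    from \<epsilon>(2)[OF this] show ?thesis unfolding mem_shrink e by auto
  qed
  then show ?thesis unfolding crosses_def using \<epsilon>(1) by (intro exI[of _ "\<epsilon> / 4"] conjI ballI) auto
qed

lemma mem_tau: "q \<in> tau ` A \<longleftrightarrow> tau q \<in> A"
  by (metis image_eqI imageE tau_tau)

lemma crosses_tau:
  assumes "crosses A B (tau p)"
  shows "crosses (tau ` A) (tau ` B) p"
proof -
  obtain \<epsilon> where \<epsilon>: "0 < \<epsilon>" "\<And>q. q \<in> ball (tau p) \<epsilon> \<Longrightarrow>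
      (q \<in> A \<longleftrightarrow> fst (q - tau p) = snd (q - tau p)) \<and> (q \<in> B \<longleftrightarrow> fst (q - tau p) = - snd (q - tau p))"
    using assms unfolding crosses_def by blast
  have "(q \<in> tau ` A \<longleftrightarrow> fst (q - p) = snd (q - p)) \<and> (q \<in> tau ` B \<longleftrightarrow> fst (q - p) = - snd (q - p))"
    if q: "q \<in> ball p \<epsilon>" for q
  proof -
    have "dist (tau p) (tau q) = dist p q"
      by (cases p; cases q) (simp add: tau_def dist_Pair_Pair dist_real_def abs_minus_commute add.commute)
    then have "tau q \<in> ball (tau p) \<epsilon>" using q by simp
    from \<epsilon>(2)[OF this] show ?thesis unfolding mem_tau by (auto simp: tau_def)
  qed
  then show ?thesis unfolding crosses_def using \<epsilon>(1) by blast
qed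

lemma closed_tau: "closed A \<Longrightarrow> closed (tau ` A)"
proof -
  assume "closed A"
  moreover have "continuous_on UNIV tau" unfolding tau_def by (intro continuous_intros)
  moreover have "tau ` A = tau -` A" by (auto simp: mem_tau)
  ultimately show ?thesis by (simp add: closed_vimage)
qed

fun swap_connection :: "connection \<Rightarrow> connection" where
  "swap_connection Zero = Infinity"
| "swap_connection Infinity = Zero"
| "swap_connection Cross = Cross"

lemma strands_tau:
  assumes "strands c S A B"
  shows "strands (swap_connection c) (tau ` S) (tau ` A) (tau ` B)"
proof -
  have inj: "inj tau" by (metis injI tau_tau)
  have c: "tau ` corners = corners" by (auto simp: corners_def tau_def)
  have e: "tau ` ends c = ends (swap_connection c)" by (cases c) (auto simp: tau_def)
  have "tau ` A \<inter> corners = ends (swap_connection c)" "tau ` B \<inter> corners = corners - ends (swap_connection c)"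
    using assms unfolding strands_def e[symmetric]
    by (metis c image_Int[OF inj], metis c image_Int[OF inj] image_set_diff[OF inj])
  moreover have "p \<in> open_box 0 1 \<and> (crosses (tau ` A) (tau ` B) p \<or> crosses (tau ` B) (tau ` A) p)"
    if "p \<in> tau ` A" "p \<in> tau ` B" for p
  proof -
    have "tau p \<in> open_box 0 1" "crosses A B (tau p) \<or> crosses B A (tau p)"
      using assms that unfolding strands_def mem_tau by blast+
    moreover have "p \<in> open_box 0 1"
      using \<open>tau p \<in> open_box 0 1\<close> by (cases p) (simp add: tau_def open_box_def)
    ultimately show ?thesis using crosses_tau by blast
  qed
  ultimately show ?thesis
    using assms closed_tau tau_unit_square unfolding strands_def by (simp add: image_Un)
qed

lemma strands_crossing: "strands Cross crossing (closed_segment (0, 1) (1, 0)) (closed_segment (0, 0) (1, 1))"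
proof -
  have A: "q \<in> closed_segment (0, 1) (1, 0) \<longleftrightarrow> fst q + snd q = 1 \<and> 0 \<le> fst q \<and> fst q \<le> 1" for q :: plane
    by (cases q) (auto simp: closed_segment_def intro!: exI[of _ "fst q"])
  have B: "q \<in> closed_segment (0, 0) (1, 1) \<longleftrightarrow> fst q = snd q \<and> 0 \<le> fst q \<and> fst q \<le> 1" for q :: plane
    by (cases q) (auto simp: closed_segment_def)
  have "crosses (closed_segment (0, 0) (1, 1)) (closed_segment (0, 1) (1, 0)) (1/2, 1/2)"
    unfolding crosses_def
  proof (intro exI[of _ "1/2"] conjI ballI)
    fix q :: plane assume "q \<in> ball (1/2, 1/2) (1/2)"
    then have "dist (1/2, 1/2) q < 1/2" by simp
    then have "\<bar>1/2 - fst q\<bar> < 1/2" using dist_fst_le[of "(1/2, 1/2)" q] by (simp add: dist_real_def)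
    then have "0 \<le> fst q" "fst q \<le> 1" by linarith+
    then show "(q \<in> closed_segment (0, 0) (1, 1)) = (fst (q - (1/2, 1/2)) = snd (q - (1/2, 1/2)))"
      "(q \<in> closed_segment (0, 1) (1, 0)) = (fst (q - (1/2, 1/2)) = - snd (q - (1/2, 1/2)))"
      unfolding A B by auto
  qed simp
  moreover have mid: "p = (1/2, 1/2)" if "p \<in> closed_segment (0, 1) (1, 0)" "p \<in> closed_segment (0, 0) (1, 1)" for p :: plane
    using that unfolding A B by (auto simp: prod_eq_iff)
  ultimately have "p \<in> open_box 0 1 \<and> (crosses (closed_segment (0, 1) (1, 0)) (closed_segment (0, 0) (1, 1)) p \<or>
      crosses (closed_segment (0, 0) (1, 1)) (closed_segment (0, 1) (1, 0)) p)"
    if "p \<in> closed_segment (0, 1) (1, 0)" "p \<in> closed_segment (0, 0) (1, 1)" for p :: plane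
    using mid[OF that] by (simp add: open_box_def)
  moreover have "crossing = closed_segment (0, 1) (1, 0) \<union> closed_segment (0, 0) (1, 1)"
    by (auto simp: crossing_def)
  moreover have "closed_segment (0, 1) (1, 0) \<subseteq> unit_square" "closed_segment (0, 0) (1, 1) \<subseteq> (unit_square :: plane set)"
    by (auto simp: A B)
  moreover have "closed_segment (0, 1) (1, 0) \<inter> corners = ends Cross"
    "closed_segment (0, 0) (1, 1) \<inter> corners = corners - ends Cross"
    by (auto simp: A B corners_def)
  ultimately show ?thesis unfolding strands_def using closed_segment by blast
qed

subsection \<open>Strands of a juxtaposition\<close>

definition leg_nw :: "plane set" where "leg_nw = closed_segment (0, 1) (1/8, 5/8)"
definition leg_sw :: "plane set" where "leg_sw = closed_segment (0, 0) (1/8, 3/8)"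
definition leg_n :: "plane set" where "leg_n = closed_segment (3/8, 5/8) (5/8, 5/8)"
definition leg_s :: "plane set" where "leg_s = closed_segment (3/8, 3/8) (5/8, 3/8)"
definition leg_ne :: "plane set" where "leg_ne = closed_segment (7/8, 5/8) (1, 1)"
definition leg_se :: "plane set" where "leg_se = closed_segment (7/8, 3/8) (1, 0)"

lemmas leg_defs = leg_nw_def leg_sw_def leg_n_def leg_s_def leg_ne_def leg_se_def

lemma juxtapose_legs_eq:
  "juxtapose S T = shrink (1/8, 3/8) S \<union> shrink (5/8, 3/8) T \<union> leg_nw \<union> leg_sw \<union> leg_n \<union> leg_s \<union> leg_ne \<union> leg_se"
  by (simp add: juxtapose_def leg_defs)

lemma leg_regions:
  "leg_nw \<subseteq> {0..1/8} \<times> {5/8..1}" "leg_sw \<subseteq> {0..1/8} \<times> {0..3/8}"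
  "leg_n \<subseteq> {3/8..5/8} \<times> {5/8}" "leg_s \<subseteq> {3/8..5/8} \<times> {3/8}"
  "leg_ne \<subseteq> {7/8..1} \<times> {5/8..1}" "leg_se \<subseteq> {7/8..1} \<times> {0..3/8}"
  unfolding leg_defs by (rule closed_segment_subset; auto intro!: convex_Times)+

lemma leg_corners:
  "leg_nw \<inter> corners = {(0, 1)}" "leg_sw \<inter> corners = {(0, 0)}" "leg_n \<inter> corners = {}" "leg_s \<inter> corners = {}"
  "leg_ne \<inter> corners = {(1, 1)}" "leg_se \<inter> corners = {(1, 0)}"
proof -
  have e: "(0, 1) \<in> leg_nw" "(0, 0) \<in> leg_sw" "(1, 1) \<in> leg_ne" "(1, 0) \<in> leg_se" by (simp_all add: leg_defs)
  show "leg_nw \<inter> corners = {(0, 1)}" using leg_regions(1) e unfolding corners_def by auto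
  show "leg_sw \<inter> corners = {(0, 0)}" using leg_regions(2) e unfolding corners_def by auto
  show "leg_n \<inter> corners = {}" using leg_regions(3) unfolding corners_def by auto
  show "leg_s \<inter> corners = {}" using leg_regions(4) unfolding corners_def by auto
  show "leg_ne \<inter> corners = {(1, 1)}" using leg_regions(5) e unfolding corners_def by auto
  show "leg_se \<inter> corners = {(1, 0)}" using leg_regions(6) e unfolding corners_def by auto
qed

lemma rectangles_disjoint:
  assumes "X \<subseteq> I \<times> J" "Y \<subseteq> I' \<times> J'" "I \<inter> I' = {} \<or> J \<inter> J' = {}"
  shows "X \<inter> Y = {}"
  using assms by blast

lemma closed_legs: "closed leg_nw" "closed leg_sw" "closed leg_n" "closed leg_s" "closed leg_ne" "closed leg_se"
  by (simp_all add: leg_defs)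

lemma legs_disjoint:
  "leg_nw \<inter> leg_sw = {}" "leg_nw \<inter> leg_n = {}" "leg_nw \<inter> leg_s = {}" "leg_nw \<inter> leg_ne = {}" "leg_nw \<inter> leg_se = {}"
  "leg_sw \<inter> leg_n = {}" "leg_sw \<inter> leg_s = {}" "leg_sw \<inter> leg_ne = {}" "leg_sw \<inter> leg_se = {}"
  "leg_n \<inter> leg_s = {}" "leg_n \<inter> leg_ne = {}" "leg_n \<inter> leg_se = {}"
  "leg_s \<inter> leg_ne = {}" "leg_s \<inter> leg_se = {}" "leg_ne \<inter> leg_se = {}"
  by (rule rectangles_disjoint, rule leg_regions, rule leg_regions, simp)+

lemma closed_shrink: "closed S \<Longrightarrow> closed (shrink b S)"
proof -
  assume "closed S"
  moreover have "continuous_on UNIV (\<lambda>q. 4 *\<^sub>R (q - b))" by (intro continuous_intros)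
  moreover have "shrink b S = (\<lambda>q. 4 *\<^sub>R (q - b)) -` S" by (auto simp: mem_shrink)
  ultimately show ?thesis by (simp add: closed_vimage)
qed

lemma shrink_regions:
  assumes "S \<subseteq> unit_square"
  shows "shrink (1/8, 3/8) S \<subseteq> {1/8..3/8} \<times> {3/8..5/8}" "shrink (5/8, 3/8) S \<subseteq> {5/8..7/8} \<times> {3/8..5/8}"
  using shrink_subset[OF assms, of "(1/8, 3/8)"] shrink_subset[OF assms, of "(5/8, 3/8)"] by simp_all

text \<open>A leg touches the closed box in at most one corner. Whether it meets a strand is
  therefore decided by the ends of that strand.\<close>

lemma left_box_legs:
  assumes "S \<subseteq> unit_square"
  shows "(0, 1) \<notin> S \<Longrightarrow> shrink (1/8, 3/8) S \<inter> leg_nw = {}" "(0, 0) \<notin> S \<Longrightarrow> shrink (1/8, 3/8) S \<inter> leg_sw = {}"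
    "(1, 1) \<notin> S \<Longrightarrow> shrink (1/8, 3/8) S \<inter> leg_n = {}" "(1, 0) \<notin> S \<Longrightarrow> shrink (1/8, 3/8) S \<inter> leg_s = {}"
    "shrink (1/8, 3/8) S \<inter> leg_ne = {}" "shrink (1/8, 3/8) S \<inter> leg_se = {}"
proof -
  have corner: "x \<notin> shrink (1/8, 3/8) S" if "4 *\<^sub>R (x - (1/8, 3/8)) \<notin> S" for x using that by (simp add: mem_shrink)
  have sub: "X \<inter> Y \<subseteq> {x}" if "X \<subseteq> I \<times> J" "Y \<subseteq> I' \<times> J'" "I \<inter> I' \<subseteq> {fst x}" "J \<inter> J' \<subseteq> {snd x}"
    for X Y :: "plane set" and I I' J J' :: "real set" and x using that by (cases x) auto
  have s: "shrink (1/8, 3/8) S \<inter> leg_nw \<subseteq> {(1/8, 5/8)}" "shrink (1/8, 3/8) S \<inter> leg_sw \<subseteq> {(1/8, 3/8)}"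
    "shrink (1/8, 3/8) S \<inter> leg_n \<subseteq> {(3/8, 5/8)}" "shrink (1/8, 3/8) S \<inter> leg_s \<subseteq> {(3/8, 3/8)}"
    by (rule sub[OF shrink_regions(1)[OF assms] leg_regions(1)] sub[OF shrink_regions(1)[OF assms] leg_regions(2)]
        sub[OF shrink_regions(1)[OF assms] leg_regions(3)] sub[OF shrink_regions(1)[OF assms] leg_regions(4)]; auto)+
  show "(0, 1) \<notin> S \<Longrightarrow> shrink (1/8, 3/8) S \<inter> leg_nw = {}" using s(1) corner[of "(1/8, 5/8)"] by auto
  show "(0, 0) \<notin> S \<Longrightarrow> shrink (1/8, 3/8) S \<inter> leg_sw = {}"
    using s(2) corner[of "(1/8, 3/8)"] by (auto simp: zero_prod_def)
  show "(1, 1) \<notin> S \<Longrightarrow> shrink (1/8, 3/8) S \<inter> leg_n = {}" using s(3) corner[of "(3/8, 5/8)"] by auto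
  show "(1, 0) \<notin> S \<Longrightarrow> shrink (1/8, 3/8) S \<inter> leg_s = {}" using s(4) corner[of "(3/8, 3/8)"] by auto
  show "shrink (1/8, 3/8) S \<inter> leg_ne = {}" "shrink (1/8, 3/8) S \<inter> leg_se = {}"
    by (rule rectangles_disjoint[OF shrink_regions(1)[OF assms]], rule leg_regions, simp)+
qed

lemma right_box_legs:
  assumes "S \<subseteq> unit_square"
  shows "(0, 1) \<notin> S \<Longrightarrow> shrink (5/8, 3/8) S \<inter> leg_n = {}" "(0, 0) \<notin> S \<Longrightarrow> shrink (5/8, 3/8) S \<inter> leg_s = {}"
    "(1, 1) \<notin> S \<Longrightarrow> shrink (5/8, 3/8) S \<inter> leg_ne = {}" "(1, 0) \<notin> S \<Longrightarrow> shrink (5/8, 3/8) S \<inter> leg_se = {}"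
    "shrink (5/8, 3/8) S \<inter> leg_nw = {}" "shrink (5/8, 3/8) S \<inter> leg_sw = {}"
proof -
  have corner: "x \<notin> shrink (5/8, 3/8) S" if "4 *\<^sub>R (x - (5/8, 3/8)) \<notin> S" for x using that by (simp add: mem_shrink)
  have sub: "X \<inter> Y \<subseteq> {x}" if "X \<subseteq> I \<times> J" "Y \<subseteq> I' \<times> J'" "I \<inter> I' \<subseteq> {fst x}" "J \<inter> J' \<subseteq> {snd x}"
    for X Y :: "plane set" and I I' J J' :: "real set" and x using that by (cases x) auto
  have s: "shrink (5/8, 3/8) S \<inter> leg_n \<subseteq> {(5/8, 5/8)}" "shrink (5/8, 3/8) S \<inter> leg_s \<subseteq> {(5/8, 3/8)}"
    "shrink (5/8, 3/8) S \<inter> leg_ne \<subseteq> {(7/8, 5/8)}" "shrink (5/8, 3/8) S \<inter> leg_se \<subseteq> {(7/8, 3/8)}"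
    by (rule sub[OF shrink_regions(2)[OF assms] leg_regions(3)] sub[OF shrink_regions(2)[OF assms] leg_regions(4)]
        sub[OF shrink_regions(2)[OF assms] leg_regions(5)] sub[OF shrink_regions(2)[OF assms] leg_regions(6)]; auto)+
  show "(0, 1) \<notin> S \<Longrightarrow> shrink (5/8, 3/8) S \<inter> leg_n = {}" using s(1) corner[of "(5/8, 5/8)"] by auto
  show "(0, 0) \<notin> S \<Longrightarrow> shrink (5/8, 3/8) S \<inter> leg_s = {}"
    using s(2) corner[of "(5/8, 3/8)"] by (auto simp: zero_prod_def)
  show "(1, 1) \<notin> S \<Longrightarrow> shrink (5/8, 3/8) S \<inter> leg_ne = {}" using s(3) corner[of "(7/8, 5/8)"] by auto
  show "(1, 0) \<notin> S \<Longrightarrow> shrink (5/8, 3/8) S \<inter> leg_se = {}" using s(4) corner[of "(7/8, 3/8)"] by auto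
  show "shrink (5/8, 3/8) S \<inter> leg_nw = {}" "shrink (5/8, 3/8) S \<inter> leg_sw = {}"
    by (rule rectangles_disjoint[OF shrink_regions(2)[OF assms]], rule leg_regions, simp)+
qed

lemma boxes_disjoint:
  assumes "S \<subseteq> unit_square" "T \<subseteq> unit_square"
  shows "shrink (1/8, 3/8) S \<inter> shrink (5/8, 3/8) T = {}"
  by (rule rectangles_disjoint[OF shrink_regions(1)[OF assms(1)] shrink_regions(2)[OF assms(2)]]) simp

lemma shrink_corners:
  assumes "S \<subseteq> unit_square"
  shows "shrink (1/8, 3/8) S \<inter> corners = {}" "shrink (5/8, 3/8) S \<inter> corners = {}"
  using shrink_regions[OF assms] by (auto simp: corners_def)

lemma open_small_boxes: "open (shrink b (open_box 0 1))"
  unfolding shrink_open_box by (intro open_Times) auto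

lemma legs_open_boxes:
  assumes "X \<in> {leg_nw, leg_sw, leg_n, leg_s, leg_ne, leg_se}"
  shows "X \<inter> shrink (1/8, 3/8) (open_box 0 1) = {}" "X \<inter> shrink (5/8, 3/8) (open_box 0 1) = {}"
proof -
  have "leg_nw \<inter> shrink (1/8, 3/8) (open_box 0 1) = {}" "leg_sw \<inter> shrink (1/8, 3/8) (open_box 0 1) = {}"
    "leg_n \<inter> shrink (1/8, 3/8) (open_box 0 1) = {}" "leg_s \<inter> shrink (1/8, 3/8) (open_box 0 1) = {}"
    "leg_ne \<inter> shrink (1/8, 3/8) (open_box 0 1) = {}" "leg_se \<inter> shrink (1/8, 3/8) (open_box 0 1) = {}"
    unfolding shrink_open_box by (rule rectangles_disjoint, rule leg_regions, rule subset_refl, force)+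
  then show "X \<inter> shrink (1/8, 3/8) (open_box 0 1) = {}" using assms by blast
  have "leg_nw \<inter> shrink (5/8, 3/8) (open_box 0 1) = {}" "leg_sw \<inter> shrink (5/8, 3/8) (open_box 0 1) = {}"
    "leg_n \<inter> shrink (5/8, 3/8) (open_box 0 1) = {}" "leg_s \<inter> shrink (5/8, 3/8) (open_box 0 1) = {}"
    "leg_ne \<inter> shrink (5/8, 3/8) (open_box 0 1) = {}" "leg_se \<inter> shrink (5/8, 3/8) (open_box 0 1) = {}"
    unfolding shrink_open_box by (rule rectangles_disjoint, rule leg_regions, rule subset_refl, force)+
  then show "X \<inter> shrink (5/8, 3/8) (open_box 0 1) = {}" using assms by blast
qed

text \<open>The two strands of a composite are unions of pieces that meet only inside one of the two boxes,
  where they look like the strands of a component.\<close>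

lemma crosses_in_box:
  assumes st: "strands c S A B" and p: "p \<in> shrink b A" "p \<in> shrink b B"
    and A': "A' \<inter> shrink b (open_box 0 1) = shrink b A \<inter> shrink b (open_box 0 1)"
    and B': "B' \<inter> shrink b (open_box 0 1) = shrink b B \<inter> shrink b (open_box 0 1)"
  shows "p \<in> shrink b (open_box 0 1) \<and> (crosses A' B' p \<or> crosses B' A' p)"
proof -
  have "4 *\<^sub>R (p - b) \<in> A" "4 *\<^sub>R (p - b) \<in> B" using p by (simp_all add: mem_shrink)
  then have z: "4 *\<^sub>R (p - b) \<in> open_box 0 1" "crosses A B (4 *\<^sub>R (p - b)) \<or> crosses B A (4 *\<^sub>R (p - b))"
    using st unfolding strands_def by blast+
  then have "p \<in> shrink b (open_box 0 1)" by (simp add: mem_shrink)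
  moreover have "crosses (shrink b A) (shrink b B) p \<or> crosses (shrink b B) (shrink b A) p"
    using z(2) crosses_shrink by blast
  ultimately show ?thesis
    using crosses_local[OF _ open_small_boxes, of _ _ p b] A' B' by metis
qed

lemma small_box_open_box: "shrink (1/8, 3/8) (open_box 0 1) \<subseteq> open_box 0 1" "shrink (5/8, 3/8) (open_box 0 1) \<subseteq> open_box 0 1"
  unfolding shrink_open_box by (auto simp: open_box_def)

text \<open>\<open>Zero\<close> and \<open>Cross\<close> act as the identity and the transposition
  of the upper and lower level; an \<open>Infinity\<close> in either component turns the strand back
  and persists.\<close>

fun compose_right :: "connection \<Rightarrow> connection \<Rightarrow> connection" where
  "compose_right Zero d = d"
| "compose_right Cross Zero = Cross"
| "compose_right Cross Cross = Zero"
| "compose_right c d = Infinity"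

text \<open>In this type the strand from NW returns to SW within \<open>S\<close>, so it is complete
  after its two legs. Everything else, including all of \<open>T\<close>, is assigned to the second
  strand, and no new common points arise.\<close>

lemma strands_juxtapose_Infinity:
  assumes S: "strands Infinity S A B" and T: "T \<subseteq> unit_square" "closed T"
  shows "\<exists>A' B'. strands Infinity (juxtapose S T) A' B'"
proof -
  define sA where "sA = shrink (1/8, 3/8) A"
  define sB where "sB = shrink (1/8, 3/8) B"
  define t where "t = shrink (5/8, 3/8) T"
  define A' where "A' = sA \<union> leg_nw \<union> leg_sw"
  define B' where "B' = sB \<union> leg_n \<union> leg_s \<union> leg_ne \<union> leg_se \<union> t"
  have AB: "A \<subseteq> unit_square" "B \<subseteq> unit_square" "S = A \<union> B" "closed A" "closed B"
    "A \<inter> corners = {(0, 1), (0, 0)}" "B \<inter> corners = corners - {(0, 1), (0, 0)}"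
    using S by (simp_all add: strands_def)
  have ends: "(1, 1) \<notin> A" "(1, 0) \<notin> A" "(0, 1) \<notin> B" "(0, 0) \<notin> B"
    by (simp_all add: strands_corner[OF S])
  note dis = left_box_legs(3)[OF AB(1) ends(1)] left_box_legs(4)[OF AB(1) ends(2)] left_box_legs(5,6)[OF AB(1)]
    left_box_legs(1)[OF AB(2) ends(3)] left_box_legs(2)[OF AB(2) ends(4)] right_box_legs(5,6)[OF T(1)] legs_disjoint
    boxes_disjoint[OF AB(1) T(1)]
  have meet: "A' \<inter> B' \<subseteq> sA \<inter> sB"
    unfolding A'_def B'_def sA_def sB_def t_def Int_Un_distrib Int_Un_distrib2 Un_subset_iff
    by (simp only: dis dis[THEN trans[OF Int_commute]] empty_subsetI subset_refl simp_thms)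
  have lb: "X \<inter> shrink (1/8, 3/8) (open_box 0 1) = {}" if "X \<in> {leg_nw, leg_sw, leg_n, leg_s, leg_ne, leg_se}" for X
    using legs_open_boxes(1)[OF that] .
  have tb: "t \<inter> shrink (1/8, 3/8) (open_box 0 1) = {}"
  proof -
    have "open_box 0 1 \<subseteq> unit_square" by (auto simp: open_box_def)
    from boxes_disjoint[OF this T(1)] show ?thesis by (simp only: t_def Int_commute)
  qed
  have loc: "A' \<inter> shrink (1/8, 3/8) (open_box 0 1) = sA \<inter> shrink (1/8, 3/8) (open_box 0 1)"
    "B' \<inter> shrink (1/8, 3/8) (open_box 0 1) = sB \<inter> shrink (1/8, 3/8) (open_box 0 1)"
    unfolding A'_def B'_def using lb tb by (simp_all add: Int_Un_distrib2)
  have "p \<in> open_box 0 1 \<and> (crosses A' B' p \<or> crosses B' A' p)" if "p \<in> A'" "p \<in> B'" for p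
    using crosses_in_box[OF S, of p "(1/8, 3/8)" A' B'] loc meet that small_box_open_box unfolding sA_def sB_def by blast
  moreover have "juxtapose S T = A' \<union> B'"
    unfolding juxtapose_legs_eq A'_def B'_def sA_def sB_def t_def AB(3) shrink_def by blast
  moreover have "closed A'" "closed B'"
    unfolding A'_def B'_def sA_def sB_def t_def by (intro closed_Un closed_legs closed_shrink AB T)+
  moreover have "A' \<inter> corners = ends Infinity" "B' \<inter> corners = corners - ends Infinity"
    unfolding A'_def B'_def sA_def sB_def t_def Int_Un_distrib2 leg_corners shrink_corners[OF AB(1)]
      shrink_corners[OF AB(2)] shrink_corners[OF T(1)]
    by (auto simp: corners_def)
  moreover have "A' \<subseteq> unit_square" "B' \<subseteq> unit_square"
  proof -
    have "S \<subseteq> unit_square" unfolding AB(3) using AB(1,2) by (simp only: Un_least)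
    then have "A' \<union> B' \<subseteq> unit_square"
      unfolding \<open>juxtapose S T = A' \<union> B'\<close>[symmetric] using T(1) by (rule juxtapose_subset)
    then show "A' \<subseteq> unit_square" "B' \<subseteq> unit_square" by (simp_all only: Un_subset_iff)
  qed
  ultimately show ?thesis by (intro exI[of _ A'] exI[of _ B'] strandsI)
qed

lemma strands_juxtapose:
  assumes S: "strands c S Sa Sb" and T: "strands d T T1 T2" and c: "c \<noteq> Infinity" and d: "d \<noteq> Infinity"
  shows "\<exists>A B. strands (compose_right c d) (juxtapose S T) A B"
proof -
  let ?s = "shrink (1/8, 3/8)" and ?t = "shrink (5/8, 3/8)"
  define mid where "mid = (\<lambda>b. if b then leg_n else leg_s)"
  define out where "out = (\<lambda>b. if b then leg_ne else leg_se)"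
  define tT where "tT = (\<lambda>b. if b then ?t T1 else ?t T2)"
  \<comment> \<open>The strand from NW leaves \<open>S\<close> on the upper level if
    \<open>u\<close> holds. It continues along the strand of \<open>T\<close> that begins on the
    same level, and \<open>T\<close> keeps the level if \<open>v\<close> holds; so it leaves on top
    exactly if \<open>u = v\<close>.\<close>
  define u where "u = (c = Zero)"
  define v where "v = (d = Zero)"
  define A where "A = ?s Sa \<union> leg_nw \<union> mid u \<union> tT u \<union> out (u = v)"
  define B where "B = ?s Sb \<union> leg_sw \<union> mid (\<not> u) \<union> tT (\<not> u) \<union> out (u \<noteq> v)"
  have SS: "Sa \<subseteq> unit_square" "Sb \<subseteq> unit_square" "S = Sa \<union> Sb" "closed Sa" "closed Sb"
    "Sa \<inter> corners = ends c" "Sb \<inter> corners = corners - ends c"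
    using S by (simp_all add: strands_def)
  have TT: "T1 \<subseteq> unit_square" "T2 \<subseteq> unit_square" "T = T1 \<union> T2" "closed T1" "closed T2"
    "T1 \<inter> corners = ends d" "T2 \<inter> corners = corners - ends d"
    using T by (simp_all add: strands_def)
  have corner: "x \<in> corners" if "x \<in> {(0, 1), (0, 0), (1, 1), (1, 0)}" for x using that by (auto simp: corners_def)
  have eS: "(0, 0) \<notin> Sa" "(0, 1) \<notin> Sb" "u \<Longrightarrow> (1, 0) \<notin> Sa" "u \<Longrightarrow> (1, 1) \<notin> Sb" "\<not> u \<Longrightarrow> (1, 1) \<notin> Sa" "\<not> u \<Longrightarrow> (1, 0) \<notin> Sb"
    using c by (cases c; simp add: strands_corner[OF S] u_def)+
  have eT: "(0, 0) \<notin> T1" "(0, 1) \<notin> T2" "v \<Longrightarrow> (1, 0) \<notin> T1" "v \<Longrightarrow> (1, 1) \<notin> T2" "\<not> v \<Longrightarrow> (1, 1) \<notin> T1" "\<not> v \<Longrightarrow> (1, 0) \<notin> T2"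
    using d by (cases d; simp add: strands_corner[OF T] v_def)+
  note dis = left_box_legs(2)[OF SS(1) eS(1)] left_box_legs(5,6)[OF SS(1)] left_box_legs(1)[OF SS(2) eS(2)]
    left_box_legs(5,6)[OF SS(2)] right_box_legs(5,6)[OF TT(1)] right_box_legs(5,6)[OF TT(2)]
    right_box_legs(1)[OF TT(2) eT(2)] right_box_legs(2)[OF TT(1) eT(1)] legs_disjoint
    boxes_disjoint[OF SS(1) TT(1)] boxes_disjoint[OF SS(1) TT(2)] boxes_disjoint[OF SS(2) TT(1)] boxes_disjoint[OF SS(2) TT(2)]
  note disu = left_box_legs(4)[OF SS(1) eS(3)] left_box_legs(3)[OF SS(2) eS(4)]
  note disnu = left_box_legs(3)[OF SS(1) eS(5)] left_box_legs(4)[OF SS(2) eS(6)]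
  note disv = right_box_legs(4)[OF TT(1) eT(3)] right_box_legs(3)[OF TT(2) eT(4)]
  note disnv = right_box_legs(3)[OF TT(1) eT(5)] right_box_legs(4)[OF TT(2) eT(6)]
  note sc = dis[THEN trans[OF Int_commute]]
  have meet: "A \<inter> B \<subseteq> (?s Sa \<inter> ?s Sb) \<union> (?t T1 \<inter> ?t T2)"
  proof (cases u; cases v)
    assume uv: "u" "v"
    note d = disu[OF \<open>u\<close>] disv[OF \<open>v\<close>]
    have "A \<inter> B = (?s Sa \<inter> ?s Sb) \<union> (tT u \<inter> tT (\<not> u))"
      unfolding A_def B_def mid_def out_def tT_def
      by (simp only: uv if_True if_False simp_thms Int_Un_distrib Int_Un_distrib2 dis sc d d[THEN trans[OF Int_commute]]
        Un_empty_left Un_empty_right)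
    then show ?thesis using uv by (auto simp: tT_def)
  next
    assume uv: "u" "\<not> v"
    note d = disu[OF \<open>u\<close>] disnv[OF \<open>\<not> v\<close>]
    have "A \<inter> B = (?s Sa \<inter> ?s Sb) \<union> (tT u \<inter> tT (\<not> u))"
      unfolding A_def B_def mid_def out_def tT_def
      by (simp only: uv if_True if_False simp_thms Int_Un_distrib Int_Un_distrib2 dis sc d d[THEN trans[OF Int_commute]]
        Un_empty_left Un_empty_right)
    then show ?thesis using uv by (auto simp: tT_def)
  next
    assume uv: "\<not> u" "v"
    note d = disnu[OF \<open>\<not> u\<close>] disv[OF \<open>v\<close>]
    have "A \<inter> B = (?s Sa \<inter> ?s Sb) \<union> (tT u \<inter> tT (\<not> u))"
      unfolding A_def B_def mid_def out_def tT_def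
      by (simp only: uv if_True if_False simp_thms Int_Un_distrib Int_Un_distrib2 dis sc d d[THEN trans[OF Int_commute]]
        Un_empty_left Un_empty_right)
    then show ?thesis using uv by (auto simp: tT_def)
  next
    assume uv: "\<not> u" "\<not> v"
    note d = disnu[OF \<open>\<not> u\<close>] disnv[OF \<open>\<not> v\<close>]
    have "A \<inter> B = (?s Sa \<inter> ?s Sb) \<union> (tT u \<inter> tT (\<not> u))"
      unfolding A_def B_def mid_def out_def tT_def
      by (simp only: uv if_True if_False simp_thms Int_Un_distrib Int_Un_distrib2 dis sc d d[THEN trans[OF Int_commute]]
        Un_empty_left Un_empty_right)
    then show ?thesis using uv by (auto simp: tT_def)
  qed
  have ob: "open_box 0 1 \<subseteq> unit_square" by (auto simp: open_box_def)
  have lb: "X \<inter> ?s (open_box 0 1) = {}" "X \<inter> ?t (open_box 0 1) = {}"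
    if "X \<in> {leg_nw, leg_sw, leg_n, leg_s, leg_ne, leg_se}" for X
    using legs_open_boxes[OF that] by simp_all
  have mo: "mid b \<inter> ?s (open_box 0 1) = {}" "mid b \<inter> ?t (open_box 0 1) = {}"
    "out b \<inter> ?s (open_box 0 1) = {}" "out b \<inter> ?t (open_box 0 1) = {}" for b
    unfolding mid_def out_def using lb by simp_all
  have bb: "tT b \<inter> ?s (open_box 0 1) = {}" "?s Sa \<inter> ?t (open_box 0 1) = {}" "?s Sb \<inter> ?t (open_box 0 1) = {}" for b
    unfolding tT_def using boxes_disjoint[OF ob TT(1)] boxes_disjoint[OF ob TT(2)] boxes_disjoint[OF SS(1) ob]
      boxes_disjoint[OF SS(2) ob] by (auto simp: Int_commute)
  have loc: "A \<inter> ?s (open_box 0 1) = ?s Sa \<inter> ?s (open_box 0 1)" "B \<inter> ?s (open_box 0 1) = ?s Sb \<inter> ?s (open_box 0 1)"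
    "A \<inter> ?t (open_box 0 1) = tT u \<inter> ?t (open_box 0 1)" "B \<inter> ?t (open_box 0 1) = tT (\<not> u) \<inter> ?t (open_box 0 1)"
    unfolding A_def B_def Int_Un_distrib2 using lb mo bb by simp_all
  have inT: "p \<in> ?t (open_box 0 1) \<and> (crosses A B p \<or> crosses B A p)" if "p \<in> ?t T1" "p \<in> ?t T2" for p
  proof (cases u)
    case True
    then show ?thesis using crosses_in_box[OF T that, of A B] loc(3,4) by (simp add: tT_def)
  next
    case False
    then show ?thesis using crosses_in_box[OF T that, of B A] loc(3,4) by (auto simp: tT_def)
  qed
  have "p \<in> open_box 0 1 \<and> (crosses A B p \<or> crosses B A p)" if "p \<in> A" "p \<in> B" for p
  proof -
    have "p \<in> ?s Sa \<and> p \<in> ?s Sb \<or> p \<in> ?t T1 \<and> p \<in> ?t T2" using meet that by blast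
    then show ?thesis
    proof
      assume "p \<in> ?s Sa \<and> p \<in> ?s Sb"
      then show ?thesis
        using crosses_in_box[OF S _ _ loc(1,2), of p] subsetD[OF small_box_open_box(1), of p] by simp
    next
      assume "p \<in> ?t T1 \<and> p \<in> ?t T2"
      then show ?thesis using inT[of p] subsetD[OF small_box_open_box(2), of p] by simp
    qed
  qed
  moreover have eq: "juxtapose S T = A \<union> B"
  proof -
    have "?s S = ?s Sa \<union> ?s Sb" "?t T = tT u \<union> tT (\<not> u)" by (auto simp: SS(3) TT(3) tT_def shrink_def)
    moreover have "leg_n \<union> leg_s = mid u \<union> mid (\<not> u)" "leg_ne \<union> leg_se = out (u = v) \<union> out (u \<noteq> v)"
      by (auto simp: mid_def out_def)
    ultimately show ?thesis unfolding juxtapose_legs_eq A_def B_def by blast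
  qed
  moreover have "closed (mid b)" "closed (out b)" "closed (tT b)" for b
    unfolding mid_def out_def tT_def using closed_legs closed_shrink TT(4,5) by auto
  then have "closed A" "closed B"
    unfolding A_def B_def using SS(4,5) by (auto intro!: closed_Un closed_legs closed_shrink)
  moreover have "A \<inter> corners = ends (compose_right c d) \<and> B \<inter> corners = corners - ends (compose_right c d)"
  proof -
    have sc: "?s Sa \<inter> corners = {}" "?s Sb \<inter> corners = {}" "tT b \<inter> corners = {}" "mid b \<inter> corners = {}"
      "out b \<inter> corners = (if b then {(1, 1)} else {(1, 0)})" for b
      using shrink_corners(1)[OF SS(1)] shrink_corners(1)[OF SS(2)] shrink_corners(2)[OF TT(1)]
        shrink_corners(2)[OF TT(2)] leg_corners by (simp_all add: tT_def mid_def out_def)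
    have AC: "A \<inter> corners = {(0, 1)} \<union> (if u = v then {(1, 1)} else {(1, 0)})"
      "B \<inter> corners = {(0, 0)} \<union> (if u \<noteq> v then {(1, 1)} else {(1, 0)})"
      unfolding A_def B_def Int_Un_distrib2 sc leg_corners by simp_all
    show ?thesis
    proof (cases "u = v")
      case True
      then have "compose_right c d = Zero" using c d by (cases c; cases d; simp add: u_def v_def)
      moreover have "corners - {(0, 1), (1, 1)} = {(0, 0), (1, 0)}" unfolding corners_def by auto
      ultimately show ?thesis using True AC by (simp add: insert_commute)
    next
      case False
      then have "compose_right c d = Cross" using c d by (cases c; cases d; simp add: u_def v_def)
      moreover have "corners - {(0, 1), (1, 0)} = {(0, 0), (1, 1)}" unfolding corners_def by auto
      ultimately show ?thesis using False AC by (simp add: insert_commute)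
    qed
  qed
  then have "A \<inter> corners = ends (compose_right c d)" "B \<inter> corners = corners - ends (compose_right c d)"
    by (rule conjunct1, rule conjunct2)
  moreover have "A \<subseteq> unit_square" "B \<subseteq> unit_square"
  proof -
    have "S \<subseteq> unit_square" "T \<subseteq> unit_square" unfolding SS(3) TT(3) using SS(1,2) TT(1,2) by (simp_all only: Un_least)
    then have "A \<union> B \<subseteq> unit_square" unfolding eq[symmetric] by (rule juxtapose_subset)
    then show "A \<subseteq> unit_square" "B \<subseteq> unit_square" by (simp_all only: Un_subset_iff)
  qed
  ultimately show ?thesis by (intro exI[of _ A] exI[of _ B] strandsI)
qed

section \<open>Strands of twists and of Conway tangles\<close>

definition stranded :: "connection \<Rightarrow> plane set \<Rightarrow> bool" where
  "stranded c S \<longleftrightarrow> (\<exists>A B. strands c S A B)"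

lemma stranded_juxtapose:
  assumes "stranded c S" "stranded d T" "d \<noteq> Infinity"
  shows "stranded (compose_right c d) (juxtapose S T)"
proof (cases "c = Infinity")
  case True
  obtain T1 T2 where T: "strands d T T1 T2" using assms(2) by (auto simp: stranded_def)
  have "T \<subseteq> unit_square" "closed T" using T by (auto simp: strands_def)
  then show ?thesis using assms(1) True strands_juxtapose_Infinity by (auto simp: stranded_def)
next
  case False
  then show ?thesis using assms strands_juxtapose unfolding stranded_def by metis
qed

lemma stranded_tau: "stranded c S \<Longrightarrow> stranded (swap_connection c) (tau ` S)"
  unfolding stranded_def using strands_tau by blast

lemma connect_right_not_Infinity: "c \<noteq> Infinity \<Longrightarrow> (connect_right ^^ k) c \<noteq> Infinity"
proof (induction k)
  case (Suc k)
  then show ?case by (cases "(connect_right ^^ k) c") auto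
qed simp

lemma compose_right_power: "compose_right c ((connect_right ^^ k) Zero) = (connect_right ^^ k) c"
proof (induction k)
  case 0
  show ?case by (cases c) simp_all
next
  case (Suc k)
  have "compose_right c (connect_right d) = connect_right (compose_right c d)" if "d \<noteq> Infinity" for d
    using that by (cases c; cases d) simp_all
  then show ?case using Suc connect_right_not_Infinity[of Zero k] by simp
qed

lemma stranded_horizontal_twist: "k \<ge> 1 \<Longrightarrow> stranded ((connect_right ^^ k) Zero) (horizontal_twist k)"
proof (induction k rule: nat_induct_at_least)
  case base
  show ?case using strands_crossing by (auto simp: stranded_def)
next
  case (Suc k)
  then obtain j where k: "k = Suc j" by (cases k) auto
  have "stranded Cross crossing" using strands_crossing by (auto simp: stranded_def)
  from stranded_juxtapose[OF Suc.IH this] show ?case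
    using compose_right_power[of "(connect_right ^^ k) Zero" 1] by (simp add: k)
qed

lemma stranded_right_twist:
  "stranded c S \<Longrightarrow> k \<ge> 1 \<Longrightarrow> stranded ((connect_right ^^ k) c) (juxtapose S (horizontal_twist k))"
  using stranded_juxtapose[OF _ stranded_horizontal_twist connect_right_not_Infinity[of Zero k]]
  by (simp add: compose_right_power)

lemma swap_connect_right: "swap_connection ((connect_right ^^ k) (swap_connection c)) = (connect_below ^^ k) c"
proof (induction k)
  case 0
  show ?case by (cases c) simp_all
next
  case (Suc k)
  have "swap_connection (connect_right d) = connect_below (swap_connection d)" for d by (cases d) simp_all
  then show ?case using Suc by simp
qed

lemma stranded_below_twist:
  assumes "stranded c S" "k \<ge> 1"
  shows "stranded ((connect_below ^^ k) c) (stack S (vertical_twist k))"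
  using stranded_tau[OF stranded_right_twist[OF stranded_tau[OF assms(1)] assms(2)]]
  by (simp add: swap_connect_right tau_juxtapose tau_horizontal_twist)

lemma stranded_conway_tangle:
  "n \<ge> 1 \<Longrightarrow> \<forall>i\<in>{1..n}. a i \<ge> 1 \<Longrightarrow> stranded (connection_of a n) (conway_tangle a n)"
proof (induction a n rule: conway_tangle.induct)
  case (2 a)
  then show ?case using stranded_horizontal_twist[of "a 1"] by simp
next
  case (3 a i)
  then have IH: "stranded (connection_of a (Suc i)) (conway_tangle a (Suc i))" and a: "a (Suc (Suc i)) \<ge> 1"
    by auto
  show ?case
    using stranded_below_twist[OF IH a] stranded_right_twist[OF IH a] by simp
qed simp

subsection \<open>Closures with two components\<close>

definition two_components :: "plane set \<Rightarrow> bool" where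
  "two_components P \<longleftrightarrow> (\<exists>A B. P = A \<union> B \<and> closed A \<and> closed B \<and> \<not> A \<subseteq> B \<and> \<not> B \<subseteq> A \<and>
     (\<forall>p. p \<in> A \<longrightarrow> p \<in> B \<longrightarrow> crosses A B p \<or> crosses B A p))"

text \<open>In this type each closing arc joins the two ends of one strand, and it runs outside the
  square, so no common points are added.\<close>

lemma two_components_numerator:
  assumes "stranded Zero S"
  shows "two_components (numerator_closure S)"
proof -
  obtain A B where st: "strands Zero S A B" using assms by (auto simp: stranded_def)
  define top where "top = polygonal [(0, 1), (1/2, 2), (1, 1::real)]"
  define bot where "bot = polygonal [(0, 0), (1/2, -1), (1, 0::real)]"
  have AB: "A \<subseteq> unit_square" "B \<subseteq> unit_square" "S = A \<union> B" "closed A" "closed B"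
    "A \<inter> corners = {(0, 1), (1, 1)}" "B \<inter> corners = corners - {(0, 1), (1, 1)}"
    using st by (simp_all add: strands_def)
  have e: "(0, 1) \<in> A" "(0, 1) \<notin> B" "(1, 1) \<notin> B" "(0, 0) \<in> B" "(0, 0) \<notin> A" "(1, 0) \<notin> A"
    by (simp_all add: strands_corner[OF st])
  have top: "snd p > 1 \<or> p \<in> {(0, 1), (1, 1)}" if "p \<in> top" for p
    using that by (cases p) (auto simp: top_def closed_segment_def)
  have bot: "snd p < 0 \<or> p \<in> {(0, 0), (1, 0)}" if "p \<in> bot" for p
    using that by (cases p) (auto simp: bot_def closed_segment_def)
  have meet: "p \<in> A \<and> p \<in> B" if p: "p \<in> A \<union> top" "p \<in> B \<union> bot" for p
  proof -
    have "top \<inter> bot = {}" using top bot by fastforce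
    moreover have "top \<inter> B = {}"
    proof -
      have "q \<notin> B" if "q \<in> top" for q
        using top[OF that] e(2,3) subsetD[OF AB(2), of q] by (cases q) auto
      then show ?thesis by blast
    qed
    moreover have "A \<inter> bot = {}"
    proof -
      have "q \<notin> A" if "q \<in> bot" for q
        using bot[OF that] e(5,6) subsetD[OF AB(1), of q] by (cases q) auto
      then show ?thesis by blast
    qed
    ultimately show ?thesis using p by blast
  qed
  have out: "top \<inter> open_box 0 1 = {}" "bot \<inter> open_box 0 1 = {}"
    using top bot by (force simp: open_box_def)+
  have loc: "A \<inter> open_box 0 1 = (A \<union> top) \<inter> open_box 0 1" "B \<inter> open_box 0 1 = (B \<union> bot) \<inter> open_box 0 1"
    using out by blast+
  have "open (open_box 0 1)" by (simp add: open_box_def open_Times)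
  then have "crosses (A \<union> top) (B \<union> bot) p \<or> crosses (B \<union> bot) (A \<union> top) p" if "p \<in> A \<union> top" "p \<in> B \<union> bot" for p
    using meet[OF that] st crosses_local[OF _ _ _ loc] crosses_local[OF _ _ _ loc(2,1)] unfolding strands_def by blast
  moreover have "numerator_closure S = (A \<union> top) \<union> (B \<union> bot)"
    unfolding numerator_closure_def AB(3) top_def bot_def by blast
  moreover have "closed (A \<union> top)" "closed (B \<union> bot)"
    using AB(4,5) by (auto simp: top_def bot_def intro!: closed_Un)
  moreover have "(0, 1) \<in> (A \<union> top) - (B \<union> bot)" "(0, 0) \<in> (B \<union> bot) - (A \<union> top)"
    using e top[of "(0, 0)"] bot[of "(0, 1)"] by auto
  then have "\<not> A \<union> top \<subseteq> B \<union> bot" "\<not> B \<union> bot \<subseteq> A \<union> top" by blast+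
  ultimately show ?thesis
    unfolding two_components_def by (intro exI[of _ "A \<union> top"] exI[of _ "B \<union> bot"] conjI allI impI)
qed

lemma two_components_tau:
  assumes "two_components P"
  shows "two_components (tau ` P)"
proof -
  obtain A B where *: "P = A \<union> B" "closed A" "closed B" "\<not> A \<subseteq> B" "\<not> B \<subseteq> A"
    "\<And>p. p \<in> A \<Longrightarrow> p \<in> B \<Longrightarrow> crosses A B p \<or> crosses B A p"
    using assms unfolding two_components_def by blast
  have "\<not> tau ` X \<subseteq> tau ` Y" if "\<not> X \<subseteq> Y" for X Y
    using that by (metis image_mono tau_image_image)
  moreover have "crosses (tau ` A) (tau ` B) p \<or> crosses (tau ` B) (tau ` A) p" if "p \<in> tau ` A" "p \<in> tau ` B" for p
    using *(6)[of "tau p"] that crosses_tau unfolding mem_tau by blast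
  moreover have "tau ` P = tau ` A \<union> tau ` B" unfolding *(1) by (rule image_Un)
  ultimately show ?thesis
    unfolding two_components_def using *(2-5) closed_tau
    by (intro exI[of _ "tau ` A"] exI[of _ "tau ` B"] conjI allI impI) simp_all
qed

text \<open>The final map of the isotopy is the homeomorphism required by
  \<open>two_strands\<close>. It would force one component into the other, which
  \<open>two_components\<close> excludes.\<close>

lemma two_components_not_knot:
  assumes "two_components P" "knot_projection K" "ambient_isotopic (inverse_stereographic ` P) K"
  shows False
proof -
  obtain A B where AB: "P = A \<union> B" "closed A" "closed B" "\<not> A \<subseteq> B" "\<not> B \<subseteq> A"
    "\<And>p. p \<in> A \<Longrightarrow> p \<in> B \<Longrightarrow> crosses A B p \<or> crosses B A p"
    using assms(1) unfolding two_components_def by blast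
  obtain \<gamma> where \<gamma>: "generic_immersion \<gamma>" "K = range \<gamma>" using assms(2) unfolding knot_projection_def by blast
  have "\<exists>H. continuous_on ({0..1} \<times> S2) H \<and> (\<forall>t\<in>{0..1 :: real}. \<exists>g. homeomorphism S2 S2 (\<lambda>x. H (t, x)) g) \<and>
      (\<forall>x\<in>S2. H (0, x) = x) \<and> (\<lambda>x. H (1, x)) ` inverse_stereographic ` P = K"
    using assms(3) unfolding ambient_isotopic_def by (elim conjE)
  then obtain H where "continuous_on ({0..1} \<times> S2) H \<and> (\<forall>t\<in>{0..1 :: real}. \<exists>g. homeomorphism S2 S2 (\<lambda>x. H (t, x)) g) \<and>
      (\<forall>x\<in>S2. H (0, x) = x) \<and> (\<lambda>x. H (1, x)) ` inverse_stereographic ` P = K" by (rule exE)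
  then have H: "\<forall>t\<in>{0..1 :: real}. \<exists>g. homeomorphism S2 S2 (\<lambda>x. H (t, x)) g"
    "(\<lambda>x. H (1, x)) ` inverse_stereographic ` P = K" by simp_all
  obtain g where g: "homeomorphism S2 S2 (\<lambda>x. H (1 :: real, x)) g"
  proof -
    have "\<exists>g. homeomorphism S2 S2 (\<lambda>x. H (1, x)) g" using H(1) by (rule bspec) simp
    then show ?thesis by (elim exE) (rule that)
  qed
  interpret two_strands \<gamma> "\<lambda>x. H (1, x)" g A B
    by unfold_locales (use \<gamma> g H(2) AB in auto)
  show False using one_strand AB(4,5) by blast
qed

lemma connection_of_knot:
  assumes "n \<ge> 1" "\<forall>i\<in>{1..n}. a i \<ge> 1" "two_bridge_knot_projection a n K"
  shows "connection_of a n \<noteq> (if odd n then Zero else Infinity)"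
proof
  assume c: "connection_of a n = (if odd n then Zero else Infinity)"
  have st: "stranded (connection_of a n) (conway_tangle a n)" by (rule stranded_conway_tangle[OF assms(1,2)])
  have "two_components (conway_closure a n)"
  proof (cases "odd n")
    case True
    then show ?thesis using two_components_numerator st c by (simp add: conway_closure_eq)
  next
    case False
    \<comment> \<open>For even \<open>n\<close> the closure is the reflection of the numerator
      closure of the reflected tangle, and the reflection turns the type \<open>Infinity\<close>
      into \<open>Zero\<close>.\<close>
    then have "two_components (tau ` numerator_closure (tau ` conway_tangle a n))"
      using two_components_tau[OF two_components_numerator] stranded_tau[OF st] c by simp
    then show ?thesis using False by (simp add: conway_closure_eq tau_numerator_closure)
  qed
  then show False
    using two_components_not_knot assms(3) unfolding two_bridge_knot_projection_def by blast
qed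

theorem proposition3:
  fixes n :: nat and a :: "nat \<Rightarrow> nat" and K :: "(real \<times> real \<times> real) set"
  assumes "n \<ge> 1"
    and "\<forall>i\<in>{1..n}. a i \<ge> 1"
    and "two_bridge_knot_projection a n K"
  shows "\<exists>T. trivial_spherical_curve T \<and> one_three_homotopic K T"
  using trivial_round_curve two_bridge_trivial[OF assms connection_of_knot[OF assms]] by blast

end
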